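(* Let $T=\{t_1,\dots,t_n\}$ be a finite set of tiles in the integer lattice, each a finite union of lattice squares homeomorphic to a closed disk. Let $\mathcal{R}$ be the set of all regions in the lattice that are homeomorphic to a disk. Let $\mathcal{P}=\langle x,y \mid r_1,\dots,r_n\rangle$ be a presentation of the tile boundary group $G_T$ obtained from some choice of tile basepoints, and let $X_{\mathcal{P}}$ be the associated standard 2-complex (the tile complex). Let $J$ be the submodule of the left $\mathbb{Z}G_T$-module $\pi_2(X_{\mathcal{P}})$ generated by all classes $[\mathbb{B}_\alpha\cdot\mathbb{B}_\beta^{-1}]$, where $\alpha$ and $\beta$ range over all pairs of tilings by $T$ of a common region $\Gamma$, for all $\Gamma\in\mathcal{R}$. Then the tile counting group $G(T,\mathcal{R})$ is isomorphic to the quotient $$H_2(X_{\mathcal{P}})/h(J),$$ where $h:\pi_2(X_{\mathcal{P}})\to H_2(X_{\mathcal{P}})$ is the Hurewicz homomorphism and $H_2(X_{\mathcal{P}})$ is the second cellular homology group.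
   Context: Tiles and tilings. The integer lattice is the tiling of the plane by closed unit squares with integer vertices. A region is a finite union of lattice squares. A tiling $\alpha$ of a region $\Gamma$ by $T$ is a covering of $\Gamma$, without gaps or overlaps, by lattice translates of copies of tiles in $T$ (no rotations). $b_i(\alpha)$ denotes the number of copies of $t_i$ used in $\alpha$. Tile counting group. $G(T,\mathcal{R})=\left(\bigoplus_{i=1}^n\mathbb{Z}t_i\right)/I$, where $I$ is the $\mathbb{Z}$-linear span of all elements $\sum_{i=1}^n b_i(\alpha)t_i-\sum_{i=1}^n b_i(\beta)t_i$, for all tilings $\alpha,\beta$ by $T$ of a common region $\Gamma\in\mathcal{R}$. Tile boundary group. For each $t_i$ choose a basepoint (a lattice point on its boundary). Traverse the boundary of $t_i$ once clockwise from the basepoint, recording $y$ (resp. $y^{-1}$) for each unit vertical edge traversed north (resp. south), and $x$ (resp. $x^{-1}$) for each unit horizontal edge traversed east (resp. west). The resulting word in the free group $F=F(x,y)$ is $r_i$. The tile boundary group is $G_T=F/R$, with $R$ the normal closure of $r_1,\dots,r_n$ in $F$; it is presented by $\mathcal{P}=\langle x,y\mid r_1,\dots,r_n\rangle$. The standard 2-complex $X_{\mathcal{P}}$ has one 0-cell $c^0$, two 1-cells $c^1_x,c^1_y$ and one 2-cell $c^2_{r_i}$ for each $i$, attached to the 1-skeleton $X^1_{\mathcal{P}}$ along the loop spelled by $r_i$. $\pi_1(X_{\mathcal{P}})=G_T$ acts on $\pi_2(X_{\mathcal{P}})$ in the usual way, making it a left $\mathbb{Z}G_T$-module. Pictures.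 A picture over $\mathcal{P}$ consists of an ambient disk with basepoint; finitely many disjoint based disks $\Delta_1,\dots,\Delta_k$ in its interior, each labelled by a relator with exponent $\pm1$; and finitely many pairwise disjoint arcs missing the interiors of the $\Delta_j$, each either a closed loop or with its two ends on boundaries of disks (the $\Delta_j$ or the ambient disk), each labelled by a generator and given a transverse orientation. Reading the arc labels met when traversing $\partial\Delta_j$ clockwise from its basepoint (exponent $+1$ or $-1$ according to whether the path crosses the arc with or against its transverse orientation) must spell the label (relator to its exponent) of $\Delta_j$. The boundary word $\partial\mathbb{B}\in F$ is read in the same way clockwise around the ambient disk. A picture is spherical if no arc meets the boundary of the ambient disk. Pictures are multiplied by concatenation, and $\mathbb{D}^{-1}$ is the planar reflection of $\mathbb{D}$ with the signs of all disks changed. Pictures are taken up to the equivalence generated by planar isotopy and these moves: FLOAT (insert or delete an arc that cuts the ambient disk into two components, one of which contains the global basepoint and all disks and remaining arcs); BRIDGE (local surgery on two adjacent arcs with the same generator label and compatible orientations); FOLD (insert or delete a pair of disks labelled by the same relator with opposite signs, with all arcs of one joined to the other and basepoints in the same region). The group of equivalence classes of pictures is isomorphic to $\pi_2(X_{\mathcal{P}},X^1_{\mathcal{P}})$, a picture being a combinatorial representation of a map of the disk into $X_{\mathcal{P}}$. If $\partial\mathbb{B}=\partial\mathbb{D}$ in $F$, then $\mathbb{B}\cdot\mathbb{D}^{-1}$ is equivalent to a spherical picture, and the subgroup of classes of spherical pictures is isomorphic to $\pi_2(X_{\mathcal{P}})$. The picture of a tiling. For a tiling $\alpha$ of $\Gamma\in\mathcal{R}$,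 with a basepoint on $\partial\Gamma$ fixed for $\Gamma$, $\mathbb{B}_\alpha$ is the based picture over $\mathcal{P}$ that is planar dual to the tiling: $\partial\Gamma$ is the boundary of the ambient disk; each copy of $t_i$ becomes a disk labelled $r_i^{+1}$, with basepoint corresponding to the tile basepoint; each unit edge shared by two tiles gives an arc joining their disks; each unit edge on $\partial\Gamma$ gives an arc from the corresponding disk to the boundary of the ambient disk; arcs are labelled $x$ or $y$ and transversely oriented according to the corresponding edge. Equivalently, $\mathbb{B}_\alpha$ represents the map $(\Gamma,\partial\Gamma)\to(X_{\mathcal{P}},X^1_{\mathcal{P}})$ sending lattice vertices on tile boundaries to $c^0$, horizontal edges (oriented east) to $c^1_x$, vertical edges (oriented north) to $c^1_y$, and each copy of $t_i$ to the 2-cell $c^2_{r_i}$ by its characteristic map. For two tilings $\alpha,\beta$ of the same $\Gamma$, $\mathbb{B}_\alpha\cdot\mathbb{B}_\beta^{-1}$ determines an element of $\pi_2(X_{\mathcal{P}})$. *)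

theory Defs
  imports "HOL-Complex_Analysis.Complex_Analysis" "HOL-Homology.Homology"
begin

section \<open>Tiles, regions and tilings\<close>

text \<open>A finite union of lattice squares is encoded by the finite set of the lower left corners of
  its squares; \<open>plane S\<close> is the subset of the plane that it stands for.\<close>

type_synonym cells = "(int \<times> int) set"

definition lat :: "int \<times> int \<Rightarrow> complex" where
  "lat v = Complex (of_int (fst v)) (of_int (snd v))"

definition plane :: "cells \<Rightarrow> complex set" where
  "plane S = (\<Union>v\<in>S. cbox (lat v) (lat v + Complex 1 1))"

definition translate :: "int \<times> int \<Rightarrow> cells \<Rightarrow> cells" where
  "translate v S = (\<lambda>c. (fst v + fst c, snd v + snd c)) ` S"

definition disk_regions :: "cells set" where
  "disk_regions = {S. finite S \<and> plane S homeomorphic (cball 0 1 :: complex set)}"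

text \<open>A tiling is the set of its placed tiles: \<open>(t, v)\<close> is the copy of \<open>t\<close> translated by \<open>v\<close>.
  Closed squares of distinct cells overlap at most in edges, so ``no overlaps'' means that the
  sets of cells are disjoint.\<close>

type_synonym tiling = "(cells \<times> (int \<times> int)) set"

definition is_tiling :: "cells set \<Rightarrow> cells \<Rightarrow> tiling \<Rightarrow> bool" where
  "is_tiling T \<Gamma> \<alpha> \<longleftrightarrow>
     fst ` \<alpha> \<subseteq> T \<and>
     (\<Union>(t, v)\<in>\<alpha>. translate v t) = \<Gamma> \<and>
     disjoint_family_on (\<lambda>(t, v). translate v t) \<alpha>"

definition tile_count :: "tiling \<Rightarrow> cells \<Rightarrow> nat" where
  "tile_count \<alpha> t = card {v. (t, v) \<in> \<alpha>}"

definition count_vector :: "cells set \<Rightarrow> tiling \<Rightarrow> cells \<Rightarrow>\<^sub>0 int" where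
  "count_vector T \<alpha> = (\<Sum>t\<in>T. frag_cmul (int (tile_count \<alpha> t)) (frag_of t))"

definition tile_counting_group :: "cells set \<Rightarrow> cells set \<Rightarrow> (cells \<Rightarrow>\<^sub>0 int) set monoid" where
  "tile_counting_group T R =
     free_Abelian_group T Mod
       generate (free_Abelian_group T)
         {count_vector T \<alpha> - count_vector T \<beta> | \<alpha> \<beta> \<Gamma>.
            \<Gamma> \<in> R \<and> is_tiling T \<Gamma> \<alpha> \<and> is_tiling T \<Gamma> \<beta>}"


section \<open>Boundary words\<close>

datatype generator = GX | GY

text \<open>The letter \<open>(g, True)\<close> stands for \<open>g\<close>, the letter \<open>(g, False)\<close> for its inverse.\<close>

type_synonym word = "(generator \<times> bool) list"

fun step :: "generator \<times> bool \<Rightarrow> complex" where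
  "step (GX, b) = (if b then 1 else -1)"
| "step (GY, b) = (if b then \<i> else -\<i>)"

definition lattice_vertex :: "int \<times> int \<Rightarrow> word \<Rightarrow> nat \<Rightarrow> complex" where
  "lattice_vertex p w k = lat p + (\<Sum>j<k. step (w ! j))"

text \<open>The path on \<open>[0,1]\<close> that starts at \<open>p\<close> and follows the unit edges spelled by \<open>w\<close> at constant
  speed: the edge number \<open>k\<close> is traversed for \<open>k \<le> length w * s \<le> k + 1\<close>.\<close>

definition lattice_path :: "int \<times> int \<Rightarrow> word \<Rightarrow> real \<Rightarrow> complex" where
  "lattice_path p w s =
     (let u = real (length w) * s; k = nat \<lfloor>u\<rfloor> in
      if k < length w then lattice_vertex p w k + of_real (u - real k) * step (w ! k)
      else lattice_vertex p w (length w))"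

text \<open>The word \<open>w\<close> is read off by traversing the boundary of \<open>S\<close> once clockwise from the lattice
  point \<open>p\<close>.\<close>

definition boundary_word :: "cells \<Rightarrow> int \<times> int \<Rightarrow> word \<Rightarrow> bool" where
  "boundary_word S p w \<longleftrightarrow>
     simple_path (lattice_path p w) \<and>
     pathfinish (lattice_path p w) = pathstart (lattice_path p w) \<and>
     path_image (lattice_path p w) = frontier (plane S) \<and>
     (\<forall>z\<in>interior (plane S). winding_number (lattice_path p w) z = -1)"


section \<open>The standard 2-complex of a presentation on the generators x and y\<close>

text \<open>The points of the complex: the 0-cell, the points of the two open 1-cells (parametrized by
  the open unit interval) and those of the open 2-cells (parametrized by the open unit disk).
  The relators are \<open>r i\<close> for \<open>i \<in> I\<close>.\<close>

datatype 'i cpoint = Vertex | Edge generator real | Face 'i complex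

definition edge_map :: "generator \<Rightarrow> real \<Rightarrow> 'i cpoint" where
  "edge_map g s = (if 0 < s \<and> s < 1 then Edge g s else Vertex)"

definition word_loop :: "word \<Rightarrow> real \<Rightarrow> 'i cpoint" where
  "word_loop w s =
     (let u = real (length w) * s; k = nat \<lfloor>u\<rfloor> in
      if k < length w
      then edge_map (fst (w ! k)) (if snd (w ! k) then u - real k else 1 - (u - real k))
      else Vertex)"

text \<open>The characteristic map of the 2-cell \<open>i\<close>. Going clockwise around the circle, the point
  \<open>exp (- 2 * pi * \<i> * s)\<close> is attached to the point \<open>s\<close> of the loop spelled by \<open>r i\<close>.\<close>

definition face_map :: "('i \<Rightarrow> word) \<Rightarrow> 'i \<Rightarrow> complex \<Rightarrow> 'i cpoint" where
  "face_map r i z =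
     (if norm z < 1 then Face i z else word_loop (r i) (Arg2pi (cnj z) / (2 * pi)))"

definition skeleton0 :: "'i cpoint set" where
  "skeleton0 = {Vertex}"

definition skeleton1 :: "'i cpoint set" where
  "skeleton1 = {Vertex} \<union> {Edge g s | g s. 0 < s \<and> s < 1}"

definition complex_points :: "'i set \<Rightarrow> 'i cpoint set" where
  "complex_points I = skeleton1 \<union> {Face i z | i z. i \<in> I \<and> norm z < 1}"

text \<open>The CW topology: the final topology for the characteristic maps of the cells.\<close>

definition complex_open :: "'i set \<Rightarrow> ('i \<Rightarrow> word) \<Rightarrow> 'i cpoint set \<Rightarrow> bool" where
  "complex_open I r U \<longleftrightarrow>
     U \<subseteq> complex_points I \<and>
     (\<forall>g. openin (top_of_set {0..1}) {s \<in> {0..1}. edge_map g s \<in> U}) \<and>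
     (\<forall>i\<in>I. openin (top_of_set (cball 0 1)) {z \<in> cball 0 1. face_map r i z \<in> U})"

definition presentation_complex :: "'i set \<Rightarrow> ('i \<Rightarrow> word) \<Rightarrow> 'i cpoint topology" where
  "presentation_complex I r = topology (complex_open I r)"

lemma openin_presentation_complex: "openin (presentation_complex I r) U \<longleftrightarrow> complex_open I r U"
proof -
  have int: "complex_open I r (U \<inter> V)" if "complex_open I r U" "complex_open I r V" for U V
  proof -
    have *: "{s \<in> A. f s \<in> U \<inter> V} = {s \<in> A. f s \<in> U} \<inter> {s \<in> A. f s \<in> V}"
      for A :: "'z set" and f by auto
    show ?thesis
      using that unfolding complex_open_def * by (auto intro: openin_Int)
  qed
  have un: "complex_open I r (\<Union>\<K>)" if "\<forall>K\<in>\<K>. complex_open I r K" for \<K>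
  proof -
    have *: "{s \<in> A. f s \<in> \<Union>\<K>} = (\<Union>K\<in>\<K>. {s \<in> A. f s \<in> K})"
      for A :: "'z set" and f by auto
    show ?thesis
      using that unfolding complex_open_def *
      by (intro conjI allI ballI openin_Union) blast+
  qed
  have "istopology (complex_open I r)"
    unfolding istopology_def using int un by blast
  then show ?thesis
    by (simp add: presentation_complex_def topology_inverse')
qed


section \<open>The second homotopy group as a module over the fundamental group\<close>

definition square :: "(real \<times> real) set" where
  "square = {(x, y). max \<bar>x\<bar> \<bar>y\<bar> \<le> 1}"

definition square_boundary :: "(real \<times> real) set" where
  "square_boundary = {(x, y). max \<bar>x\<bar> \<bar>y\<bar> = 1}"

definition spheroids :: "'a topology \<Rightarrow> 'a \<Rightarrow> (real \<times> real \<Rightarrow> 'a) set" where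
  "spheroids X x0 =
     {f. continuous_map (top_of_set square) X f \<and> f ` square_boundary \<subseteq> {x0}}"

definition pi2_class :: "'a topology \<Rightarrow> 'a \<Rightarrow> (real \<times> real \<Rightarrow> 'a) \<Rightarrow> (real \<times> real \<Rightarrow> 'a) set" where
  "pi2_class X x0 f =
     {g. homotopic_with (\<lambda>h. h ` square_boundary \<subseteq> {x0}) (top_of_set square) X f g}"

definition juxtapose :: "(real \<times> real \<Rightarrow> 'a) \<Rightarrow> (real \<times> real \<Rightarrow> 'a) \<Rightarrow> real \<times> real \<Rightarrow> 'a" where
  "juxtapose f g = (\<lambda>(x, y). if x \<le> 0 then f (2 * x + 1, y) else g (2 * x - 1, y))"

definition pi2 :: "'a topology \<Rightarrow> 'a \<Rightarrow> (real \<times> real \<Rightarrow> 'a) set monoid" where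
  "pi2 X x0 =
     \<lparr>carrier = pi2_class X x0 ` spheroids X x0,
      monoid.mult = (\<lambda>A B. \<Union>f\<in>A. \<Union>g\<in>B. pi2_class X x0 (juxtapose f g)),
      one = pi2_class X x0 (\<lambda>_. x0)\<rparr>"

definition loops :: "'a topology \<Rightarrow> 'a \<Rightarrow> (real \<Rightarrow> 'a) set" where
  "loops X x0 = {\<gamma>. pathin X \<gamma> \<and> \<gamma> 0 = x0 \<and> \<gamma> 1 = x0}"

text \<open>The usual left action of the fundamental group: \<open>f\<close> is shrunk to the inner square and \<open>\<gamma>\<close> is
  inserted on the radial segments, running inwards. The class of the result depends only on the
  homotopy classes of \<open>\<gamma>\<close> and \<open>f\<close>.\<close>

definition transport :: "(real \<Rightarrow> 'a) \<Rightarrow> (real \<times> real \<Rightarrow> 'a) \<Rightarrow> real \<times> real \<Rightarrow> 'a" where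
  "transport \<gamma> f =
     (\<lambda>(x, y). if max \<bar>x\<bar> \<bar>y\<bar> \<le> 1/2 then f (2 * x, 2 * y) else \<gamma> (2 - 2 * max \<bar>x\<bar> \<bar>y\<bar>))"

definition pi1_action ::
    "'a topology \<Rightarrow> 'a \<Rightarrow> (real \<Rightarrow> 'a) \<Rightarrow> (real \<times> real \<Rightarrow> 'a) set \<Rightarrow> (real \<times> real \<Rightarrow> 'a) set" where
  "pi1_action X x0 \<gamma> A = (\<Union>f\<in>A. pi2_class X x0 (transport \<gamma> f))"

text \<open>Submodules over the integral group ring of the fundamental group are the subgroups that are
  stable under the action of the group.\<close>

definition pi2_submodule :: "'a topology \<Rightarrow> 'a \<Rightarrow> (real \<times> real \<Rightarrow> 'a) set set \<Rightarrow> bool" where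
  "pi2_submodule X x0 J \<longleftrightarrow>
     subgroup J (pi2 X x0) \<and> (\<forall>\<gamma>\<in>loops X x0. \<forall>A\<in>J. pi1_action X x0 \<gamma> A \<in> J)"

definition generated_submodule ::
    "'a topology \<Rightarrow> 'a \<Rightarrow> (real \<times> real \<Rightarrow> 'a) set set \<Rightarrow> (real \<times> real \<Rightarrow> 'a) set set" where
  "generated_submodule X x0 S = \<Inter>{J. pi2_submodule X x0 J \<and> S \<subseteq> J}"


section \<open>Cellular homology and the Hurewicz homomorphism\<close>

text \<open>The cellular chain groups are the relative groups \<open>H\<^sub>k(X\<^sup>k, X\<^sup>k\<^sup>-\<^sup>1)\<close>. As \<open>X\<^sup>2 = X\<close> and there are no
  3-cells, the second cellular homology group is the kernel of the cellular boundary map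
  \<open>H\<^sub>2(X, X\<^sup>1) \<rightarrow> H\<^sub>1(X\<^sup>1) \<rightarrow> H\<^sub>1(X\<^sup>1, X\<^sup>0)\<close>.\<close>

definition cellular_boundary2 ::
    "'i set \<Rightarrow> ('i \<Rightarrow> word) \<Rightarrow> 'i cpoint chain set \<Rightarrow> 'i cpoint chain set" where
  "cellular_boundary2 I r =
     (let X = presentation_complex I r; X1 = subtopology X skeleton1 in
      hom_induced 1 X1 {} X1 skeleton0 id \<circ> hom_boundary 2 X skeleton1)"

definition cellular_H2 :: "'i set \<Rightarrow> ('i \<Rightarrow> word) \<Rightarrow> 'i cpoint chain set monoid" where
  "cellular_H2 I r =
     (let X = presentation_complex I r; C2 = relative_homology_group 2 X skeleton1 in
      C2\<lparr>carrier :=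
           kernel C2 (relative_homology_group 1 (subtopology X skeleton1) skeleton0)
             (cellular_boundary2 I r)\<rparr>)"

text \<open>A generator of the infinite cyclic group \<open>H\<^sub>2(square, square_boundary)\<close>, that is, an
  orientation of the 2-sphere.\<close>

definition fundamental_class :: "(real \<times> real) chain set" where
  "fundamental_class =
     (let G = relative_homology_group 2 (top_of_set square) square_boundary in
      SOME c. c \<in> carrier G \<and> generate G {c} = carrier G)"

text \<open>The class of \<open>f\<close> is sent to the image under \<open>f\<close> of the fundamental class in
  \<open>H\<^sub>2(X) = H\<^sub>2(X, X\<^sup>0)\<close>, followed by the identification of singular with cellular homology that is
  induced by the inclusion \<open>(X, X\<^sup>0) \<rightarrow> (X, X\<^sup>1)\<close>.\<close>

definition hurewicz ::
    "'i set \<Rightarrow> ('i \<Rightarrow> word) \<Rightarrow> (real \<times> real \<Rightarrow> 'i cpoint) set \<Rightarrow> 'i cpoint chain set" where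
  "hurewicz I r A =
     (let X = presentation_complex I r; f = (SOME f. f \<in> A) in
      hom_induced 2 X skeleton0 X skeleton1 id
        (hom_induced 2 (top_of_set square) square_boundary X skeleton0 f fundamental_class))"


section \<open>The spherical classes given by pairs of tilings\<close>

text \<open>An identification of a tile with the closed disk under which the clockwise boundary path of
  the tile becomes the attaching path of the 2-cell. It is unique up to homotopy relative to the
  boundary.\<close>

definition tile_chart :: "cells \<Rightarrow> int \<times> int \<Rightarrow> word \<Rightarrow> (complex \<Rightarrow> complex) \<Rightarrow> bool" where
  "tile_chart t p w \<kappa> \<longleftrightarrow>
     (\<exists>\<kappa>'. homeomorphism (cball 0 1) (plane t) \<kappa> \<kappa>') \<and>
     (\<forall>s\<in>{0..1}. \<kappa> (exp (- (2 * of_real pi * of_real s * \<i>))) = lattice_path p w s)"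

text \<open>The map of a tiled region to the complex that sends each copy of \<open>t\<close> to the 2-cell \<open>t\<close> by its
  characteristic map. Hence lattice vertices on tile boundaries go to the 0-cell, and horizontal
  (vertical) edges on tile boundaries, oriented east (north), to the 1-cell of x (of y).\<close>

definition tiling_map ::
    "(cells \<Rightarrow> word) \<Rightarrow> (cells \<Rightarrow> complex \<Rightarrow> complex) \<Rightarrow> tiling \<Rightarrow> complex \<Rightarrow> cells cpoint" where
  "tiling_map r \<kappa> \<alpha> x =
     (THE c. \<exists>t v z. (t, v) \<in> \<alpha> \<and> z \<in> cball 0 1 \<and> x = lat v + \<kappa> t z \<and> c = face_map r t z)"

text \<open>An orientation preserving identification of the closed disk, based at 1, with a region,
  based at \<open>b\<close>.\<close>

definition region_chart :: "cells \<Rightarrow> int \<times> int \<Rightarrow> (complex \<Rightarrow> complex) \<Rightarrow> bool" where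
  "region_chart \<Gamma> b \<phi> \<longleftrightarrow>
     (\<exists>\<phi>'. homeomorphism (cball 0 1) (plane \<Gamma>) \<phi> \<phi>') \<and>
     \<phi> 1 = lat b \<and>
     winding_number (\<phi> \<circ> circlepath 0 1) (\<phi> 0) = 1"

text \<open>The map \<open>[0,1] \<times> [-1,1] \<rightarrow> cball 0 1\<close> below collapses the sides \<open>a = 0\<close> and \<open>y = \<plusminus>1\<close> to the
  basepoint 1, wraps the side \<open>a = 1\<close> once around the circle and is injective elsewhere.\<close>

definition cone_map :: "real \<Rightarrow> real \<Rightarrow> complex" where
  "cone_map a y = 1 + of_real a * (exp (of_real (pi * (y + 1)) * \<i>) - 1)"

text \<open>The product of the picture of \<open>\<alpha>\<close> (left half of the square) with the planar reflection of the
  picture of \<open>\<beta>\<close> (right half), \<open>A\<close> and \<open>B\<close> being the maps of the two tilings. The two maps agree on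
  the boundary of the region, along which the two halves are joined; the boundary of the square
  goes to the basepoint, so that the result is spherical.\<close>

definition product_with_mirror ::
    "(complex \<Rightarrow> complex) \<Rightarrow> (complex \<Rightarrow> 'a) \<Rightarrow> (complex \<Rightarrow> 'a) \<Rightarrow> real \<times> real \<Rightarrow> 'a" where
  "product_with_mirror \<phi> A B =
     (\<lambda>(x, y). if x \<le> 0 then A (\<phi> (cone_map (1 + x) y)) else B (\<phi> (cone_map (1 - x) y)))"

text \<open>The classes of the products, for the tile basepoints \<open>p\<close>, relators \<open>r\<close> and region basepoints
  \<open>b\<close>. The class for \<open>\<alpha>\<close> and \<open>\<beta>\<close> does not depend on the charts.\<close>

definition tiling_pair_classes ::
    "cells set \<Rightarrow> cells set \<Rightarrow> (cells \<Rightarrow> int \<times> int) \<Rightarrow> (cells \<Rightarrow> word) \<Rightarrow> (cells \<Rightarrow> int \<times> int) \<Rightarrow>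
     (real \<times> real \<Rightarrow> cells cpoint) set set" where
  "tiling_pair_classes T R p r b =
     {pi2_class (presentation_complex T r) Vertex
        (product_with_mirror \<phi> (tiling_map r \<kappa> \<alpha>) (tiling_map r \<kappa> \<beta>)) | \<kappa> \<phi> \<alpha> \<beta> \<Gamma>.
        \<Gamma> \<in> R \<and> is_tiling T \<Gamma> \<alpha> \<and> is_tiling T \<Gamma> \<beta> \<and>
        (\<forall>t\<in>T. tile_chart t (p t) (r t) (\<kappa> t)) \<and> region_chart \<Gamma> (b \<Gamma>) \<phi>}"

definition tiling_submodule ::
    "cells set \<Rightarrow> cells set \<Rightarrow> (cells \<Rightarrow> int \<times> int) \<Rightarrow> (cells \<Rightarrow> word) \<Rightarrow> (cells \<Rightarrow> int \<times> int) \<Rightarrow>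
     (real \<times> real \<Rightarrow> cells cpoint) set set" where
  "tiling_submodule T R p r b =
     generated_submodule (presentation_complex T r) Vertex (tiling_pair_classes T R p r b)"

end

theory Submission
  imports Defs
begin

text \<open>Since tile boundaries are closed curves in the plane, the two circle valued maps winding along the
  edge of one generator extend over all faces (as \<open>exp (2 \<pi> i x)\<close> and \<open>exp (2 \<pi> i y)\<close> do on a tile).
  They detect the first homology of the 1-skeleton relative to the vertex, so the cellular boundary
  vanishes and \<open>H\<^sub>2\<close> is free abelian on the faces. The image in it of a tiling of a disk is the sum of
  the faces of its tiles, because the local degree is 1 at the centre of every tile; hence the
  Hurewicz map sends the class of a pair of tilings to the difference of their tile counts. As it is
  a homomorphism that does not see the action of the fundamental group, it maps the submodule \<open>J\<close>
  onto the subgroup spanned by these differences.\<close>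

section \<open>Attaching cells\<close>

text \<open>Homology is computed from excision, homotopy invariance and exactness. Everything is
  reduced to attaching cells, in four situations: the complex over its 1-skeleton, the 1-skeleton
  over the vertex, a tiled region over the tile boundaries, and the square over its boundary with a
  middle segment. Cells come as squares, disks and intervals, hence the positively homogeneous gauge
  \<open>N\<close>. A class is recognised by its images relative to the complements of single open
  cells. Two points need care. \<open>fundamental_class\<close> is an arbitrary generator;
  \<open>disk_class\<close> is its image and the unit for faces and tiles alike, so its sign
  cancels, provided that tile charts and region charts have the same orientation. They do: the
  boundary words and the attaching circle both run clockwise. Secondly, the action of the
  fundamental group drags the boundary of a spheroid along a loop, which is no homotopy of pairs;
  its invariance is obtained on the sphere that collapses the boundary, where classes lift to
  absolute homology.\<close>

locale cell_model =
  fixes N :: "'e::real_normed_vector \<Rightarrow> real"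
  assumes cont_N: "continuous_on UNIV N"
    and nonneg_N: "N x \<ge> 0"
    and scale_N: "c \<ge> 0 \<Longrightarrow> N (c *\<^sub>R x) = c * N x"
    and compact_N: "compact {x. N x \<le> 1}"
begin

definition cell :: "'e set" where "cell = {x. N x \<le> 1}"

definition rim :: "'e set" where "rim = {x. N x = 1}"

definition core :: "'e set" where "core = {x. N x \<le> 1/2}"

text \<open>Radial push towards the rim. The cap \<open>1 / max (N x) (1/2)\<close> keeps points of
  \<open>cell\<close> inside it and is attained at \<open>s = 1\<close>, so that everything outside
  \<open>core\<close> lands on \<open>rim\<close>, while \<open>core\<close> is blown up to the
  whole cell. The \<open>1/2\<close> under \<open>max\<close> also avoids a singularity at the
  origin.\<close>

definition stretch :: "real \<Rightarrow> 'e \<Rightarrow> 'e" where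
  "stretch s x = min (1 + s) (1 / max (N x) (1/2)) *\<^sub>R x"

lemma compact_cell: "compact cell"
  using compact_N by (simp add: cell_def)

lemma closed_core: "closed core"
  unfolding core_def by (rule closed_Collect_le[OF cont_N continuous_on_const])

lemma closed_rim: "closed rim"
proof -
  have "rim = {x. N x \<le> 1} \<inter> {x. 1 \<le> N x}" by (auto simp: rim_def)
  then show ?thesis
    using closed_Collect_le[OF cont_N continuous_on_const] closed_Collect_le[OF continuous_on_const cont_N]
    by (metis closed_Int)
qed

lemma rim_subset: "rim \<subseteq> cell"
  by (auto simp: cell_def rim_def)

lemma core_subset: "core \<subseteq> cell - rim"
  by (auto simp: cell_def rim_def core_def)

lemma N_stretch: "s \<ge> 0 \<Longrightarrow> N (stretch s x) = min (1 + s) (1 / max (N x) (1/2)) * N x"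
  unfolding stretch_def by (rule scale_N) auto

lemma stretch_0: "x \<in> cell \<Longrightarrow> stretch 0 x = x"
  using nonneg_N[of x] by (auto simp: stretch_def cell_def min_def max_def divide_simps)

lemma stretch_rim: "s \<ge> 0 \<Longrightarrow> x \<in> rim \<Longrightarrow> stretch s x = x"
  by (auto simp: stretch_def rim_def min_def max_def)

lemma stretch_cell:
  assumes "s \<ge> 0" "x \<in> cell" shows "stretch s x \<in> cell"
proof -
  have "min (1 + s) (1 / max (N x) (1/2)) * N x \<le> (1 / max (N x) (1/2)) * N x"
    using nonneg_N[of x] by (intro mult_right_mono) auto
  also have "\<dots> \<le> 1" by (auto simp: max_def divide_simps)
  finally show ?thesis using assms by (simp add: cell_def N_stretch)
qed

lemma stretch_not_core:
  assumes "s \<ge> 0" "x \<in> cell - core" shows "stretch s x \<in> cell - core"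
proof -
  have x: "1/2 < N x" "N x \<le> 1" using assms by (auto simp: cell_def core_def)
  have "1/2 < 1 * N x" using x by simp
  also have "1 * N x \<le> min (1 + s) (1 / max (N x) (1/2)) * N x"
    using nonneg_N[of x] assms x by (intro mult_right_mono) (auto simp: max_def)
  also have "\<dots> = N (stretch s x)" using N_stretch[OF assms(1)] by simp
  finally have "1/2 < N (stretch s x)" .
  then have "stretch s x \<notin> core" by (simp add: core_def)
  then show ?thesis using stretch_cell assms by auto
qed

lemma stretch_1: "x \<in> cell - core \<Longrightarrow> stretch 1 x \<in> rim"
  by (auto simp: rim_def core_def cell_def N_stretch min_def max_def divide_simps split: if_splits)

lemma continuous_stretch: "continuous_on UNIV (\<lambda>(s, x). stretch s x)"
proof -
  have "continuous_on UNIV (\<lambda>z. N (snd z :: 'e))"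
    by (rule continuous_on_compose2[OF cont_N]) (auto intro: continuous_intros)
  then have "continuous_on UNIV (\<lambda>z::real\<times>'e. stretch (fst z) (snd z))"
    unfolding stretch_def by (intro continuous_intros) auto
  then show ?thesis by (simp add: case_prod_unfold)
qed

text \<open>No embedding is demanded on the open cell: that \<xi> is a homeomorphism there will
  follow from compactness of the cell and the Hausdorff property of \<open>Y\<close>.\<close>

definition attaches :: "'y topology \<Rightarrow> 'y set \<Rightarrow> ('e \<Rightarrow> 'y) \<Rightarrow> bool" where
  "attaches Y A \<xi> \<longleftrightarrow>
     continuous_map (top_of_set cell) Y \<xi> \<and> \<xi> ` rim \<subseteq> A \<and>
     inj_on \<xi> (cell - rim) \<and> \<xi> ` (cell - rim) \<inter> A = {}"

end

section \<open>Excision for one cell attached to a closed subspace\<close>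

locale cell_attachment = cell_model N for N :: "'e::real_normed_vector \<Rightarrow> real" +
  fixes Y :: "'y topology" and A :: "'y set" and \<xi> :: "'e \<Rightarrow> 'y"
  assumes Hausdorff: "Hausdorff_space Y"
    and closed_A: "closedin Y A"
    and cover: "topspace Y = A \<union> \<xi> ` cell"
    and attaches: "attaches Y A \<xi>"
begin

lemma cont: "continuous_map (top_of_set cell) Y \<xi>"
  and rim_A: "\<And>x. x \<in> rim \<Longrightarrow> \<xi> x \<in> A"
  and inj: "inj_on \<xi> (cell - rim)"
  and interior_A: "\<And>x. x \<in> cell - rim \<Longrightarrow> \<xi> x \<notin> A"
  using attaches by (auto simp: attaches_def)

text \<open>Compactness of the cell makes \<xi> closed, which replaces an explicit assumption that
  \<open>Y\<close> carries the quotient topology.\<close>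

lemma closed_map_chi: "closed_map (top_of_set cell) Y \<xi>"
  using continuous_imp_closed_map[OF cont] compact_cell Hausdorff
  by (simp add: compact_space_subtopology)

text \<open>\<open>stretch\<close> carried over to \<open>Y\<close>. As \<open>stretch\<close> fixes
  the rim, extending by the identity on \<open>A\<close> is consistent even where \<xi> identifies
  rim points.\<close>

definition spread :: "real \<Rightarrow> 'y \<Rightarrow> 'y" where
  "spread s y = (if y \<in> \<xi> ` (cell - rim)
     then \<xi> (stretch s (the_inv_into (cell - rim) \<xi> y)) else y)"

lemma spread_chi:
  assumes "s \<ge> 0" "x \<in> cell" shows "spread s (\<xi> x) = \<xi> (stretch s x)"
proof (cases "x \<in> rim")
  case True
  then have "\<xi> x \<notin> \<xi> ` (cell - rim)" using rim_A interior_A by (metis imageE)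
  then show ?thesis using True assms by (simp add: spread_def stretch_rim)
next
  case False
  then show ?thesis using assms inj by (auto simp: spread_def the_inv_into_f_f)
qed

lemma spread_A: "y \<in> A \<Longrightarrow> spread s y = y"
  using interior_A by (auto simp: spread_def)

lemma spread_0: "spread 0 y = y"
  using inj by (auto simp: spread_def the_inv_into_f_f stretch_0)

abbreviation collar :: "'y set" where "collar \<equiv> topspace Y - \<xi> ` core"

text \<open>Rim points go into \<open>A\<close> and interior points stay out of \<open>A\<close>, so
  a point of the image of the core has only one preimage in the cell.\<close>

lemma chi_core:
  assumes "x \<in> cell" shows "\<xi> x \<in> \<xi> ` core \<longleftrightarrow> x \<in> core"
proof
  assume "\<xi> x \<in> \<xi> ` core"
  then obtain x' where x': "x' \<in> core" "\<xi> x = \<xi> x'" by auto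
  then have "x' \<in> cell - rim" using core_subset by auto
  moreover have "x \<notin> rim" using rim_A[of x] interior_A[OF calculation] x' by auto
  ultimately show "x \<in> core" using x' assms inj_onD[OF inj, of x x'] by auto
qed auto

lemma openin_collar: "openin Y collar"
proof -
  have "closedin (top_of_set cell) core"
    using closed_core core_subset by (auto simp: closedin_subtopology_Int_closedin intro!: closed_subset)
  then have "closedin Y (\<xi> ` core)"
    using closed_map_chi by (auto simp: closed_map_def)
  then show ?thesis by blast
qed

lemma A_collar: "A \<subseteq> collar"
  using closedin_subset[OF closed_A] interior_A core_subset by blast

lemma spread_topspace: "s \<ge> 0 \<Longrightarrow> y \<in> topspace Y \<Longrightarrow> spread s y \<in> topspace Y"
  using cover by (auto simp: spread_A spread_chi stretch_cell)

lemma spread_collar: "s \<ge> 0 \<Longrightarrow> y \<in> collar \<Longrightarrow> spread s y \<in> collar"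
proof -
  assume s: "s \<ge> 0" and y: "y \<in> collar"
  show ?thesis
  proof (cases "y \<in> A")
    case False
    then obtain x where x: "x \<in> cell" "y = \<xi> x" using y cover by auto
    then have "x \<notin> core" using y by auto
    then show ?thesis using s x stretch_not_core[of s x] spread_topspace[of s y] y
      by (auto simp: spread_chi chi_core)
  qed (use y spread_A in auto)
qed

lemma spread_1_collar: "y \<in> collar \<Longrightarrow> spread 1 y \<in> A"
proof (cases "y \<in> A")
  case False
  assume y: "y \<in> collar"
  then obtain x where x: "x \<in> cell" "y = \<xi> x" using False cover by auto
  then have "x \<notin> core" using y by auto
  then show ?thesis using x stretch_1 rim_A by (auto simp: spread_chi)
qed (simp add: spread_A)

text \<open>Preimages of closed sets are glued from two closed pieces: over \<open>A\<close>, where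
  nothing moves, and over the cell, where the piece is the image of a closed set under
  \<open>?q\<close>. Compactness of the time interval times the cell makes \<open>?q\<close>
  closed.\<close>

lemma continuous_spread:
  "continuous_map (prod_topology (top_of_set {0..1}) Y) Y (\<lambda>(s, y). spread s y)"
proof -
  let ?I = "top_of_set {0..1::real}"
  let ?q = "\<lambda>(s::real, x). (s, \<xi> x)"
  have "continuous_map (prod_topology ?I (top_of_set cell)) (prod_topology ?I Y) ?q"
    using continuous_map_prod_top[of ?I "top_of_set cell" ?I Y id \<xi>] cont by (simp add: id_def)
  moreover have "compact_space (prod_topology ?I (top_of_set cell))"
    using compact_cell unfolding compact_space_prod_topology by (simp add: compact_space_subtopology)
  moreover have "Hausdorff_space (prod_topology ?I Y)"
    using Hausdorff by (simp add: Hausdorff_space_prod_topology Hausdorff_space_subtopology)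
  ultimately have q: "closed_map (prod_topology ?I (top_of_set cell)) (prod_topology ?I Y) ?q"
    by (metis continuous_imp_closed_map)
  have st: "continuous_map (prod_topology ?I (top_of_set cell)) (top_of_set cell) (\<lambda>(s, x). stretch s x)"
    using continuous_on_subset[OF continuous_stretch, of "{0..1} \<times> cell"] stretch_cell
    by (auto simp: continuous_map_in_subtopology)
  have g: "continuous_map (prod_topology ?I (top_of_set cell)) Y (\<lambda>(s, x). \<xi> (stretch s x))"
    using continuous_map_compose[OF st cont] by (simp add: o_def case_prod_unfold)
  show ?thesis
    unfolding continuous_map_closedin
  proof (intro conjI allI impI)
    fix C assume C: "closedin Y C"
    let ?R = "{z \<in> topspace (prod_topology ?I (top_of_set cell)). (\<lambda>(s, x). \<xi> (stretch s x)) z \<in> C}"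
    have "closedin (prod_topology ?I Y) (?q ` ?R)"
      using q g C by (auto simp: closed_map_def continuous_map_closedin)
    moreover have "closedin (prod_topology ?I Y) ({0..1} \<times> (A \<inter> C))"
      using closed_A C by (auto simp: closedin_prod_Times_iff)
    moreover have "{z \<in> topspace (prod_topology ?I Y). (\<lambda>(s, y). spread s y) z \<in> C}
        = {0..1} \<times> (A \<inter> C) \<union> ?q ` ?R"
    proof -
      have "(s, y) \<in> {0..1} \<times> (A \<inter> C) \<union> ?q ` ?R"
        if z: "s \<in> {0..1}" "y \<in> topspace Y" "spread s y \<in> C" for s y
      proof (cases "y \<in> A")
        case False
        then obtain x where "x \<in> cell" "y = \<xi> x" using z(2) cover by blast
        then show ?thesis using z
          by (auto simp: spread_chi intro!: image_eqI[where x = "(s, x)"])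
      qed (use z spread_A in auto)
      moreover have "A \<subseteq> topspace Y" by (simp add: closed_A closedin_subset)
      ultimately show ?thesis using cover by (auto simp: spread_A spread_chi)
    qed
    ultimately show "closedin (prod_topology ?I Y)
        {z \<in> topspace (prod_topology ?I Y). (\<lambda>(s, y). spread s y) z \<in> C}" by auto
  qed (auto simp: spread_topspace)
qed

lemma continuous_spread_1: "continuous_map Y Y (spread 1)"
proof -
  have "continuous_map Y (prod_topology (top_of_set {0..1}) Y) (\<lambda>y. (1::real, y))"
    by (simp add: continuous_map_pairedI)
  from continuous_map_compose[OF this continuous_spread] show ?thesis by (simp add: o_def)
qed

lemma homotopic_spread:
  assumes "\<And>s. 0 \<le> s \<Longrightarrow> P (spread s)"
  shows "homotopic_with P Y Y (spread 1) id"
proof (rule homotopic_with_sym[THEN iffD1])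
  show "homotopic_with P Y Y id (spread 1)"
  unfolding homotopic_with_def
    using continuous_spread assms
    by (intro exI[of _ "\<lambda>(s, y). spread s y"]) (auto simp: spread_0)
qed

text \<open>\<open>spread 1\<close> is a homotopy inverse of the inclusion of pairs: it pushes the
  collar into \<open>A\<close>, and the homotopy to the identity preserves both \<open>A\<close> and
  the collar.\<close>

lemma iso_collar:
  "hom_induced p Y A Y collar id \<in> iso (relative_homology_group p Y A) (relative_homology_group p Y collar)"
proof -
  have "homotopic_with (\<lambda>h. h \<in> A \<rightarrow> A) Y Y (spread 1) id"
    by (rule homotopic_spread) (auto simp: spread_A)
  moreover have "homotopic_with (\<lambda>h. h \<in> collar \<rightarrow> collar) Y Y (spread 1) id"
    by (rule homotopic_spread) (use spread_collar in blast)
  ultimately have "group_isomorphisms (relative_homology_group p Y A) (relative_homology_group p Y collar)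
      (hom_induced p Y A Y collar id) (hom_induced p Y collar Y A (spread 1))"
    using A_collar spread_1_collar continuous_spread_1
    by (intro homotopy_equivalence_relative_homology_group_isomorphisms) auto
  then show ?thesis by (rule group_isomorphisms_imp_iso)
qed

text \<open>The reason for thickening \<open>A\<close>: excision wants the closure of the excised
  set inside the interior of the other one, and \<open>A\<close> is closed while the collar is
  open.\<close>

lemma iso_excision:
  "hom_induced p (subtopology Y (topspace Y - A)) (collar - A) Y collar id
     \<in> iso (relative_homology_group p (subtopology Y (topspace Y - A)) (collar - A))
           (relative_homology_group p Y collar)"
  using homology_excision_axiom[of Y A collar "topspace Y" p] A_collar closed_A openin_collar
  by (simp add: closure_of_closedin interior_of_openin)

text \<open>Restricted over the complement of \<open>A\<close>, the closed map \<xi> stays closed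
  and becomes bijective.\<close>

lemma homeomorphic_interior:
  "homeomorphic_map (subtopology (top_of_set cell) (cell - rim)) (subtopology Y (topspace Y - A)) \<xi>"
proof (rule bijective_closed_imp_homeomorphic_map)
  have e: "{x \<in> topspace (top_of_set cell). \<xi> x \<in> topspace Y - A} = cell - rim"
    using rim_A interior_A cover by auto
  show "closed_map (subtopology (top_of_set cell) (cell - rim)) (subtopology Y (topspace Y - A)) \<xi>"
    using closed_map_restriction[OF closed_map_chi e] by simp
  show "continuous_map (subtopology (top_of_set cell) (cell - rim)) (subtopology Y (topspace Y - A)) \<xi>"
    using cont interior_A cover
    by (auto simp: continuous_map_in_subtopology continuous_map_from_subtopology)
  show "\<xi> ` topspace (subtopology (top_of_set cell) (cell - rim)) = topspace (subtopology Y (topspace Y - A))"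
    using e cover interior_A rim_A by (auto simp: image_iff)
  show "inj_on \<xi> (topspace (subtopology (top_of_set cell) (cell - rim)))"
    using inj by (simp add: inj_on_def)
qed

end

context cell_model begin

text \<open>The cell counts as attached to its own rim, so that thickening and excision are
  available on the source side of \<xi> as well.\<close>

lemma cell_attachment_id: "cell_attachment N (top_of_set cell) rim (\<lambda>x. x)"
proof unfold_locales
  show "closedin (top_of_set cell) rim"
    using closed_rim rim_subset by (simp add: closed_subset)
  show "attaches (top_of_set cell) rim (\<lambda>x. x)"
    by (auto simp: attaches_def)
qed (use rim_subset in \<open>auto simp: Hausdorff_space_subtopology\<close>)

end

lemma bij_betw_square:
  assumes "bij_betw a A B" "bij_betw a' A' B'" "\<And>x. x \<in> A \<Longrightarrow> g (a x) = a' (f x)" "f ` A \<subseteq> A'" "g ` B \<subseteq> B'"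
  shows "bij_betw f A A' \<longleftrightarrow> bij_betw g B B'"
proof -
  have "bij_betw f A A' \<longleftrightarrow> bij_betw (a' \<circ> f) A B'"
    by (rule bij_betw_comp_iff2) (use assms in auto)
  also have "\<dots> \<longleftrightarrow> bij_betw (g \<circ> a) A B'"
    by (rule bij_betw_cong) (use assms in auto)
  also have "\<dots> \<longleftrightarrow> bij_betw g B B'"
    by (rule bij_betw_comp_iff[symmetric]) (use assms in auto)
  finally show ?thesis .
qed

context cell_attachment begin

text \<open>Two naturality squares join three levels: relative to rim and \<open>A\<close>, relative
  to the collars, and after excision. On the last level \<xi> is a homeomorphism of pairs, and
  bijectivity climbs back through the squares.\<close>

theorem iso_cell:
  "hom_induced p (top_of_set cell) rim Y A \<xi>
     \<in> iso (relative_homology_group p (top_of_set cell) rim) (relative_homology_group p Y A)"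
proof -
  interpret D: cell_attachment N "top_of_set cell" rim "\<lambda>x. x"
    by (rule cell_attachment_id)
  let ?D = "top_of_set cell"
  let ?Di = "subtopology ?D (cell - rim)" and ?Yi = "subtopology Y (topspace Y - A)"
  let ?W = "cell - core"
  have W: "D.collar = ?W" by simp
  have chi_W: "\<xi> \<in> ?W \<rightarrow> collar" using chi_core cover by auto
  have chi_D0: "\<xi> ` (?W - rim) = collar - A"
  proof
    show "\<xi> ` (?W - rim) \<subseteq> collar - A" using chi_core cover interior_A by auto
    show "collar - A \<subseteq> \<xi> ` (?W - rim)" using cover rim_A by auto
  qed
  have c0: "hom_induced p ?Di (?W - rim) ?Yi (collar - A) \<xi>
      \<in> iso (relative_homology_group p ?Di (?W - rim)) (relative_homology_group p ?Yi (collar - A))"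
    by (rule homeomorphic_map_relative_homology_iso[OF homeomorphic_interior _ chi_D0]) auto
  have cont0: "continuous_map ?Di ?Yi \<xi>"
    using homeomorphic_interior homeomorphic_imp_continuous_map by blast
  have carr: "hom_induced p X S Z T f ` carrier (relative_homology_group p X S) \<subseteq> carrier (relative_homology_group p Z T)"
    for X :: "'u topology" and Z :: "'v topology" and S T f
    by (auto simp: hom_induced_carrier)
  have "bij_betw (hom_induced p ?Di (?W - rim) ?Yi (collar - A) \<xi>)
     (carrier (relative_homology_group p ?Di (?W - rim))) (carrier (relative_homology_group p ?Yi (collar - A)))
    \<longleftrightarrow> bij_betw (hom_induced p ?D ?W Y collar \<xi>)
     (carrier (relative_homology_group p ?D ?W)) (carrier (relative_homology_group p Y collar))"
  proof (rule bij_betw_square[OF _ _ _ carr carr])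
    show "bij_betw (hom_induced p ?Di (?W - rim) ?D ?W id)
        (carrier (relative_homology_group p ?Di (?W - rim))) (carrier (relative_homology_group p ?D ?W))"
      using D.iso_excision[of p] by (simp add: iso_def)
    show "bij_betw (hom_induced p ?Yi (collar - A) Y collar id)
        (carrier (relative_homology_group p ?Yi (collar - A))) (carrier (relative_homology_group p Y collar))"
      using iso_excision[of p] by (simp add: iso_def)
    have i1: "continuous_map ?Di ?D id" "continuous_map ?Yi Y id"
      by (auto simp: continuous_map_from_subtopology)
    have m1: "\<xi> \<in> (?W - rim) \<rightarrow> collar - A" using chi_D0 by blast
    show "hom_induced p ?D ?W Y collar \<xi> (hom_induced p ?Di (?W - rim) ?D ?W id x)
      = hom_induced p ?Yi (collar - A) Y collar id (hom_induced p ?Di (?W - rim) ?Yi (collar - A) \<xi> x)" for x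
      by (subst hom_induced_compose'[OF i1(1) _ cont chi_W], force)
        (subst hom_induced_compose'[OF cont0 m1 i1(2)], auto)
  qed
  then have cW: "bij_betw (hom_induced p ?D ?W Y collar \<xi>)
     (carrier (relative_homology_group p ?D ?W)) (carrier (relative_homology_group p Y collar))"
    using c0 by (simp add: iso_def)
  have "bij_betw (hom_induced p ?D rim Y A \<xi>)
     (carrier (relative_homology_group p ?D rim)) (carrier (relative_homology_group p Y A))
    \<longleftrightarrow> bij_betw (hom_induced p ?D ?W Y collar \<xi>)
     (carrier (relative_homology_group p ?D ?W)) (carrier (relative_homology_group p Y collar))"
  proof (rule bij_betw_square[OF _ _ _ carr carr])
    show "bij_betw (hom_induced p ?D rim ?D ?W id)
        (carrier (relative_homology_group p ?D rim)) (carrier (relative_homology_group p ?D ?W))"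
      using D.iso_collar[of p] by (simp add: iso_def)
    show "bij_betw (hom_induced p Y A Y collar id)
        (carrier (relative_homology_group p Y A)) (carrier (relative_homology_group p Y collar))"
      using iso_collar[of p] by (simp add: iso_def)
    have m: "\<xi> \<in> rim \<rightarrow> A" "id \<in> rim \<rightarrow> ?W" "id \<in> A \<rightarrow> collar"
      using rim_A A_collar core_subset rim_subset by auto
    show "hom_induced p ?D ?W Y collar \<xi> (hom_induced p ?D rim ?D ?W id x)
      = hom_induced p Y A Y collar id (hom_induced p ?D rim Y A \<xi> x)" for x
      by (subst hom_induced_compose'[OF _ m(2) cont chi_W], force)
         (subst hom_induced_compose'[OF cont m(1) _ m(3)], auto)
  qed
  then show ?thesis using cW by (simp add: iso_def hom_induced_hom)
qed

end

section \<open>Finitely many cells attached at once\<close>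

locale cell_family = cell_model N for N :: "'e::real_normed_vector \<Rightarrow> real" +
  fixes Y :: "'y topology" and A :: "'y set" and J :: "'j set" and \<xi> :: "'j \<Rightarrow> 'e \<Rightarrow> 'y"
  assumes Hausdorff: "Hausdorff_space Y"
    and closed_A: "closedin Y A"
    and finite_J: "finite J"
    and cover: "topspace Y = A \<union> (\<Union>j\<in>J. \<xi> j ` cell)"
    and attaches: "\<And>j. j \<in> J \<Longrightarrow> attaches Y A (\<xi> j)"
    and disjoint: "\<And>i j. i \<in> J \<Longrightarrow> j \<in> J \<Longrightarrow> i \<noteq> j \<Longrightarrow> \<xi> i ` (cell - rim) \<inter> \<xi> j ` (cell - rim) = {}"
begin

abbreviation off :: "'j \<Rightarrow> 'y set" where "off j \<equiv> topspace Y - \<xi> j ` (cell - rim)"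

lemma chi_rim: "j \<in> J \<Longrightarrow> x \<in> rim \<Longrightarrow> \<xi> j x \<in> A"
  and chi_interior: "j \<in> J \<Longrightarrow> x \<in> cell - rim \<Longrightarrow> \<xi> j x \<notin> A"
  and cont_chi: "j \<in> J \<Longrightarrow> continuous_map (top_of_set cell) Y (\<xi> j)"
  and inj_chi: "j \<in> J \<Longrightarrow> inj_on (\<xi> j) (cell - rim)"
  using attaches[of j] by (auto simp: attaches_def)

lemma closed_cell: "j \<in> J \<Longrightarrow> closedin Y (\<xi> j ` cell)"
  using continuous_imp_closed_map[OF cont_chi _ Hausdorff] compact_cell
  by (simp add: closed_map_def compact_space_subtopology)

lemma off_eq: 
  assumes j: "j \<in> J" shows "off j = A \<union> (\<Union>i\<in>J - {j}. \<xi> i ` cell)"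
proof
  show "off j \<subseteq> A \<union> (\<Union>i\<in>J - {j}. \<xi> i ` cell)"
  proof
    fix y assume y: "y \<in> off j"
    show "y \<in> A \<union> (\<Union>i\<in>J - {j}. \<xi> i ` cell)"
    proof (cases "y \<in> \<xi> j ` cell")
      case True
      then show ?thesis using y chi_rim[OF j] by auto
    next
      case False
      then show ?thesis using y cover by blast
    qed
  qed
  have *: "\<xi> i x \<notin> \<xi> j ` (cell - rim)" if "i \<in> J - {j}" "x \<in> cell" for i x
  proof (cases "x \<in> rim")
    case True
    then show ?thesis using chi_rim[of i x] chi_interior[OF j] that by auto
  next
    case False
    then show ?thesis using disjoint[of i j] j that by blast
  qed
  have "A \<inter> \<xi> j ` (cell - rim) = {}" using chi_interior[OF j] by auto
  moreover have "(\<Union>i\<in>J - {j}. \<xi> i ` cell) \<inter> \<xi> j ` (cell - rim) = {}"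
  proof (rule equals0I)
    fix y assume "y \<in> (\<Union>i\<in>J - {j}. \<xi> i ` cell) \<inter> \<xi> j ` (cell - rim)"
    then obtain i x where "i \<in> J - {j}" "x \<in> cell" "y = \<xi> i x" "y \<in> \<xi> j ` (cell - rim)" by blast
    then show False using * by blast
  qed
  ultimately show "A \<union> (\<Union>i\<in>J - {j}. \<xi> i ` cell) \<subseteq> off j"
    using cover by auto
qed

lemma A_off: "j \<in> J \<Longrightarrow> A \<subseteq> off j"
  using off_eq by auto

lemma closed_off: "j \<in> J \<Longrightarrow> closedin Y (off j)"
  unfolding off_eq using closed_A closed_cell finite_J by (intro closedin_Un closedin_Union) auto

text \<open>All cells but one are absorbed into the base, which leaves a single attached
  cell.\<close>

lemma cell_attachment: "j \<in> J \<Longrightarrow> cell_attachment N Y (off j) (\<xi> j)"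
proof unfold_locales
  assume j: "j \<in> J"
  show "topspace Y = off j \<union> \<xi> j ` cell"
    using cover j by auto
  show "attaches Y (off j) (\<xi> j)"
    using attaches[OF j] A_off[OF j] by (auto simp: attaches_def)
qed (simp_all add: Hausdorff closed_off)

lemma iso_cell:
  "j \<in> J \<Longrightarrow> hom_induced p (top_of_set cell) rim Y (off j) (\<xi> j)
     \<in> iso (relative_homology_group p (top_of_set cell) rim) (relative_homology_group p Y (off j))"
  using cell_attachment.iso_cell[OF cell_attachment] .

end

text \<open>Induction over the cells. A class that dies relative to \<open>off j\<close> comes, by
  exactness of the triple, from the subspace \<open>off j\<close>, which carries one cell less.
  There it dies relative to the complement of each remaining cell too, because the local groups of
  these cells do not change.\<close>

theorem (in cell_model) joint_injectivity:
  assumes "cell_family N Y A J \<xi>"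
    and "w \<in> carrier (relative_homology_group p Y A)"
    and "\<And>j. j \<in> J \<Longrightarrow> hom_induced p Y A Y (topspace Y - \<xi> j ` (cell - rim)) id w
            = \<one>\<^bsub>relative_homology_group p Y (topspace Y - \<xi> j ` (cell - rim))\<^esub>"
  shows "w = \<one>\<^bsub>relative_homology_group p Y A\<^esub>"
proof -
  have "finite J" using assms(1) by (simp add: cell_family_def cell_family_axioms_def)
  then show ?thesis using assms
  proof (induction J arbitrary: Y w rule: finite_induct)
    case empty
    interpret cell_family N Y A "{}" \<xi> by fact
    have "trivial_group (relative_homology_group p Y A)"
      using trivial_relative_homology_group_topspace[of p Y] cover by simp
    then show ?case using empty.prems by (simp add: trivial_group_def)
  next
    case (insert j J)
    interpret cell_family N Y A "insert j J" \<xi> by fact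
    let ?B = "off j"
    let ?Y = "subtopology Y ?B"
    have B: "?B = A \<union> (\<Union>i\<in>J. \<xi> i ` cell)"
      using off_eq[of j] insert.hyps by simp
    have inc: "continuous_map ?Y Y id" by (simp add: continuous_map_from_subtopology)
    have family: "cell_family N ?Y A J \<xi>"
    proof unfold_locales
      show "closedin ?Y A" using closed_A A_off[of j] by (simp add: closedin_subset_topspace closedin_closed_subtopology closed_off)
      show "topspace ?Y = A \<union> (\<Union>i\<in>J. \<xi> i ` cell)"
        using B by auto
      show "attaches ?Y A (\<xi> i)" if "i \<in> J" for i
      proof -
        have "\<xi> i \<in> cell \<rightarrow> ?B" using that unfolding B by auto
        then show ?thesis using attaches[of i] that by (auto simp: attaches_def continuous_map_in_subtopology)
      qed
      show "\<xi> i ` (cell - rim) \<inter> \<xi> k ` (cell - rim) = {}" if "i \<in> J" "k \<in> J" "i \<noteq> k" for i k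
        using disjoint that by blast
    qed (use insert.hyps Hausdorff in \<open>auto simp: Hausdorff_space_subtopology\<close>)
    interpret Y': cell_family N ?Y A J \<xi> by (rule family)
    have "w \<in> kernel (relative_homology_group p Y A) (relative_homology_group p Y ?B) (hom_induced p Y A Y ?B id)"
      using insert.prems(2) insert.prems(3)[of j] by (simp add: kernel_def id_def)
    then obtain w' where w': "w' \<in> carrier (relative_homology_group p ?Y A)" "w = hom_induced p ?Y A Y A id w'"
      using homology_exactness_triple_3[OF A_off[of j], of p] by auto
    have "w' = \<one>\<^bsub>relative_homology_group p ?Y A\<^esub>"
    proof (rule insert.IH[OF family w'(1)])
      fix i assume i: "i \<in> J"
      let ?r = "hom_induced p ?Y A ?Y (Y'.off i) id" and ?g = "hom_induced p ?Y (Y'.off i) Y (off i) id"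
      have gf: "?g (hom_induced p (top_of_set cell) rim ?Y (Y'.off i) (\<xi> i) x)
          = hom_induced p (top_of_set cell) rim Y (off i) (\<xi> i) x" for x
      proof (subst hom_induced_compose'[OF Y'.cont_chi[OF i] _ inc])
        show "\<xi> i \<in> rim \<rightarrow> Y'.off i" using Y'.chi_rim[OF i] Y'.A_off[OF i] by blast
        show "id \<in> Y'.off i \<rightarrow> off i" by auto
      qed simp
      \<comment> \<open>Both local groups are identified with the group of the model cell by the
        same characteristic map.\<close>
      have "bij_betw ?g (carrier (relative_homology_group p ?Y (Y'.off i))) (carrier (relative_homology_group p Y (off i)))"
      proof (subst bij_betw_comp_iff)
        show "bij_betw (hom_induced p (top_of_set cell) rim ?Y (Y'.off i) (\<xi> i))
            (carrier (relative_homology_group p (top_of_set cell) rim)) (carrier (relative_homology_group p ?Y (Y'.off i)))"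
          using Y'.iso_cell[OF i, of p] by (simp add: iso_def)
        show "bij_betw (?g \<circ> hom_induced p (top_of_set cell) rim ?Y (Y'.off i) (\<xi> i))
            (carrier (relative_homology_group p (top_of_set cell) rim)) (carrier (relative_homology_group p Y (off i)))"
          unfolding o_def gf using iso_cell[of i p] i by (simp add: iso_def)
      qed
      then have "inj_on ?g (carrier (relative_homology_group p ?Y (Y'.off i)))"
        by (simp add: bij_betw_def)
      moreover have "?g (?r w') = ?g \<one>\<^bsub>relative_homology_group p ?Y (Y'.off i)\<^esub>"
      proof -
        have "?g (?r w') = hom_induced p ?Y A Y (off i) id w'"
          by (subst hom_induced_compose'[OF _ _ inc]) (use Y'.A_off[OF i] in auto)
        also have "\<dots> = hom_induced p Y A Y (off i) id w"
          unfolding w'(2) by (subst hom_induced_compose'[OF inc]) (use A_off[of i] i in auto)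
        also have "\<dots> = \<one>\<^bsub>relative_homology_group p Y (off i)\<^esub>" using insert.prems(3)[of i] i by blast
        also have "\<dots> = ?g \<one>\<^bsub>relative_homology_group p ?Y (Y'.off i)\<^esub>"
          by (intro hom_one[symmetric] hom_induced_hom) auto
        finally show ?thesis .
      qed
      ultimately show "?r w' = \<one>\<^bsub>relative_homology_group p ?Y (Y'.off i)\<^esub>"
        by (rule inj_onD) (simp_all only: hom_induced_carrier group.is_monoid monoid.one_closed group_relative_homology_group)
    qed
    then show ?case
      using w'(2) hom_one[OF hom_induced_hom] by (metis group_relative_homology_group)
  qed
qed

section \<open>Homology of the square\<close>

definition supnorm :: "real \<times> real \<Rightarrow> real" where
  "supnorm z = max \<bar>fst z\<bar> \<bar>snd z\<bar>"

lemma square_iff: "(x, y) \<in> square \<longleftrightarrow> -1 \<le> x \<and> x \<le> 1 \<and> -1 \<le> y \<and> y \<le> 1"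
  by (auto simp: square_def)

lemma square_boundary_iff:
  "(x, y) \<in> square_boundary \<longleftrightarrow> (x, y) \<in> square \<and> (x = 1 \<or> x = -1 \<or> y = 1 \<or> y = -1)"
  by (auto simp: square_def square_boundary_def max_def split: if_splits)

lemma square_eq_Times: "square = {-1..1} \<times> {-1..1}"
  by (auto simp: square_iff)

lemma square_supnorm: "square = {z. supnorm z \<le> 1}"
  by (auto simp: square_def supnorm_def)

lemma square_boundary_supnorm: "square_boundary = {z. supnorm z = 1}"
  by (auto simp: square_boundary_def supnorm_def)

lemma compact_square: "compact square"
  by (simp add: square_eq_Times compact_Times)

lemma convex_square: "convex square"
  by (simp add: square_eq_Times convex_Times)

lemma square_boundary_subset: "square_boundary \<subseteq> square"
  by (auto simp: square_boundary_iff)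

interpretation sq: cell_model supnorm
proof
  show "continuous_on UNIV supnorm"
    unfolding supnorm_def by (intro continuous_intros)
  show "supnorm z \<ge> 0" for z by (simp add: supnorm_def le_max_iff_disj)
  show "c \<ge> 0 \<Longrightarrow> supnorm (c *\<^sub>R z) = c * supnorm z" for c z
    by (simp add: supnorm_def abs_mult max_mult_distrib_left)
  show "compact {z. supnorm z \<le> 1}"
    using compact_square by (simp add: square_supnorm)
qed

lemma sq_cell: "sq.cell = square" and sq_rim: "sq.rim = square_boundary"
  by (auto simp: sq.cell_def sq.rim_def square_supnorm square_boundary_supnorm)

text \<open>The map factors through the group of \<open>T\<close> modulo itself, which is
  trivial.\<close>

lemma hom_induced_into_subset:
  assumes f: "continuous_map X Y f" "f \<in> topspace X \<rightarrow> T" "f \<in> S \<rightarrow> T"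
  shows "hom_induced p X S Y T f c = \<one>\<^bsub>relative_homology_group p Y T\<^esub>"
proof -
  \<comment> \<open>\<open>T\<close> may stick out of \<open>topspace Y\<close>; relative groups
    only see its intersection with the space.\<close>
  have *: "relative_homology_group p (subtopology Y T) T
      = relative_homology_group p (subtopology Y T) (topspace (subtopology Y T))"
    by (metis Int_commute inf.idem inf_left_commute relative_homology_group_restrict topspace_subtopology)
  have "trivial_group (relative_homology_group p (subtopology Y T) T)"
    unfolding * by (rule trivial_relative_homology_group_topspace)
  then have 1: "hom_induced p X S (subtopology Y T) T f c = \<one>\<^bsub>relative_homology_group p (subtopology Y T) T\<^esub>"
    using hom_induced_carrier[of p X S "subtopology Y T" T f c] by (simp add: trivial_group_def)
  have "hom_induced p X S Y T f c
      = hom_induced p (subtopology Y T) T Y T id (hom_induced p X S (subtopology Y T) T f c)"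
    using f by (subst hom_induced_compose')
      (auto simp: continuous_map_in_subtopology continuous_map_from_subtopology)
  then show ?thesis
    unfolding 1 using hom_one[OF hom_induced_hom] by (metis group_relative_homology_group)
qed

lemma homotopic_with_linear_path:
  fixes f g :: "'a::topological_space \<Rightarrow> 'b::real_normed_vector"
  assumes f: "continuous_on S f" "f ` S \<subseteq> C" and g: "continuous_on S g" "g ` S \<subseteq> C"
    and C: "convex C"
    and P: "\<And>t. t \<in> {0..1} \<Longrightarrow> P (\<lambda>z. (1 - t) *\<^sub>R f z + t *\<^sub>R g z)"
  shows "homotopic_with P (top_of_set S) (top_of_set C) f g"
proof -
  let ?h = "\<lambda>z. (1 - fst z) *\<^sub>R f (snd z) + fst z *\<^sub>R g (snd z)"
  have "continuous_on ({0..1} \<times> S) ?h"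
    by (intro continuous_intros continuous_on_compose2[OF f(1)] continuous_on_compose2[OF g(1)]) auto
  moreover have "?h \<in> {0..1} \<times> S \<rightarrow> C"
    using f(2) g(2) C by (auto intro!: convexD)
  ultimately show ?thesis
    unfolding homotopic_with_def using P
    by (intro exI[of _ ?h]) (auto simp: continuous_map_in_subtopology)
qed

section \<open>Cutting the square into two halves\<close>

definition theta_graph :: "(real \<times> real) set" where
  "theta_graph = square_boundary \<union> {z \<in> square. fst z = 0}"

text \<open>The characteristic maps of a cell structure on the square with two 2-cells and
  1-skeleton \<open>theta_graph\<close>; \<open>True\<close> stands for the right half.\<close>

definition half_square :: "bool \<Rightarrow> real \<times> real \<Rightarrow> real \<times> real" where
  "half_square j = (\<lambda>(x, y). ((x + (if j then 1 else -1)) / 2, y))"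

lemma theta_graph_iff: "(x, y) \<in> theta_graph \<longleftrightarrow> (x, y) \<in> square_boundary \<or> (x, y) \<in> square \<and> x = 0"
  by (auto simp: theta_graph_def)

lemma theta_graph_subset: "theta_graph \<subseteq> square"
  using square_boundary_subset by (auto simp: theta_graph_def)

lemma continuous_half_square: "continuous_on S (half_square j)"
  unfolding half_square_def case_prod_unfold by (intro continuous_intros) auto

lemma half_square_mem:
  "z \<in> square \<Longrightarrow> half_square j z \<in> square"
  "z \<in> square_boundary \<Longrightarrow> half_square j z \<in> theta_graph"
  by (cases z; cases j; auto simp: half_square_def square_boundary_iff theta_graph_iff square_iff)+

lemma halves_family: "cell_family supnorm (top_of_set square) theta_graph UNIV half_square"
proof unfold_locales
  have "closed {z \<in> square. fst z = 0}"
    using closed_Collect_eq[of "fst :: real \<times> real \<Rightarrow> real" "\<lambda>_. 0"] compact_imp_closed[OF compact_square]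
    by (simp add: Collect_conj_eq closed_Int continuous_on_fst continuous_on_id)
  then show "closedin (top_of_set square) theta_graph"
    using sq.closed_rim theta_graph_subset by (auto simp: theta_graph_def sq_rim intro!: closed_subset)
  show "topspace (top_of_set square) = theta_graph \<union> (\<Union>j\<in>UNIV. half_square j ` sq.cell)"
  proof
    show "topspace (top_of_set square) \<subseteq> theta_graph \<union> (\<Union>j\<in>UNIV. half_square j ` sq.cell)"
    proof
      fix z assume z: "z \<in> topspace (top_of_set square)"
      obtain x y where [simp]: "z = (x, y)" by fastforce
      have "z = half_square (x > 0) (if x > 0 then 2 * x - 1 else 2 * x + 1, y)"
        by (simp add: half_square_def)
      moreover have "(if x > 0 then 2 * x - 1 else 2 * x + 1, y) \<in> square"
        using z by (auto simp: square_iff)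
      ultimately show "z \<in> theta_graph \<union> (\<Union>j\<in>UNIV. half_square j ` sq.cell)"
        unfolding sq_cell by blast
    qed
  qed (use theta_graph_subset half_square_mem in \<open>auto simp: sq_cell\<close>)
  show "sq.attaches (top_of_set square) theta_graph (half_square j)" for j
    unfolding sq.attaches_def sq_cell sq_rim
  proof (intro conjI)
    show "continuous_map (top_of_set square) (top_of_set square) (half_square j)"
      using half_square_mem(1) by (auto simp: continuous_half_square)
    show "inj_on (half_square j) (square - square_boundary)"
      by (auto simp: inj_on_def half_square_def)
    show "half_square j ` (square - square_boundary) \<inter> theta_graph = {}"
      by (cases j) (auto simp: half_square_def theta_graph_iff square_boundary_iff square_iff)
  qed (use half_square_mem in auto)
  show "half_square i ` (sq.cell - sq.rim) \<inter> half_square j ` (sq.cell - sq.rim) = {}" if "i \<noteq> j" for i j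
    using that unfolding sq_cell sq_rim
    by (cases i; cases j) (auto simp: half_square_def square_boundary_iff square_iff)
qed (auto simp: Hausdorff_space_subtopology)

text \<open>The inclusion is homotopic to either half, as a map to the square modulo the complement of
  the interior of that half.\<close>

theorem square_subdivision:
  assumes c: "c \<in> carrier (relative_homology_group p (top_of_set square) square_boundary)"
  shows "hom_induced p (top_of_set square) square_boundary (top_of_set square) theta_graph id c
    = hom_induced p (top_of_set square) square_boundary (top_of_set square) theta_graph (half_square False) c
      \<otimes>\<^bsub>relative_homology_group p (top_of_set square) theta_graph\<^esub>
      hom_induced p (top_of_set square) square_boundary (top_of_set square) theta_graph (half_square True) c"
    (is "?d = ?e False \<otimes>\<^bsub>?H\<^esub> ?e True")
proof -
  interpret cell_family supnorm "top_of_set square" theta_graph UNIV half_square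
    by (rule halves_family)
  interpret H: comm_group ?H by simp
  let ?Sq = "top_of_set square"
  have carr: "?d \<in> carrier ?H" "?e j \<in> carrier ?H" for j by (simp_all add: hom_induced_carrier)
  \<comment> \<open>The defect of the asserted sum; by joint injectivity it vanishes once it
    vanishes relative to the complement of each open half.\<close>
  define w where "w = ?d \<otimes>\<^bsub>?H\<^esub> inv\<^bsub>?H\<^esub> (?e False \<otimes>\<^bsub>?H\<^esub> ?e True)"
  have "w = \<one>\<^bsub>?H\<^esub>"
  proof (rule sq.joint_injectivity[OF halves_family])
    show "w \<in> carrier ?H" unfolding w_def using carr by simp
    fix j :: bool
    let ?K = "relative_homology_group p ?Sq (off j)"
    interpret K: comm_group ?K by simp
    let ?r = "hom_induced p ?Sq theta_graph ?Sq (off j) id"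
    interpret r: group_hom ?H ?K ?r
      by (simp add: group_hom_def group_hom_axioms_def hom_induced_hom)
    have A: "id \<in> theta_graph \<rightarrow> off j" using A_off[of j] by auto
    have m: "half_square k \<in> square_boundary \<rightarrow> theta_graph" "id \<in> square_boundary \<rightarrow> theta_graph"
        "continuous_map ?Sq ?Sq (half_square k)" for k
      using half_square_mem by (auto simp: theta_graph_def continuous_half_square)
    have re: "?r (?e k) = hom_induced p ?Sq square_boundary ?Sq (off j) (half_square k) c" for k
      by (subst hom_induced_compose'[OF m(3) m(1) _ A]) auto
    have rd: "?r ?d = hom_induced p ?Sq square_boundary ?Sq (off j) id c"
      by (subst hom_induced_compose'[OF _ m(2) _ A]) auto
    \<comment> \<open>The other half avoids the open half \<open>j\<close> altogether.\<close>
    have r1: "?r (?e k) = \<one>\<^bsub>?K\<^esub>" if "k \<noteq> j" for k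
    proof -
      have "half_square k \<in> square \<rightarrow> off j"
        using half_square_mem(1) that
        by (cases j; cases k) (auto simp: half_square_def sq_cell sq_rim square_boundary_iff square_iff)
      then show ?thesis unfolding re using square_boundary_subset
        by (intro hom_induced_into_subset m(3)) auto
    qed
    have r2: "?r ?d = ?r (?e j)"
    proof -
      have off_j: "off j = {(x, y). (x, y) \<in> square \<and> ((x, y) \<in> square_boundary \<or> (if j then x \<le> 0 else x \<ge> 0))}"
      proof (rule Set.set_eqI)
        fix z :: "real \<times> real"
        obtain x y where z: "z = (x, y)" by fastforce
        define x' where "x' = (if j then 2 * x - 1 else 2 * x + 1)"
        have "(x, y) = half_square j (x', y)"
          by (simp add: half_square_def x'_def)
        moreover have "(x, y) = half_square j u \<Longrightarrow> u = (x', y)" for u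
          by (cases u) (auto simp: half_square_def x'_def)
        ultimately have "(x, y) \<in> half_square j ` (square - square_boundary) \<longleftrightarrow> (x', y) \<in> square - square_boundary"
          by (metis image_iff)
        then show "z \<in> off j \<longleftrightarrow> z \<in> {(x, y). (x, y) \<in> square \<and> ((x, y) \<in> square_boundary \<or> (if j then x \<le> 0 else x \<ge> 0))}"
          unfolding z sq_cell sq_rim
          by (cases j) (auto simp: square_iff square_boundary_iff x'_def)
      qed
      \<comment> \<open>The straight line motion is horizontal. Top and bottom keep their height,
        the outer side of half \<open>j\<close> is fixed and the opposite side slides through the
        other half, so the boundary never enters the open half \<open>j\<close>.\<close>
      have "homotopic_with (\<lambda>h. h \<in> square_boundary \<rightarrow> off j) ?Sq ?Sq id (half_square j)"
      proof (rule homotopic_with_linear_path)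
        fix t :: real assume t: "t \<in> {0..1}"
        show "(\<lambda>z. (1 - t) *\<^sub>R id z + t *\<^sub>R half_square j z) \<in> square_boundary \<rightarrow> off j"
        proof
          fix z assume z: "z \<in> square_boundary"
          obtain x y where xy: "z = (x, y)" by fastforce
          define x' where "x' = (1 - t) * x + t * ((x + (if j then 1 else - 1)) / 2)"
          have e: "(1 - t) *\<^sub>R id z + t *\<^sub>R half_square j z = (x', y)"
            by (auto simp: xy half_square_def x'_def algebra_simps)
          have sq: "z \<in> square" using z square_boundary_subset by auto
          then have "(1 - t) *\<^sub>R id z + t *\<^sub>R half_square j z \<in> square"
            using t half_square_mem(1) by (intro convexD[OF convex_square]) auto
          then have s: "(x', y) \<in> square" using e by simp
          moreover have "(x', y) \<in> square_boundary \<or> (if j then x' \<le> 0 else x' \<ge> 0)"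
          proof -
            consider "y = 1 \<or> y = -1" | "x = 1" | "x = -1" using z by (auto simp: xy square_boundary_iff)
            then show ?thesis
            proof cases
              case 1
              then show ?thesis using s by (simp add: square_boundary_iff)
            next
              case 2
              then have "x' = (if j then 1 else 1 - t)" by (simp add: x'_def)
              then show ?thesis using s t by (auto simp: square_boundary_iff)
            next
              case 3
              then have "x' = (if j then t - 1 else - 1)" by (simp add: x'_def)
              then show ?thesis using s t by (auto simp: square_boundary_iff)
            qed
          qed
          ultimately show "(1 - t) *\<^sub>R id z + t *\<^sub>R half_square j z \<in> off j"
            unfolding e off_j by simp
        qed
      qed (use half_square_mem convex_square in \<open>auto simp: continuous_half_square\<close>)
      then show ?thesis unfolding re rd by (simp add: homology_homotopy_axiom)
    qed
    have rc: "?r x \<in> carrier ?K" for x by (rule hom_induced_carrier)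
    have "?r ?d = ?r (?e False) \<otimes>\<^bsub>?K\<^esub> ?r (?e True)"
    proof (cases j)
      case True
      have "?r (?e False) = \<one>\<^bsub>?K\<^esub>" by (rule r1) (use True in simp)
      moreover have "?r ?d = ?r (?e True)" using r2 by (simp only: True)
      ultimately show ?thesis using K.l_one[OF rc] by metis
    next
      case False
      have "?r (?e True) = \<one>\<^bsub>?K\<^esub>" by (rule r1) (use False in simp)
      moreover have "?r ?d = ?r (?e False)" using r2 by (simp only: False)
      ultimately show ?thesis using K.r_one[OF rc] by metis
    qed
    also have "\<dots> = ?r (?e False \<otimes>\<^bsub>?H\<^esub> ?e True)"
      by (rule r.hom_mult[OF carr(2) carr(2), symmetric])
    finally have "?r ?d = ?r (?e False \<otimes>\<^bsub>?H\<^esub> ?e True)" .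
    then show "?r w = \<one>\<^bsub>?K\<^esub>"
      unfolding w_def using carr rc by (metis K.r_inv r.hom_inv r.hom_mult H.m_closed H.inv_closed)
  qed
  then show ?thesis unfolding w_def using carr by (metis H.inv_closed H.inv_inv H.inv_equality H.m_closed)
qed

definition mirror :: "real \<times> real \<Rightarrow> real \<times> real" where
  "mirror = (\<lambda>(x, y). (- x, y))"

lemma continuous_mirror: "continuous_on S mirror"
  unfolding mirror_def case_prod_unfold by (intro continuous_intros)

lemma mirror_mem: "z \<in> square \<Longrightarrow> mirror z \<in> square" "z \<in> square_boundary \<Longrightarrow> mirror z \<in> square_boundary"
  by (cases z; auto simp: mirror_def square_iff square_boundary_iff)+

text \<open>Folding the square along its middle line gives a map homotopic to a map into the boundary.\<close>

theorem hom_induced_mirror: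
  assumes c: "c \<in> carrier (relative_homology_group p (top_of_set square) square_boundary)"
  shows "hom_induced p (top_of_set square) square_boundary (top_of_set square) square_boundary mirror c
    = inv\<^bsub>relative_homology_group p (top_of_set square) square_boundary\<^esub> c"
proof -
  let ?Sq = "top_of_set square" let ?bd = square_boundary
  let ?G = "relative_homology_group p ?Sq ?bd"
  interpret G: comm_group ?G by simp
  \<comment> \<open>The fold: composed with \<open>half_square False\<close> it is the identity,
    composed with \<open>half_square True\<close> it is \<open>mirror\<close>. The middle segment
    goes to the side \<open>x = 1\<close>, so the theta graph ends up in the boundary.\<close>
  define m :: "real \<times> real \<Rightarrow> real \<times> real" where "m = (\<lambda>(x, y). (1 - 2 * \<bar>x\<bar>, y))"
  have "continuous_on square m"
    unfolding m_def case_prod_unfold by (intro continuous_intros)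
  then have m: "continuous_map ?Sq ?Sq m" "m \<in> theta_graph \<rightarrow> ?bd"
    by (auto simp: m_def square_iff theta_graph_iff square_boundary_iff abs_if)
  have h: "half_square k \<in> ?bd \<rightarrow> theta_graph" "id \<in> ?bd \<rightarrow> theta_graph"
        "continuous_map ?Sq ?Sq (half_square k)" for k
    using half_square_mem by (auto simp: theta_graph_def continuous_half_square)
  let ?m = "hom_induced p ?Sq theta_graph ?Sq ?bd m"
  \<comment> \<open>\<open>m\<close> sends both vertical sides to the side \<open>x = -1\<close> and
    preserves top and bottom, so contracting the first coordinate to \<open>-1\<close> is a homotopy
    of pairs.\<close>
  have "homotopic_with (\<lambda>h. h \<in> ?bd \<rightarrow> ?bd) ?Sq ?Sq m (\<lambda>z. (-1, snd z))"
  proof (rule homotopic_with_linear_path)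
    fix t :: real assume t: "t \<in> {0..1}"
    show "(\<lambda>z. (1 - t) *\<^sub>R m z + t *\<^sub>R (-1, snd z)) \<in> ?bd \<rightarrow> ?bd"
    proof
      fix z assume z: "z \<in> ?bd"
      have "m z \<in> square" "(-1, snd z) \<in> square" using z m(1) square_boundary_subset
        by (cases z; auto simp: square_boundary_iff square_iff)+
      then have "(1 - t) *\<^sub>R m z + t *\<^sub>R (-1, snd z) \<in> square"
        using t by (intro convexD[OF convex_square]) auto
      then show "(1 - t) *\<^sub>R m z + t *\<^sub>R (-1, snd z) \<in> ?bd"
        using z by (cases z) (auto simp: m_def square_boundary_iff algebra_simps)
    qed
  qed (use m convex_square in \<open>auto simp: square_iff intro!: continuous_intros\<close>)
  then have "hom_induced p ?Sq ?bd ?Sq ?bd m c = hom_induced p ?Sq ?bd ?Sq ?bd (\<lambda>z. (-1, snd z)) c"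
    by (simp add: homology_homotopy_axiom)
  also have "\<dots> = \<one>\<^bsub>?G\<^esub>"
    by (rule hom_induced_into_subset) (auto simp: square_iff square_boundary_iff intro!: continuous_intros)
  finally have "\<one>\<^bsub>?G\<^esub> = ?m (hom_induced p ?Sq ?bd ?Sq theta_graph id c)"
    by (subst hom_induced_compose'[OF _ h(2) m]) auto
  also have "\<dots> = ?m (hom_induced p ?Sq ?bd ?Sq theta_graph (half_square False) c)
      \<otimes>\<^bsub>?G\<^esub> ?m (hom_induced p ?Sq ?bd ?Sq theta_graph (half_square True) c)"
    unfolding square_subdivision[OF c] by (rule hom_mult[OF hom_induced_hom]) (auto simp: hom_induced_carrier)
  also have "?m (hom_induced p ?Sq ?bd ?Sq theta_graph (half_square False) c) = hom_induced p ?Sq ?bd ?Sq ?bd id c"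
    by (subst hom_induced_compose'[OF h(3,1) m], rule fun_cong[OF hom_induced_eq])
       (auto simp: m_def half_square_def square_iff field_simps)
  also have "?m (hom_induced p ?Sq ?bd ?Sq theta_graph (half_square True) c) = hom_induced p ?Sq ?bd ?Sq ?bd mirror c"
    by (subst hom_induced_compose'[OF h(3,1) m], rule fun_cong[OF hom_induced_eq])
       (auto simp: m_def half_square_def square_iff mirror_def field_simps)
  finally have "c \<otimes>\<^bsub>?G\<^esub> hom_induced p ?Sq ?bd ?Sq ?bd mirror c = \<one>\<^bsub>?G\<^esub>"
    using c by (simp only: hom_induced_id)
  then show ?thesis using c
    by (metis G.inv_equality G.m_comm hom_induced_carrier)
qed

section \<open>The second homotopy group\<close>

abbreviation spheroid_homotopic ::
    "'a topology \<Rightarrow> 'a \<Rightarrow> (real \<times> real \<Rightarrow> 'a) \<Rightarrow> (real \<times> real \<Rightarrow> 'a) \<Rightarrow> bool" where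
  "spheroid_homotopic X x0 \<equiv> homotopic_with (\<lambda>h. h ` square_boundary \<subseteq> {x0}) (top_of_set square) X"

lemma spheroids_iff:
  "f \<in> spheroids X x0 \<longleftrightarrow> continuous_map (top_of_set square) X f \<and> f ` square_boundary \<subseteq> {x0}"
  by (simp add: spheroids_def)

lemma spheroid_boundary: "f \<in> spheroids X x0 \<Longrightarrow> z \<in> square_boundary \<Longrightarrow> f z = x0"
  by (auto simp: spheroids_iff)

lemma spheroid_homotopic_refl: "f \<in> spheroids X x0 \<Longrightarrow> spheroid_homotopic X x0 f f"
  by (simp add: spheroids_iff)

lemma spheroid_homotopic_imp_spheroids:
  "spheroid_homotopic X x0 f g \<Longrightarrow> f \<in> spheroids X x0 \<and> g \<in> spheroids X x0"
  using homotopic_with_imp_property homotopic_with_imp_continuous_maps unfolding spheroids_iff by blast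

lemma spheroid_homotopic_eq:
  assumes "spheroid_homotopic X x0 f g" "\<And>z. z \<in> square \<Longrightarrow> f' z = f z" "\<And>z. z \<in> square \<Longrightarrow> g' z = g z"
  shows "spheroid_homotopic X x0 f' g'"
  by (rule homotopic_with_eq[OF assms(1)])
     (use assms(2,3) square_boundary_subset in \<open>auto simp: subset_iff image_subset_iff\<close>)

lemma pi2_class_eq_iff:
  assumes "f \<in> spheroids X x0" "g \<in> spheroids X x0"
  shows "pi2_class X x0 f = pi2_class X x0 g \<longleftrightarrow> spheroid_homotopic X x0 f g"
proof
  assume "pi2_class X x0 f = pi2_class X x0 g"
  then have "g \<in> pi2_class X x0 f"
    using spheroid_homotopic_refl[OF assms(2)] by (simp add: pi2_class_def)
  then show "spheroid_homotopic X x0 f g" by (simp add: pi2_class_def)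
next
  assume "spheroid_homotopic X x0 f g"
  then show "pi2_class X x0 f = pi2_class X x0 g"
    unfolding pi2_class_def by (blast intro: homotopic_with_trans homotopic_with_symD)
qed

lemma mem_pi2_class: "f \<in> spheroids X x0 \<Longrightarrow> f \<in> pi2_class X x0 f"
  using spheroid_homotopic_refl by (simp add: pi2_class_def)

lemma pi2_class_mem:
  assumes "g \<in> pi2_class X x0 f"
  shows "g \<in> spheroids X x0" "spheroid_homotopic X x0 f g"
  using assms spheroid_homotopic_imp_spheroids[of x0 X f g] by (simp_all add: pi2_class_def)

lemma const_spheroid: "x0 \<in> topspace X \<Longrightarrow> (\<lambda>_. x0) \<in> spheroids X x0"
  by (auto simp: spheroids_iff)

text \<open>Linear interpolation between \<open>r0\<close> and \<open>r1\<close> leaves both ends on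
  vertical sides, hence the boundary stays in the boundary. Maps that are not monotone are allowed,
  so that associativity, unit and inverse are all instances.\<close>

lemma spheroid_reparam:
  fixes r0 r1 :: "real \<Rightarrow> real"
  assumes f: "f \<in> spheroids X x0"
    and r: "continuous_on {-1..1} r0" "r0 ` {-1..1} \<subseteq> {-1..1}" "continuous_on {-1..1} r1" "r1 ` {-1..1} \<subseteq> {-1..1}"
    and ends: "r0 (-1) = r1 (-1)" "r0 1 = r1 1" "r1 (-1) \<in> {-1, 1}" "r1 1 \<in> {-1, 1}"
  shows "spheroid_homotopic X x0 (\<lambda>(x, y). f (r0 x, y)) (\<lambda>(x, y). f (r1 x, y))"
proof -
  have "homotopic_with (\<lambda>h. h ` square_boundary \<subseteq> square_boundary) (top_of_set square) (top_of_set square)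
      (\<lambda>(x, y). (r0 x, y)) (\<lambda>(x, y). (r1 x, y))"
  proof (rule homotopic_with_linear_path)
    show "continuous_on square (\<lambda>(x, y). (r0 x, y))" "continuous_on square (\<lambda>(x, y). (r1 x, y))"
      unfolding case_prod_unfold square_eq_Times
      by (intro continuous_intros continuous_on_compose2[OF r(1)] continuous_on_compose2[OF r(3)]; auto)+
    show img: "(\<lambda>(x, y). (r0 x, y)) ` square \<subseteq> square" "(\<lambda>(x, y). (r1 x, y)) ` square \<subseteq> square"
      using r(2,4) by (force simp: square_eq_Times)+
    fix t :: real assume t: "t \<in> {0..1}"
    show "(\<lambda>z. (1 - t) *\<^sub>R (case z of (x, y) \<Rightarrow> (r0 x, y)) + t *\<^sub>R (case z of (x, y) \<Rightarrow> (r1 x, y)))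
        ` square_boundary \<subseteq> square_boundary"
    proof (rule image_subsetI)
      fix z assume "z \<in> square_boundary"
      then obtain x y where z: "z = (x, y)" and xy: "(x, y) \<in> square_boundary" by (cases z) auto
      then have "(r0 x, y) \<in> square" "(r1 x, y) \<in> square"
        using img square_boundary_subset by (auto simp: image_subset_iff)
      then have "(1 - t) *\<^sub>R (r0 x, y) + t *\<^sub>R (r1 x, y) \<in> square"
        using t by (intro convexD[OF convex_square]) auto
      then show "(1 - t) *\<^sub>R (case z of (x, y) \<Rightarrow> (r0 x, y)) + t *\<^sub>R (case z of (x, y) \<Rightarrow> (r1 x, y)) \<in> square_boundary"
        unfolding z using xy ends by (auto simp: square_boundary_iff algebra_simps)
    qed
  qed (rule convex_square)
  then have "spheroid_homotopic X x0 (f \<circ> (\<lambda>(x, y). (r0 x, y))) (f \<circ> (\<lambda>(x, y). (r1 x, y)))"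
    by (rule homotopic_with_compose_continuous_map_left) (use f in \<open>auto simp: spheroids_iff\<close>)
  then show ?thesis by (simp add: o_def case_prod_unfold)
qed

text \<open>The parameter set \<open>B\<close> lets one pasting argument serve homotopies
  (\<open>B\<close> the unit interval) and single maps (\<open>B = {0}\<close>).\<close>

lemma continuous_map_juxtapose:
  fixes B :: "real set"
  assumes F: "continuous_map (top_of_set (B \<times> square)) X (\<lambda>(t, z). F t z)"
    and G: "continuous_map (top_of_set (B \<times> square)) X (\<lambda>(t, z). G t z)"
    and FG: "\<And>t y. t \<in> B \<Longrightarrow> y \<in> {-1..1} \<Longrightarrow> F t (1, y) = G t (-1, y)"
  shows "continuous_map (top_of_set (B \<times> square)) X (\<lambda>(t, z). juxtapose (F t) (G t) z)"
proof -
  let ?x = "\<lambda>w :: real \<times> real \<times> real. fst (snd w)" let ?y = "\<lambda>w :: real \<times> real \<times> real. snd (snd w)"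
  let ?S = "B \<times> square"
  have "continuous_map (subtopology (top_of_set ?S) {w \<in> topspace (top_of_set ?S). ?x w \<le> 0})
      X ((\<lambda>(t, z). F t z) \<circ> (\<lambda>w. (fst w, 2 * ?x w + 1, ?y w)))"
    by (rule continuous_map_compose[OF _ F])
       (auto simp: subtopology_subtopology continuous_map_in_subtopology square_iff intro!: continuous_intros)
  moreover have "continuous_map (subtopology (top_of_set ?S) {w \<in> topspace (top_of_set ?S). 0 \<le> ?x w})
      X ((\<lambda>(t, z). G t z) \<circ> (\<lambda>w. (fst w, 2 * ?x w - 1, ?y w)))"
    by (rule continuous_map_compose[OF _ G])
       (auto simp: subtopology_subtopology continuous_map_in_subtopology square_iff intro!: continuous_intros)
  ultimately have "continuous_map (top_of_set ?S) X
      (\<lambda>w. if ?x w \<le> 0 then ((\<lambda>(t, z). F t z) \<circ> (\<lambda>w. (fst w, 2 * ?x w + 1, ?y w))) w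
            else ((\<lambda>(t, z). G t z) \<circ> (\<lambda>w. (fst w, 2 * ?x w - 1, ?y w))) w)"
    by (intro continuous_map_cases_le) (auto simp: FG square_iff o_def case_prod_unfold intro!: continuous_intros)
  then show ?thesis unfolding juxtapose_def case_prod_unfold o_def fst_conv snd_conv .
qed

lemma juxtapose_homotopic:
  assumes "spheroid_homotopic X x0 f f'" "spheroid_homotopic X x0 g g'"
  shows "spheroid_homotopic X x0 (juxtapose f g) (juxtapose f' g')"
proof -
  obtain h where h: "continuous_map (top_of_set ({0..1::real} \<times> square)) X h" "\<And>z. h (0, z) = f z" "\<And>z. h (1, z) = f' z"
      "\<And>t. t \<in> {0..1} \<Longrightarrow> (\<lambda>z. h (t, z)) ` square_boundary \<subseteq> {x0}"
    using assms(1) by (auto simp: homotopic_with_def)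
  obtain k where k: "continuous_map (top_of_set ({0..1::real} \<times> square)) X k" "\<And>z. k (0, z) = g z" "\<And>z. k (1, z) = g' z"
      "\<And>t. t \<in> {0..1} \<Longrightarrow> (\<lambda>z. k (t, z)) ` square_boundary \<subseteq> {x0}"
    using assms(2) by (auto simp: homotopic_with_def)
  let ?J = "\<lambda>t. juxtapose (\<lambda>z. h (t, z)) (\<lambda>z. k (t, z))"
  have hk: "h (t, z) = x0" "k (t, z) = x0" if "t \<in> {0..1}" "z \<in> square_boundary" for t z
    using h(4)[OF that(1)] k(4)[OF that(1)] that(2) by auto
  have "continuous_map (top_of_set ({0..1} \<times> square)) X (\<lambda>(t, z). ?J t z)"
    using h(1) k(1) by (intro continuous_map_juxtapose) (simp_all add: hk square_boundary_iff square_iff)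
  moreover have "?J t ` square_boundary \<subseteq> {x0}" if "t \<in> {0..1}" for t
    using hk[OF that] by (auto simp: juxtapose_def square_boundary_iff square_iff)
  moreover have "?J 0 = juxtapose f g" "?J 1 = juxtapose f' g'" 
    by (simp_all add: h k)
  ultimately show ?thesis
    unfolding homotopic_with_def
    by (intro exI[of _ "\<lambda>(t, z). ?J t z"]) auto
qed

lemma juxtapose_spheroid:
  "f \<in> spheroids X x0 \<Longrightarrow> g \<in> spheroids X x0 \<Longrightarrow> juxtapose f g \<in> spheroids X x0"
  using juxtapose_homotopic spheroid_homotopic_refl spheroid_homotopic_imp_spheroids by metis

text \<open>The product is a union over all representatives; since homotopic factors have homotopic
  juxtapositions, all members of the union coincide.\<close>

lemma pi2_mult:
  assumes f: "f \<in> spheroids X x0" and g: "g \<in> spheroids X x0"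
  shows "pi2_class X x0 f \<otimes>\<^bsub>pi2 X x0\<^esub> pi2_class X x0 g = pi2_class X x0 (juxtapose f g)"
proof -
  have "pi2_class X x0 (juxtapose f' g') = pi2_class X x0 (juxtapose f g)"
    if "f' \<in> pi2_class X x0 f" "g' \<in> pi2_class X x0 g" for f' g'
  proof -
    have "spheroid_homotopic X x0 (juxtapose f g) (juxtapose f' g')"
      by (rule juxtapose_homotopic[OF that[THEN pi2_class_mem(2)]])
    note * = this
    show ?thesis
      using pi2_class_eq_iff[THEN iffD2, OF _ _ *] spheroid_homotopic_imp_spheroids[OF *] by simp
  qed
  then have "(\<Union>f'\<in>pi2_class X x0 f. \<Union>g'\<in>pi2_class X x0 g. pi2_class X x0 (juxtapose f' g'))
      = (\<Union>f'\<in>pi2_class X x0 f. \<Union>g'\<in>pi2_class X x0 g. pi2_class X x0 (juxtapose f g))"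
    by (intro SUP_cong refl)
  also have "\<dots> = pi2_class X x0 (juxtapose f g)"
    using mem_pi2_class[OF f] mem_pi2_class[OF g] by (simp add: ex_in_conv[symmetric]) blast
  finally show ?thesis by (simp add: pi2_def)
qed

lemma carrier_pi2: "carrier (pi2 X x0) = pi2_class X x0 ` spheroids X x0"
  and one_pi2: "\<one>\<^bsub>pi2 X x0\<^esub> = pi2_class X x0 (\<lambda>_. x0)"
  by (simp_all add: pi2_def)

lemma juxtapose_assoc:
  assumes "f \<in> spheroids X x0" "g \<in> spheroids X x0" "h \<in> spheroids X x0"
  shows "spheroid_homotopic X x0 (juxtapose (juxtapose f g) h) (juxtapose f (juxtapose g h))"
proof -
  \<comment> \<open>\<open>?r\<close> is concave and piecewise linear with slopes 2, 1, 1/2 and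
    breaks at \<open>-1/2\<close> and \<open>0\<close>, written as the minimum of its three affine
    pieces so that continuity is immediate. It carries the three blocks of the left bracketing to
    those of the right one.\<close>
  let ?k = "juxtapose f (juxtapose g h)" and ?r = "\<lambda>x::real. min (2 * x + 1) (min (x + 1 / 2) ((x + 1) / 2))"
  have k: "?k \<in> spheroids X x0" by (intro juxtapose_spheroid assms)
  have b: "f (1, y) = x0" "g (-1, y) = x0" "g (1, y) = x0" "h (-1, y) = x0" if "-1 \<le> y" "y \<le> 1" for y
    using assms[THEN spheroid_boundary, of "(1, y)"] assms[THEN spheroid_boundary, of "(-1, y)"] that
    by (simp_all add: square_boundary_iff square_iff)
  have "spheroid_homotopic X x0 (\<lambda>(x, y). ?k (?r x, y)) (\<lambda>(x, y). ?k (x, y))"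
  proof (rule spheroid_reparam[OF k])
    show "continuous_on {-1..1} ?r" by (intro continuous_intros) auto
    show "?r ` {-1..1} \<subseteq> {-1..1}"
    proof
      fix u assume "u \<in> ?r ` {-1..1}"
      then obtain x where x: "u = ?r x" "-1 \<le> x" "x \<le> 1" by auto
      then have "-1 \<le> 2 * x + 1" "-1 \<le> x + 1 / 2" "-1 \<le> (x + 1) / 2" by simp_all
      then have "-1 \<le> ?r x" by (intro min.boundedI)
      moreover have "?r x \<le> (x + 1) / 2" by (rule min.coboundedI2) (rule min.cobounded2)
      ultimately show "u \<in> {-1..1}" using x by simp
    qed
  qed auto
  then show ?thesis
  proof (rule spheroid_homotopic_eq)
    fix z assume "z \<in> square"
    then obtain x y where z: "z = (x, y)" "-1 \<le> x" "x \<le> 1" "-1 \<le> y" "y \<le> 1"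
      by (cases z) (auto simp: square_iff)
    consider "x \<le> -1/2" | "-1/2 < x" "x \<le> 0" | "0 < x" by linarith
    then show "juxtapose (juxtapose f g) h z = (case z of (x, y) \<Rightarrow> ?k (?r x, y))"
    proof cases
      case 1
      then have "?r x = 2 * x + 1" by (simp add: min_def)
      then show ?thesis using 1 z by (simp add: juxtapose_def)
    next
      case 2
      then have "?r x = x + 1 / 2" by (simp add: min_def)
      then show ?thesis using 2 z b by (simp add: juxtapose_def algebra_simps)
    next
      case 3
      then have "?r x = (x + 1) / 2" by (simp add: min_def)
      moreover have "4 * ((x + 1) / 2) - 3 = 2 * x - 1" by (simp add: field_simps)
      ultimately show ?thesis using 3 z b by (simp add: juxtapose_def field_simps)
    qed
  qed auto
qed

lemma juxtapose_const_left:
  assumes "f \<in> spheroids X x0"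
  shows "spheroid_homotopic X x0 (juxtapose (\<lambda>_. x0) f) f"
proof -
  \<comment> \<open>The cut-off at \<open>-1\<close> spends the left half on the side
    \<open>x = -1\<close>, where \<open>f\<close> equals \<open>x0\<close>.\<close>
  have "spheroid_homotopic X x0 (\<lambda>(x, y). f (max (-1) (2 * x - 1), y)) (\<lambda>(x, y). f (x, y))"
  proof (rule spheroid_reparam[OF assms])
    show "continuous_on {-1..1} (\<lambda>x::real. max (-1) (2 * x - 1))" by (intro continuous_intros)
  qed auto
  then show ?thesis
    by (rule spheroid_homotopic_eq)
       (use assms in \<open>auto simp: juxtapose_def max_def square_iff square_boundary_iff spheroid_boundary\<close>)
qed

lemma mirror_spheroid: "f \<in> spheroids X x0 \<Longrightarrow> f \<circ> mirror \<in> spheroids X x0"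
  using continuous_map_compose[of "top_of_set square" "top_of_set square" mirror X f] mirror_mem
  by (auto simp: spheroids_iff continuous_mirror image_subset_iff Pi_iff)

lemma juxtapose_mirror_left:
  assumes "f \<in> spheroids X x0"
  shows "spheroid_homotopic X x0 (juxtapose (f \<circ> mirror) f) (\<lambda>_. x0)"
proof -
  \<comment> \<open>There and back: \<open>2 * \<bar>x\<bar> - 1\<close> starts and ends at 1, so it
    deforms to the constant 1, where \<open>f\<close> equals \<open>x0\<close>.\<close>
  have "spheroid_homotopic X x0 (\<lambda>(x, y). f (2 * \<bar>x\<bar> - 1, y)) (\<lambda>(x, y). f (1, y))"
  proof (rule spheroid_reparam[OF assms])
    show "continuous_on {-1..1} (\<lambda>x::real. 2 * \<bar>x\<bar> - 1)" by (intro continuous_intros)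
  qed auto
  then show ?thesis
    by (rule spheroid_homotopic_eq)
       (use assms in \<open>auto simp: juxtapose_def mirror_def abs_if square_iff square_boundary_iff spheroid_boundary\<close>)
qed

theorem group_pi2:
  assumes x0: "x0 \<in> topspace X"
  shows "group (pi2 X x0)"
proof (rule groupI)
  fix A B assume "A \<in> carrier (pi2 X x0)" "B \<in> carrier (pi2 X x0)"
  then show "A \<otimes>\<^bsub>pi2 X x0\<^esub> B \<in> carrier (pi2 X x0)"
    by (auto simp: carrier_pi2 pi2_mult juxtapose_spheroid)
next
  show "\<one>\<^bsub>pi2 X x0\<^esub> \<in> carrier (pi2 X x0)"
    using x0 by (simp add: carrier_pi2 one_pi2 const_spheroid)
next
  fix A B C assume "A \<in> carrier (pi2 X x0)" "B \<in> carrier (pi2 X x0)" "C \<in> carrier (pi2 X x0)"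
  then obtain f g h where "f \<in> spheroids X x0" "g \<in> spheroids X x0" "h \<in> spheroids X x0"
    "A = pi2_class X x0 f" "B = pi2_class X x0 g" "C = pi2_class X x0 h" by (auto simp: carrier_pi2)
  then show "A \<otimes>\<^bsub>pi2 X x0\<^esub> B \<otimes>\<^bsub>pi2 X x0\<^esub> C = A \<otimes>\<^bsub>pi2 X x0\<^esub> (B \<otimes>\<^bsub>pi2 X x0\<^esub> C)"
    by (simp add: pi2_mult juxtapose_spheroid pi2_class_eq_iff juxtapose_assoc)
next
  fix A assume "A \<in> carrier (pi2 X x0)"
  then obtain f where f: "f \<in> spheroids X x0" "A = pi2_class X x0 f" by (auto simp: carrier_pi2)
  then show "\<one>\<^bsub>pi2 X x0\<^esub> \<otimes>\<^bsub>pi2 X x0\<^esub> A = A"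
    using x0 by (simp add: one_pi2 pi2_mult juxtapose_spheroid const_spheroid pi2_class_eq_iff juxtapose_const_left)
  have "pi2_class X x0 (f \<circ> mirror) \<otimes>\<^bsub>pi2 X x0\<^esub> A = \<one>\<^bsub>pi2 X x0\<^esub>"
    using x0 f by (simp add: one_pi2 pi2_mult juxtapose_spheroid const_spheroid mirror_spheroid
        pi2_class_eq_iff juxtapose_mirror_left)
  then show "\<exists>B\<in>carrier (pi2 X x0). B \<otimes>\<^bsub>pi2 X x0\<^esub> A = \<one>\<^bsub>pi2 X x0\<^esub>"
    using mirror_spheroid[OF f(1)] by (auto simp: carrier_pi2)
qed

text \<open>The part of \<open>f\<close> is shrunk to radius \<open>1 - t/2\<close>, the remaining collar runs along \<open>\<gamma>\<close> from
  \<open>\<gamma> (1 - t)\<close> on the boundary; for \<open>t = 1\<close> this is the transport.\<close>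

definition partial_transport :: "(real \<Rightarrow> 'a) \<Rightarrow> (real \<times> real \<Rightarrow> 'a) \<Rightarrow> real \<Rightarrow> real \<times> real \<Rightarrow> 'a" where
  "partial_transport \<gamma> f t z =
     (if supnorm z \<le> 1 - t / 2 then f ((1 / (1 - t / 2)) *\<^sub>R z) else \<gamma> (3 - t - 2 * supnorm z))"

lemma partial_transport_1: "partial_transport \<gamma> f 1 = transport \<gamma> f"
  by (auto simp: partial_transport_def transport_def supnorm_def fun_eq_iff)

text \<open>Both the family \<open>F\<close> and the degree \<tau> vary because there are two uses:
  \<tau> constantly 1 with a homotopy \<open>F\<close> shows that \<open>transport\<close> respects
  homotopy, and \<open>\<tau> t = t\<close> with constant \<open>F\<close> deforms \<open>f\<close>
  into its transport.\<close>

lemma continuous_map_partial_transport: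
  fixes B :: "real set"
  assumes F: "continuous_map (top_of_set (B \<times> square)) X (\<lambda>(t, z). F t z)"
    and Fb: "\<And>t. t \<in> B \<Longrightarrow> F t ` square_boundary \<subseteq> {x0}"
    and \<gamma>: "\<gamma> \<in> loops X x0"
    and \<tau>: "continuous_on B \<tau>" "\<tau> ` B \<subseteq> {0..1}"
  shows "continuous_map (top_of_set (B \<times> square)) X (\<lambda>(t, z). partial_transport \<gamma> (F t) (\<tau> t) z)"
proof -
  let ?N = "\<lambda>w :: real \<times> real \<times> real. supnorm (snd w)" let ?t = "\<lambda>w :: real \<times> real \<times> real. \<tau> (fst w)"
  let ?S = "B \<times> square"
  have N: "continuous_on V ?N" for V
    by (rule continuous_on_compose2[OF sq.cont_N]) (auto intro: continuous_intros)
  have t: "continuous_on V ?t" if "V \<subseteq> ?S" for V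
    using that by (intro continuous_on_compose2[OF \<tau>(1)] continuous_intros) auto
  have pos: "1 - ?t w / 2 > 0" "?t w \<in> {0..1}" if "w \<in> ?S" for w
    using that \<tau>(2) by (cases w, force)+
  have sc: "(1 / (1 - ?t w / 2)) *\<^sub>R snd w \<in> square" if "w \<in> ?S" "?N w \<le> 1 - ?t w / 2" for w
    using pos[OF that(1)] that(2) unfolding square_supnorm
    by (simp add: sq.scale_N divide_le_eq)
  have "continuous_map (subtopology (top_of_set ?S) {w \<in> topspace (top_of_set ?S). ?N w \<le> 1 - ?t w / 2})
      X ((\<lambda>(t, z). F t z) \<circ> (\<lambda>w. (fst w, (1 / (1 - ?t w / 2)) *\<^sub>R snd w)))"
  proof (rule continuous_map_compose[OF _ F])
    have "continuous_on {w \<in> ?S. ?N w \<le> 1 - ?t w / 2} (\<lambda>w. (fst w, (1 / (1 - ?t w / 2)) *\<^sub>R snd w))"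
      using pos by (intro continuous_intros t) (auto simp: less_le)
    then show "continuous_map (subtopology (top_of_set ?S) {w \<in> topspace (top_of_set ?S). ?N w \<le> 1 - ?t w / 2})
        (top_of_set ?S) (\<lambda>w. (fst w, (1 / (1 - ?t w / 2)) *\<^sub>R snd w))"
      using sc by (auto simp: subtopology_subtopology continuous_map_in_subtopology Int_absorb1 Collect_conj_eq[symmetric]
          intro: continuous_on_subset)
  qed
  moreover have "continuous_map (subtopology (top_of_set ?S) {w \<in> topspace (top_of_set ?S). 1 - ?t w / 2 \<le> ?N w})
      X (\<gamma> \<circ> (\<lambda>w. 3 - ?t w - 2 * ?N w))"
  proof (rule continuous_map_compose)
    show "continuous_map (top_of_set {0..1}) X \<gamma>" using \<gamma> by (simp add: loops_def pathin_def)
    have "continuous_on {w \<in> ?S. 1 - ?t w / 2 \<le> ?N w} (\<lambda>w. 3 - ?t w - 2 * ?N w)"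
      by (intro continuous_intros t N) auto
    moreover have "3 - ?t w - 2 * ?N w \<in> {0..1}" if "w \<in> ?S" "1 - ?t w / 2 \<le> ?N w" for w
      using that pos(2)[OF that(1)] by (auto simp: square_supnorm)
    ultimately show "continuous_map (subtopology (top_of_set ?S) {w \<in> topspace (top_of_set ?S). 1 - ?t w / 2 \<le> ?N w})
        (top_of_set {0..1}) (\<lambda>w. 3 - ?t w - 2 * ?N w)"
      by (auto simp: subtopology_subtopology continuous_map_in_subtopology Int_absorb1 Collect_conj_eq[symmetric]
          intro: continuous_on_subset)
  qed
  ultimately have "continuous_map (top_of_set ?S) X
      (\<lambda>w. if ?N w \<le> 1 - ?t w / 2 then ((\<lambda>(t, z). F t z) \<circ> (\<lambda>w. (fst w, (1 / (1 - ?t w / 2)) *\<^sub>R snd w))) w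
            else (\<gamma> \<circ> (\<lambda>w. 3 - ?t w - 2 * ?N w)) w)"
  proof (rule continuous_map_cases_le[rotated 2])
    show "continuous_map (top_of_set ?S) euclideanreal ?N"
      "continuous_map (top_of_set ?S) euclideanreal (\<lambda>w. 1 - ?t w / 2)"
      by (auto intro!: continuous_intros N t)
    \<comment> \<open>On the seam the rescaled point has gauge 1 and the argument of \<gamma> is 1,
      so both branches give \<open>x0\<close>.\<close>
    fix w assume w: "w \<in> topspace (top_of_set ?S)" and e: "?N w = 1 - ?t w / 2"
    have "(1 / (1 - ?t w / 2)) *\<^sub>R snd w \<in> square_boundary"
      using pos[of w] w e unfolding square_boundary_supnorm by (auto simp: sq.scale_N)
    then have "F (fst w) ((1 / (1 - ?t w / 2)) *\<^sub>R snd w) = x0" using Fb[of "fst w"] w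
      by (auto simp: image_subset_iff)
    moreover have "\<gamma> (3 - ?t w - 2 * ?N w) = x0"
    proof -
      have "3 - ?t w - 2 * ?N w = 1" using e by simp
      then show ?thesis using \<gamma> by (simp only: loops_def) simp
    qed
    ultimately show "((\<lambda>(t, z). F t z) \<circ> (\<lambda>w. (fst w, (1 / (1 - ?t w / 2)) *\<^sub>R snd w))) w = (\<gamma> \<circ> (\<lambda>w. 3 - ?t w - 2 * ?N w)) w"
      by simp
  qed
  then show ?thesis unfolding partial_transport_def case_prod_unfold o_def fst_conv snd_conv .
qed

lemma transport_boundary:
  assumes "\<gamma> \<in> loops X x0" "z \<in> square_boundary" shows "transport \<gamma> f z = x0"
  using assms by (cases z) (auto simp: transport_def square_boundary_def loops_def)

lemma transport_homotopic:
  assumes "spheroid_homotopic X x0 f g" and \<gamma>: "\<gamma> \<in> loops X x0"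
  shows "spheroid_homotopic X x0 (transport \<gamma> f) (transport \<gamma> g)"
proof -
  obtain h where h: "continuous_map (top_of_set ({0..1::real} \<times> square)) X h" "\<And>z. h (0, z) = f z" "\<And>z. h (1, z) = g z"
      "\<And>t. t \<in> {0..1} \<Longrightarrow> (\<lambda>z. h (t, z)) ` square_boundary \<subseteq> {x0}"
    using assms(1) by (auto simp: homotopic_with_def)
  let ?T = "\<lambda>t. transport \<gamma> (\<lambda>z. h (t, z))"
  have "continuous_map (top_of_set ({0..1} \<times> square)) X (\<lambda>(t, z). partial_transport \<gamma> (\<lambda>z. h (t, z)) 1 z)"
    using h \<gamma> by (intro continuous_map_partial_transport[where \<tau> = "\<lambda>_. 1"]) auto
  then have "continuous_map (top_of_set ({0..1} \<times> square)) X (\<lambda>(t, z). ?T t z)"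
    by (simp add: partial_transport_1)
  moreover have "?T 0 = transport \<gamma> f" "?T 1 = transport \<gamma> g" by (simp_all add: h)
  ultimately show ?thesis
    unfolding homotopic_with_def using transport_boundary[OF \<gamma>]
    by (intro exI[of _ "\<lambda>(t, z). ?T t z"]) auto
qed

lemma transport_spheroid: "f \<in> spheroids X x0 \<Longrightarrow> \<gamma> \<in> loops X x0 \<Longrightarrow> transport \<gamma> f \<in> spheroids X x0"
  using transport_homotopic spheroid_homotopic_refl spheroid_homotopic_imp_spheroids by metis

lemma pi1_action_class:
  assumes f: "f \<in> spheroids X x0" and \<gamma>: "\<gamma> \<in> loops X x0"
  shows "pi1_action X x0 \<gamma> (pi2_class X x0 f) = pi2_class X x0 (transport \<gamma> f)"
proof -
  have "pi2_class X x0 (transport \<gamma> g) = pi2_class X x0 (transport \<gamma> f)" if "g \<in> pi2_class X x0 f" for g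
  proof -
    have "spheroid_homotopic X x0 (transport \<gamma> f) (transport \<gamma> g)"
      by (rule transport_homotopic[OF pi2_class_mem(2)[OF that] \<gamma>])
    note * = this
    show ?thesis
      using pi2_class_eq_iff[THEN iffD2, OF _ _ *] spheroid_homotopic_imp_spheroids[OF *] by simp
  qed
  then have "(\<Union>g\<in>pi2_class X x0 f. pi2_class X x0 (transport \<gamma> g))
      = (\<Union>g\<in>pi2_class X x0 f. pi2_class X x0 (transport \<gamma> f))"
    by (intro SUP_cong refl)
  also have "\<dots> = pi2_class X x0 (transport \<gamma> f)"
    using mem_pi2_class[OF f] by (simp add: ex_in_conv[symmetric]) blast
  finally show ?thesis by (simp add: pi1_action_def)
qed

section \<open>Hurewicz classes of transports and products\<close>

text \<open>The homotopy may move the boundary, so it is not one of pairs. As each stage is constant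
  on the boundary, it descends to the sphere obtained by collapsing the boundary. A class relative
  to the collapsed point lifts to an absolute class there, on which freely homotopic maps
  agree.\<close>

lemma hom_induced_boundary_constant_homotopy:
  assumes K: "continuous_map (top_of_set ({0..1::real} \<times> square)) X (\<lambda>(t, z). K t z)"
    and const: "\<And>t z z'. t \<in> {0..1} \<Longrightarrow> z \<in> square_boundary \<Longrightarrow> z' \<in> square_boundary \<Longrightarrow> K t z = K t z'"
    and ends: "K 0 ` square_boundary \<subseteq> {x0}" "K 1 ` square_boundary \<subseteq> {x0}"
  shows "hom_induced p (top_of_set square) square_boundary X {x0} (K 0)
       = hom_induced p (top_of_set square) square_boundary X {x0} (K 1)"
proof -
  let ?Sq = "top_of_set square" and ?bd = square_boundary
  \<comment> \<open>A concrete model of the collapse: the factor \<open>1 - supnorm z\<close> kills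
    the boundary, and repeating it as last coordinate makes the map injective elsewhere.\<close>
  define q :: "real \<times> real \<Rightarrow> (real \<times> real) \<times> real" where "q z = ((1 - supnorm z) *\<^sub>R z, 1 - supnorm z)" for z
  let ?Q = "top_of_set (q ` square)"
  let ?qq = "\<lambda>(t::real, z). (t, q z)"
  have q_eq: "z = z' \<or> z \<in> ?bd \<and> z' \<in> ?bd" if "q z = q z'" "z \<in> square" "z' \<in> square" for z z'
    using that by (auto simp: q_def square_boundary_supnorm)
  have q0: "q z = 0" if "z \<in> ?bd" for z
    using that by (auto simp: q_def square_boundary_supnorm zero_prod_def)
  have q_cont: "continuous_on S q" for S
    unfolding q_def by (intro continuous_intros continuous_on_subset[OF sq.cont_N]) auto
  have "continuous_on ({0..1} \<times> square) ?qq"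
    unfolding case_prod_unfold
    by (intro continuous_intros continuous_on_compose2[OF q_cont[of UNIV]]) auto
  \<comment> \<open>A continuous map from a compact to a Hausdorff space is closed. The time factor
    is included because the whole homotopy has to descend.\<close>
  then have "quotient_map (top_of_set ({0..1} \<times> square)) (top_of_set ({0..1} \<times> q ` square)) ?qq"
  proof (intro continuous_closed_imp_quotient_map continuous_imp_closed_map)
    show "compact_space (top_of_set ({0..1::real} \<times> square))"
      by (simp add: compact_space_subtopology compact_Times compact_square)
    show "?qq ` topspace (top_of_set ({0..1} \<times> square)) = topspace (top_of_set ({0..1} \<times> q ` square))"
      using image_paired_Times[of "\<lambda>t. t" q "{0..1}" square] by simp
  qed (auto simp: Hausdorff_space_subtopology)
  note quot = this
  have K_eq: "K t z = K t z'" if "t \<in> {0..1}" "z \<in> square" "z' \<in> square" "q z = q z'" for t z z'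
    using q_eq[OF that(4,2,3)] const that(1) by blast
  have compat: "(case w of (t, z) \<Rightarrow> K t z) = (case w' of (t, z) \<Rightarrow> K t z)"
    if "w \<in> topspace (top_of_set ({0..1} \<times> square))" "w' \<in> topspace (top_of_set ({0..1} \<times> square))" "?qq w = ?qq w'" for w w'
  proof -
    obtain t z t' z' where w: "w = (t, z)" "w' = (t', z')" by (cases w; cases w')
    then have "t = t'" "q z = q z'" using that(3) by auto
    then show ?thesis using K_eq[of t z z'] that(1,2) unfolding w by auto
  qed
  obtain g where g: "continuous_map (top_of_set ({0..1} \<times> q ` square)) X g"
    and g': "\<And>w. w \<in> topspace (top_of_set ({0..1} \<times> square)) \<Longrightarrow> g (?qq w) = (case w of (t, z) \<Rightarrow> K t z)"
  proof (rule quotient_map_lift_exists[OF quot K])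
    show "(case w of (t, z) \<Rightarrow> K t z) = (case w' of (t, z) \<Rightarrow> K t z)"
      if "w \<in> topspace (top_of_set ({0..1} \<times> square))" "w' \<in> topspace (top_of_set ({0..1} \<times> square))" "?qq w = ?qq w'" for w w'
      by (rule compat[OF that])
  qed (rule that)
  have g2: "g (t, q z) = K t z" if "t \<in> {0..1}" "z \<in> square" for t z
    using g'[of "(t, z)"] that by simp
  have hom: "homotopic_with (\<lambda>h. h \<in> {} \<rightarrow> {x0}) ?Q X (\<lambda>u. g (0, u)) (\<lambda>u. g (1, u))"
    unfolding homotopic_with_def using g by (intro exI[of _ g]) auto
  have b: "(1, 0) \<in> ?bd" "(1, 0) \<in> square" by (simp_all add: square_boundary_iff square_iff)
  have "0 \<in> q ` square" using q0[OF b(1)] b(2) by force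
  have "hom_induced p ?Sq ?bd X {x0} (K s) c
      = hom_induced p ?Q {} X {x0} (\<lambda>u. g (s, u)) e"
    if s: "s \<in> {0..1}" "K s ` ?bd \<subseteq> {x0}" and e: "hom_induced p ?Q {} ?Q {0} id e = hom_induced p ?Sq ?bd ?Q {0} q c" for s c e
  proof -
    have "continuous_map ?Q X (g \<circ> (\<lambda>u. (s, u)))"
      using s by (intro continuous_map_compose[OF _ g]) (auto intro!: continuous_intros)
    then have gs: "continuous_map ?Q X (\<lambda>u. g (s, u))" by (simp add: o_def)
    have "g (s, 0) = x0" using g2[OF s(1) b(2)] q0[OF b(1)] s(2) b(1) by auto
    then have gs0: "(\<lambda>u. g (s, u)) \<in> {0} \<rightarrow> {x0}" by auto
    have "hom_induced p ?Sq ?bd X {x0} (K s) c = hom_induced p ?Sq ?bd X {x0} ((\<lambda>u. g (s, u)) \<circ> q) c"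
      by (rule fun_cong[OF hom_induced_eq]) (use g2 s in auto)
    also have "\<dots> = hom_induced p ?Q {0} X {x0} (\<lambda>u. g (s, u)) (hom_induced p ?Sq ?bd ?Q {0} q c)"
      by (rule hom_induced_compose'[symmetric, OF _ _ gs gs0]) (use q_cont q0 in auto)
    also have "\<dots> = hom_induced p ?Q {} X {x0} (\<lambda>u. g (s, u)) e"
      unfolding e[symmetric] by (subst hom_induced_compose'[OF _ _ gs gs0]) (auto simp: o_def)
    finally show ?thesis .
  qed
  \<comment> \<open>A point is a retract, so absolute homology maps onto homology relative to
    it.\<close>
  moreover have "\<exists>e. hom_induced p ?Q {} ?Q {0} id e = hom_induced p ?Sq ?bd ?Q {0} q c" for c
  proof -
    have "{0} retract_of_space ?Q"
      using \<open>0 \<in> q ` square\<close> by (simp add: retract_of_space_singleton)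
    then have "hom_induced p ?Q {} ?Q {0} id ` carrier (homology_group p ?Q) = carrier (relative_homology_group p ?Q {0})"
      by (intro epi_hom_induced_relativization) auto
    then have "hom_induced p ?Sq ?bd ?Q {0} q c \<in> hom_induced p ?Q {} ?Q {0} id ` carrier (homology_group p ?Q)"
      by (simp only: hom_induced_carrier)
    then show ?thesis by (elim imageE) (rule exI, erule sym)
  qed
  ultimately have "hom_induced p ?Sq ?bd X {x0} (K 0) c = hom_induced p ?Sq ?bd X {x0} (K 1) c" for c
    using ends homology_homotopy_axiom[OF hom] by (metis atLeastAtMost_iff le_numeral_extra(3,4) zero_le_one)
  then show ?thesis by blast
qed

text \<open>\<open>partial_transport\<close> is a free homotopy from \<open>f\<close> to its
  transport; at time \<open>t > 0\<close> the boundary sits at the single point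
  \<open>\<gamma> (1 - t)\<close>.\<close>

lemma hom_induced_transport:
  assumes f: "f \<in> spheroids X x0" and \<gamma>: "\<gamma> \<in> loops X x0"
  shows "hom_induced p (top_of_set square) square_boundary X {x0} (transport \<gamma> f)
       = hom_induced p (top_of_set square) square_boundary X {x0} f"
proof -
  let ?K = "partial_transport \<gamma> f"
  have "continuous_map (top_of_set ({0..1::real} \<times> square)) X (f \<circ> snd)"
    using f by (intro continuous_map_compose[of _ "top_of_set square"]) (auto simp: spheroids_iff intro!: continuous_intros)
  then have "continuous_map (top_of_set ({0..1::real} \<times> square)) X (\<lambda>(t, z). f z)"
    by (simp add: o_def case_prod_unfold)
  then have cont: "continuous_map (top_of_set ({0..1} \<times> square)) X (\<lambda>(t, z). ?K t z)"
    using f \<gamma> by (intro continuous_map_partial_transport[where \<tau> = "\<lambda>t. t"]) (auto simp: spheroids_iff)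
  have K: "?K t z = (if t = 0 then f z else \<gamma> (1 - t))" if "t \<in> {0..1}" "z \<in> square_boundary" for t z
    using that by (auto simp: partial_transport_def square_boundary_supnorm)
  have "hom_induced p (top_of_set square) square_boundary X {x0} (?K 0)
      = hom_induced p (top_of_set square) square_boundary X {x0} (?K 1)"
    by (rule hom_induced_boundary_constant_homotopy[OF cont])
       (use f \<gamma> in \<open>auto simp: K spheroid_boundary loops_def\<close>)
  moreover have "hom_induced p (top_of_set square) square_boundary X {x0} (?K 0)
      = hom_induced p (top_of_set square) square_boundary X {x0} f"
    by (rule hom_induced_eq) (auto simp: partial_transport_def square_supnorm)
  ultimately show ?thesis by (simp add: partial_transport_1)
qed

lemma continuous_juxtapose:
  assumes F: "continuous_map (top_of_set square) X F" and G: "continuous_map (top_of_set square) X G"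
    and FG: "\<And>y. y \<in> {-1..1} \<Longrightarrow> F (1, y) = G (-1, y)"
  shows "continuous_map (top_of_set square) X (juxtapose F G)"
proof -
  have snd: "continuous_map (top_of_set ({0::real} \<times> square)) (top_of_set square) snd"
    by (auto intro!: continuous_intros)
  have "continuous_map (top_of_set ({0::real} \<times> square)) X (\<lambda>(t, z). juxtapose F G z)"
    using continuous_map_compose[OF snd F] continuous_map_compose[OF snd G] FG
    by (intro continuous_map_juxtapose) (simp_all add: o_def case_prod_unfold)
  moreover have "continuous_map (top_of_set square) (top_of_set ({0::real} \<times> square)) (\<lambda>z. (0, z))"
    by (auto intro!: continuous_intros)
  ultimately have "continuous_map (top_of_set square) X ((\<lambda>(t, z). juxtapose F G z) \<circ> (\<lambda>z. (0::real, z)))"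
    by (metis continuous_map_compose)
  then show ?thesis by (simp add: o_def)
qed

text \<open>The boundary is only required to go into \<open>S\<close>, with agreement along the
  seam: besides spheroids this covers the two halves of a product of tilings, whose seam runs
  through the 1-skeleton. The middle segment goes into \<open>S\<close> as well, so the subdivision
  of the square applies.\<close>

theorem hom_induced_juxtapose:
  assumes F: "continuous_map (top_of_set square) X F" "F \<in> square_boundary \<rightarrow> S"
    and G: "continuous_map (top_of_set square) X G" "G \<in> square_boundary \<rightarrow> S"
    and FG: "\<And>y. y \<in> {-1..1} \<Longrightarrow> F (1, y) = G (-1, y)"
    and c: "c \<in> carrier (relative_homology_group p (top_of_set square) square_boundary)"
  shows "hom_induced p (top_of_set square) square_boundary X S (juxtapose F G) c
    = hom_induced p (top_of_set square) square_boundary X S F c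
      \<otimes>\<^bsub>relative_homology_group p X S\<^esub>
      hom_induced p (top_of_set square) square_boundary X S G c"
    and "juxtapose F G \<in> square_boundary \<rightarrow> S"
proof -
  let ?Sq = "top_of_set square" let ?bd = square_boundary let ?j = "juxtapose F G"
  let ?G = "relative_homology_group p X S"
  have j: "continuous_map ?Sq X ?j" by (rule continuous_juxtapose[OF F(1) G(1) FG])
  have jS: "?j z \<in> S" if "z \<in> theta_graph" for z
  proof -
    obtain x y where z: "z = (x, y)" "-1 \<le> y" "y \<le> 1" "(x, y) \<in> square"
      using \<open>z \<in> theta_graph\<close> theta_graph_subset by (cases z) (auto simp: square_iff)
    have "(if x \<le> 0 then (2 * x + 1, y) else (2 * x - 1, y)) \<in> ?bd"
      using \<open>z \<in> theta_graph\<close> z by (auto simp: theta_graph_iff square_boundary_iff square_iff)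
    then show ?thesis using F(2) G(2) by (auto simp: z juxtapose_def split: if_splits)
  qed
  then have jS': "?j \<in> theta_graph \<rightarrow> S" by blast
  show "?j \<in> ?bd \<rightarrow> S" using jS by (auto simp: theta_graph_def)
  have h: "half_square k \<in> ?bd \<rightarrow> theta_graph" "id \<in> ?bd \<rightarrow> theta_graph"
        "continuous_map ?Sq ?Sq (half_square k)" for k
    using half_square_mem by (auto simp: theta_graph_def continuous_half_square)
  let ?i = "hom_induced p ?Sq theta_graph X S ?j"
  have "hom_induced p ?Sq ?bd X S ?j c = ?i (hom_induced p ?Sq ?bd ?Sq theta_graph id c)"
    by (subst hom_induced_compose'[OF _ h(2) j jS']) auto
  also have "\<dots> = ?i (hom_induced p ?Sq ?bd ?Sq theta_graph (half_square False) c)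
      \<otimes>\<^bsub>?G\<^esub> ?i (hom_induced p ?Sq ?bd ?Sq theta_graph (half_square True) c)"
    unfolding square_subdivision[OF c] by (rule hom_mult[OF hom_induced_hom]) (auto simp: hom_induced_carrier)
  also have "?i (hom_induced p ?Sq ?bd ?Sq theta_graph (half_square False) c) = hom_induced p ?Sq ?bd X S F c"
    by (subst hom_induced_compose'[OF h(3,1) j jS'], rule fun_cong[OF hom_induced_eq])
       (auto simp: juxtapose_def half_square_def square_iff field_simps)
  also have "?i (hom_induced p ?Sq ?bd ?Sq theta_graph (half_square True) c) = hom_induced p ?Sq ?bd X S G c"
  proof (subst hom_induced_compose'[OF h(3,1) j jS'], rule fun_cong[OF hom_induced_eq])
    fix z assume "z \<in> topspace ?Sq"
    then obtain x y where z: "z = (x, y)" "-1 \<le> x" "x \<le> 1" "-1 \<le> y" "y \<le> 1"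
      by (cases z) (auto simp: square_iff)
    show "(?j \<circ> half_square True) z = G z"
    \<comment> \<open>At \<open>x = -1\<close> the right half touches the seam, where
      \<open>juxtapose\<close> uses the left map; there the matching condition \<open>FG\<close>
      enters.\<close>
    proof (cases "x = -1")
      case True
      then show ?thesis using z FG by (simp add: juxtapose_def half_square_def)
    next
      case False
      then have "\<not> (x + 1) / 2 \<le> 0" "2 * ((x + 1) / 2) - 1 = x" using z by (auto simp: field_simps)
      then show ?thesis using z by (simp only: o_def juxtapose_def half_square_def case_prod_conv if_False if_True)
    qed
  qed
  finally show "hom_induced p ?Sq ?bd X S ?j c
    = hom_induced p ?Sq ?bd X S F c \<otimes>\<^bsub>?G\<^esub> hom_induced p ?Sq ?bd X S G c" .
qed

section \<open>The disk and winding numbers\<close>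

interpretation ball: cell_model "norm :: complex \<Rightarrow> real"
proof
  show "compact {z :: complex. norm z \<le> 1}"
    using compact_cball[of "0::complex" 1] by (simp add: cball_def dist_norm)
  show "continuous_on UNIV (norm :: complex \<Rightarrow> real)" by (rule continuous_on_norm_id)
qed simp_all

lemma ball_cell: "ball.cell = cball 0 1" and ball_rim: "ball.rim = sphere 0 1"
  and ball_interior: "ball.cell - ball.rim = ball 0 1"
  by (auto simp: ball.cell_def ball.rim_def)

abbreviation disk_group :: "complex chain set monoid" where
  "disk_group \<equiv> relative_homology_group 2 (top_of_set (cball 0 1)) (sphere 0 1)"

abbreviation square_group :: "(real \<times> real) chain set monoid" where
  "square_group \<equiv> relative_homology_group 2 (top_of_set square) square_boundary"

text \<open>\<open>cone_map\<close> rescaled to the square; it presents the disk as a square cell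
  attached to the circle.\<close>

definition square_to_disk :: "real \<times> real \<Rightarrow> complex" where
  "square_to_disk = (\<lambda>(x, y). cone_map ((1 + x) / 2) y)"

definition circle_point :: "real \<Rightarrow> complex" where
  "circle_point y = exp (of_real (pi * (y + 1)) * \<i>)"

lemma norm_circle_point [simp]: "norm (circle_point y) = 1"
  by (simp add: circle_point_def)

lemma cone_map_eq: "cone_map a y = 1 + of_real a * (circle_point y - 1)"
  by (simp add: cone_map_def circle_point_def)

lemma circle_point_ends: "circle_point 1 = 1" "circle_point (-1) = 1"
  using exp_integer_2pi[of 1] by (simp_all add: circle_point_def mult.commute)

lemma circle_point_inj: "\<bar>y - y'\<bar> < 2 \<Longrightarrow> circle_point y = circle_point y' \<Longrightarrow> y = y'"
proof -
  assume *: "\<bar>y - y'\<bar> < 2" "circle_point y = circle_point y'"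
  have "pi * (y + 1) - pi * (y' + 1) = pi * (y - y')" by (simp add: algebra_simps)
  then have "\<bar>pi * (y + 1) - pi * (y' + 1)\<bar> = pi * \<bar>y - y'\<bar>" by (simp add: abs_mult)
  also have "\<dots> < pi * 2" using *(1) by (intro mult_strict_left_mono) auto
  finally have "\<bar>pi * (y + 1) - pi * (y' + 1)\<bar> < 2 * pi" by linarith
  moreover have Im: "Im (of_real r * \<i>) = r" for r by simp
  ultimately have "\<bar>Im (of_real (pi * (y + 1)) * \<i>) - Im (of_real (pi * (y' + 1)) * \<i>)\<bar> < 2 * pi"
    by (simp only: Im)
  from exp_complex_eqI[OF this *(2)[unfolded circle_point_def]]
  have "pi * (y + 1) = pi * (y' + 1)" using Im by metis
  then show "y = y'" by simp
qed

lemma circle_point_surj: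
  assumes "norm e = 1" "e \<noteq> 1" obtains y where "-1 < y" "y < 1" "circle_point y = e"
proof
  let ?y = "Arg2pi e / pi - 1"
  have e: "exp (\<i> * of_real (Arg2pi e)) = e" using assms(1) complex_norm_eq_1_exp by blast
  then have "Arg2pi e \<noteq> 0" using assms(2) by fastforce
  then show "-1 < ?y" "?y < 1"
    using Arg2pi_lt_2pi[of e] Arg2pi_ge_0[of e] by (auto simp: field_simps)
  show "circle_point ?y = e"
    using e by (simp add: circle_point_def mult.commute)
qed

text \<open>The subtracted term is nonnegative for \<open>a\<close> between 0 and 1 and vanishes
  only for \<open>a = 0\<close>, \<open>a = 1\<close> or \<open>circle_point y = 1\<close>, which
  tells the open disk from the circle.\<close>

lemma norm_cone_map:
  "norm (cone_map a y) ^ 2 = 1 - 2 * a * (1 - a) * (1 - Re (circle_point y))"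
proof -
  define u v where "u = Re (circle_point y)" and "v = Im (circle_point y)"
  have uv: "u\<^sup>2 + v\<^sup>2 = 1"
    using norm_circle_point[of y] unfolding u_def v_def cmod_def by (simp add: real_sqrt_eq_1_iff)
  have "norm (cone_map a y) ^ 2 = (1 + a * (u - 1))\<^sup>2 + (a * v)\<^sup>2"
    by (simp add: cmod_power2 cone_map_eq u_def v_def)
  also have "\<dots> = (1 + a * (u - 1))\<^sup>2 + a\<^sup>2 * (1 - u\<^sup>2)"
  proof -
    have "v\<^sup>2 = 1 - u\<^sup>2" using uv by simp
    then show ?thesis by (simp add: power_mult_distrib)
  qed
  also have "\<dots> = 1 - 2 * a * (1 - a) * (1 - u)" by (simp add: power2_eq_square algebra_simps)
  finally show ?thesis by (simp add: u_def)
qed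

lemma Re_less_1: "norm e = 1 \<Longrightarrow> e \<noteq> 1 \<Longrightarrow> Re e < 1" for e :: complex
proof -
  assume e: "norm e = 1" "e \<noteq> 1"
  have "Re e \<noteq> 1"
  proof
    assume "Re e = 1"
    then have "Im e = 0" using e(1) unfolding cmod_def by (simp add: real_sqrt_eq_1_iff)
    then show False using e(2) \<open>Re e = 1\<close> by (simp add: complex_eq_iff)
  qed
  then show ?thesis using complex_Re_le_cmod[of e] e(1) by simp
qed

text \<open>A point \<open>w = 1 + a (e - 1)\<close> of the open disk determines \<open>a\<close> since \<open>e\<close> has modulus 1.\<close>

lemma square_to_disk_attachment:
  "cell_attachment supnorm (top_of_set (cball 0 1)) (sphere 0 1) square_to_disk"
proof unfold_locales
  let ?C = square_to_disk
  have cont: "continuous_on square ?C"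
    unfolding square_to_disk_def case_prod_unfold cone_map_def by (intro continuous_intros) auto
  have le: "?C z \<in> cball 0 1" if sq: "z \<in> square" for z
  proof -
    obtain x y where z: "z = (x, y)" "-1 \<le> x" "x \<le> 1" using sq by (cases z) (auto simp: square_iff)
    have "Re (circle_point y) \<le> 1" using complex_Re_le_cmod[of "circle_point y"] by simp
    then have "2 * ((1 + x) / 2) * (1 - (1 + x) / 2) * (1 - Re (circle_point y)) \<ge> 0"
      using z by (intro mult_nonneg_nonneg) auto
    then have "norm (?C z) ^ 2 \<le> 1" unfolding z square_to_disk_def by (simp add: norm_cone_map)
    then show ?thesis by (simp add: power2_le_iff_abs_le abs_square_le_1)
  qed
  have bd: "norm (?C z) = 1" if "z \<in> square_boundary" for z
    using that by (cases z) (auto simp: square_boundary_iff square_to_disk_def cone_map_eq circle_point_ends field_simps)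
  have int: "norm (?C z) < 1" if sq: "z \<in> square - square_boundary" for z
  proof -
    obtain x y where z: "z = (x, y)" "-1 < x" "x < 1" "-1 < y" "y < 1"
      using sq by (cases z) (auto simp: square_iff square_boundary_iff less_le)
    have "circle_point y \<noteq> 1"
      using circle_point_inj[of y 1] circle_point_inj[of y "-1"] z circle_point_ends by auto
    then have "Re (circle_point y) < 1" by (intro Re_less_1) auto
    then have "2 * ((1 + x) / 2) * (1 - (1 + x) / 2) * (1 - Re (circle_point y)) > 0"
      using z by (intro mult_pos_pos) auto
    then have "norm (?C z) ^ 2 < 1" unfolding z square_to_disk_def by (simp add: norm_cone_map)
    then show ?thesis by (simp add: power_less_one_iff)
  qed
  have surj: "\<exists>z\<in>square. ?C z = w" if w: "norm w < 1" for w
  proof -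
    define v where "v = w - 1"
    have v: "(Re v)\<^sup>2 + (Im v)\<^sup>2 + 2 * Re v < 0"
    proof -
      have "norm w ^ 2 < 1" using w by (simp add: power_less_one_iff)
      then have "(Re w)\<^sup>2 + (Im w)\<^sup>2 < 1" by (simp only: cmod_power2)
      then show ?thesis by (simp add: v_def power2_eq_square algebra_simps)
    qed
    then have Rev: "Re v < 0" by (smt (verit) zero_le_power2)
    \<comment> \<open>The solution of \<open>norm (1 + v / a) = 1\<close>. The fact
      \<open>v\<close>, which is \<open>norm w < 1\<close> rewritten for the displacement from 1,
      forces \<open>a < 1\<close>.\<close>
    define a where "a = - ((Re v)\<^sup>2 + (Im v)\<^sup>2) / (2 * Re v)"
    have a: "0 < a" "a < 1"
    proof -
      have "(Re v)\<^sup>2 + (Im v)\<^sup>2 > 0" using Rev by (simp add: sum_power2_gt_zero_iff)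
      then show "0 < a" unfolding a_def using Rev by (intro divide_neg_neg) auto
      show "a < 1" unfolding a_def using Rev v by (simp add: neg_divide_less_eq)
    qed
    define e where "e = 1 + v / of_real a"
    have "norm e ^ 2 = 1"
    proof -
      have "norm e ^ 2 = (1 + Re v / a)\<^sup>2 + (Im v / a)\<^sup>2" by (simp add: cmod_power2 e_def)
      also have "\<dots> = 1 + (2 * Re v * a + ((Re v)\<^sup>2 + (Im v)\<^sup>2)) / a\<^sup>2"
        using a by (simp add: power2_eq_square field_simps)
      also have "2 * Re v * a + ((Re v)\<^sup>2 + (Im v)\<^sup>2) = 0" using Rev by (simp add: a_def)
      finally show ?thesis by simp
    qed
    then have "norm e = 1" by (simp add: power2_eq_1_iff) (metis norm_ge_zero not_one_le_zero neg_0_le_iff_le)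
    moreover have "e \<noteq> 1" using Rev a by (auto simp: e_def)
    ultimately obtain y where y: "-1 < y" "y < 1" "circle_point y = e" by (rule circle_point_surj)
    have "?C (2 * a - 1, y) = w"
      using a by (simp add: square_to_disk_def cone_map_eq y e_def v_def)
    then show ?thesis using a y by (intro bexI[of _ "(2 * a - 1, y)"]) (auto simp: square_iff)
  qed
  show "topspace (top_of_set (cball 0 1)) = sphere 0 1 \<union> ?C ` sq.cell"
  proof
    show "topspace (top_of_set (cball 0 1)) \<subseteq> sphere 0 1 \<union> ?C ` sq.cell"
      using surj unfolding sq_cell by (force simp: less_le)
  qed (use le sq_cell in auto)
  show "sq.attaches (top_of_set (cball 0 1)) (sphere 0 1) ?C"
    unfolding sq.attaches_def sq_cell sq_rim
  proof (intro conjI)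
    show "continuous_map (top_of_set square) (top_of_set (cball 0 1)) ?C"
      using cont le by auto
    show "?C ` square_boundary \<subseteq> sphere 0 1" using bd by auto
    show "?C ` (square - square_boundary) \<inter> sphere 0 1 = {}" using int by force
    show "inj_on ?C (square - square_boundary)"
    proof (rule inj_onI)
      fix z z' assume zz: "z \<in> square - square_boundary" "z' \<in> square - square_boundary" "?C z = ?C z'"
      obtain x y where z: "z = (x, y)" "-1 < x" "x < 1" "-1 < y" "y < 1"
        using zz by (cases z) (auto simp: square_iff square_boundary_iff less_le)
      obtain x' y' where z': "z' = (x', y')" "-1 < x'" "x' < 1" "-1 < y'" "y' < 1"
        using zz by (cases z') (auto simp: square_iff square_boundary_iff less_le)
      \<comment> \<open>The same formula, now read as uniqueness: \<open>a\<close> depends only on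
        the displacement \<open>v\<close> from the basepoint.\<close>
      have key: "a = ((Re v)\<^sup>2 + (Im v)\<^sup>2) / (- 2 * Re v)"
        if "v = of_real a * (circle_point y - 1)" "0 < a" "circle_point y \<noteq> 1" for a y v
      proof -
        let ?u = "Re (circle_point y)" and ?w = "Im (circle_point y)"
        have uw: "?u\<^sup>2 + ?w\<^sup>2 = 1"
          using norm_circle_point[of y] unfolding cmod_def by (simp add: real_sqrt_eq_1_iff)
        have "(Re v)\<^sup>2 + (Im v)\<^sup>2 = a\<^sup>2 * ((?u\<^sup>2 + ?w\<^sup>2) - 2 * ?u + 1)"
          unfolding that(1) by (simp add: power2_eq_square algebra_simps)
        also have "\<dots> = a * (- 2 * Re v)"
          unfolding uw that(1) by (simp add: power2_eq_square algebra_simps)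
        finally have "(Re v)\<^sup>2 + (Im v)\<^sup>2 = a * (- 2 * Re v)" .
        moreover have "Re v \<noteq> 0" using Re_less_1[OF _ that(3)] that(1,2) by auto
        ultimately show ?thesis by simp
      qed
      have ne: "circle_point y \<noteq> 1" "circle_point y' \<noteq> 1"
        using circle_point_inj[of y 1] circle_point_inj[of y "-1"] z circle_point_inj[of y' 1]
          circle_point_inj[of y' "-1"] z' circle_point_ends by auto
      have e: "of_real ((1 + x) / 2) * (circle_point y - 1) = of_real ((1 + x') / 2) * (circle_point y' - 1)"
        using zz(3) by (simp add: z z' square_to_disk_def cone_map_eq)
      have "(1 + x) / 2 = (1 + x') / 2"
        using key[OF refl _ ne(1), of "(1 + x) / 2"] key[OF e _ ne(2)] z z' by simp
      then have "x = x'" by simp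
      moreover have "y = y'"
      proof (rule circle_point_inj)
        have "of_real ((1 + x) / 2) \<noteq> (0 :: complex)" using z by (metis of_real_eq_0_iff add_eq_0_iff divide_eq_0_iff order_less_irrefl zero_neq_numeral)
        then show "circle_point y = circle_point y'" using e unfolding \<open>x = x'\<close> by simp
      qed (use z z' in auto)
      ultimately show "z = z'" using z z' by simp
    qed
  qed
qed (auto simp: Hausdorff_space_subtopology closed_subset)

lemma iso_square_to_disk:
  "hom_induced p (top_of_set square) square_boundary (top_of_set (cball 0 1)) (sphere 0 1) square_to_disk
     \<in> iso (relative_homology_group p (top_of_set square) square_boundary)
           (relative_homology_group p (top_of_set (cball 0 1)) (sphere 0 1))"
  using cell_attachment.iso_cell[OF square_to_disk_attachment] by (simp add: sq_cell sq_rim)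

text \<open>The disk is contractible, so its group relative to the circle is the reduced first
  homology of the circle.\<close>

lemma disk_group_iso: "disk_group \<cong> integer_group"
proof -
  have "contractible_space (top_of_set (cball (0::complex) 1))"
    by (simp add: contractible_space_top_of_set convex_imp_contractible)
  moreover have "topspace (top_of_set (cball (0::complex) 1)) \<inter> sphere 0 1 \<noteq> {}"
  proof -
    have "(1::complex) \<in> topspace (top_of_set (cball 0 1)) \<inter> sphere 0 1" by simp
    then show ?thesis by blast
  qed
  ultimately have "disk_group \<cong> reduced_homology_group (2 - 1) (subtopology (top_of_set (cball (0::complex) 1)) (sphere 0 1))"
    by (rule isomorphic_group_relative_homology_of_contractible)
  then have "disk_group \<cong> reduced_homology_group 1 (subtopology (top_of_set (cball (0::complex) 1)) (sphere 0 1))"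
    by simp
  also have "subtopology (top_of_set (cball (0::complex) 1)) (sphere 0 1) = top_of_set (sphere 0 1)"
    by (simp add: subtopology_subtopology Int_absorb1)
  finally have 1: "disk_group \<cong> reduced_homology_group 1 (top_of_set (sphere (0::complex) 1))" .
  \<comment> \<open>The unit circle of the complex plane is matched with \<open>nsphere 1\<close>
    through an orthogonal basis of two elements.\<close>
  obtain f :: "(nat \<Rightarrow> real) \<Rightarrow> complex" and g
    where "homeomorphic_maps (nsphere (2 - 1)) (top_of_set (sphere 0 1 \<inter> span Basis)) f g"
    by (rule homeomorphic_maps_nsphere_euclidean_sphere[of "Basis :: complex set" 2])
       (auto simp: independent_Basis pairwise_def orthogonal_def inner_Basis)
  then have "nsphere 1 homeomorphic_space top_of_set (sphere (0::complex) 1)"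
    by (auto simp: homeomorphic_space_def)
  then have "top_of_set (sphere (0::complex) 1) homeomorphic_space nsphere 1"
    by (rule homeomorphic_space_sym[THEN iffD1])
  then have "reduced_homology_group 1 (top_of_set (sphere (0::complex) 1)) \<cong> reduced_homology_group 1 (nsphere 1)"
    by (rule homeomorphic_space_imp_isomorphic_reduced_homology_groups)
  with 1 have "disk_group \<cong> reduced_homology_group 1 (nsphere 1)" by (rule iso_trans)
  then show ?thesis using reduced_homology_group_nsphere(1)[of 1] iso_trans by fastforce
qed

text \<open>The second part treats an arbitrary generator, since \<open>fundamental_class\<close> is
  only known to be some generator and exponents have to be read off it unambiguously.\<close>

lemma iso_integer_group_generator:
  assumes G: "group G" and iso: "G \<cong> integer_group"
  shows "\<exists>c. c \<in> carrier G \<and> generate G {c} = carrier G"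
    and "c \<in> carrier G \<Longrightarrow> generate G {c} = carrier G \<Longrightarrow> bij_betw (\<lambda>n::int. c [^]\<^bsub>G\<^esub> n) UNIV (carrier G)"
proof -
  interpret group G by fact
  obtain h where h: "h \<in> iso G integer_group" using iso by (auto simp: is_iso_def)
  then have bij: "bij_betw h (carrier G) UNIV" and hom: "h \<in> hom G integer_group"
    by (auto simp: iso_def integer_group_def)
  have pow: "h (c [^]\<^bsub>G\<^esub> n) = n * h c" if "c \<in> carrier G" for c and n :: int
    using hom_int_pow[OF hom that G group_integer_group] by simp
  obtain d where d: "d \<in> carrier G" "h d = 1" using bij by (metis UNIV_I bij_betw_iff_bijections)
  have "generate G {d} = carrier G"
  proof
    show "generate G {d} \<subseteq> carrier G" using d by (intro generate_incl) auto
    show "carrier G \<subseteq> generate G {d}"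
    proof
      fix x assume x: "x \<in> carrier G"
      have "h (d [^]\<^bsub>G\<^esub> h x) = h x" using pow[OF d(1)] d by simp
      then have "x = d [^]\<^bsub>G\<^esub> h x" using bij x d by (metis bij_betw_def inj_onD int_pow_closed)
      then show "x \<in> generate G {d}" using d generate_pow by blast
    qed
  qed
  then show "\<exists>c. c \<in> carrier G \<and> generate G {c} = carrier G" using d by blast
  assume c: "c \<in> carrier G" "generate G {c} = carrier G"
  have surj: "range (\<lambda>n::int. c [^]\<^bsub>G\<^esub> n) = carrier G" using c generate_pow[OF c(1)] by (simp add: full_SetCompr_eq)
  obtain x where x: "x \<in> carrier G" "h x = 1" using bij by (metis UNIV_I bij_betw_iff_bijections)
  then obtain n :: int where "x = c [^]\<^bsub>G\<^esub> n" using surj by auto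
  then have "h c \<noteq> 0" using pow[OF c(1), of n] x by auto
  then have "inj (\<lambda>n::int. c [^]\<^bsub>G\<^esub> n)" using pow[OF c(1)] by (metis injI mult_cancel_right)
  then show "bij_betw (\<lambda>n::int. c [^]\<^bsub>G\<^esub> n) UNIV (carrier G)" using surj by (simp add: bij_betw_def)
qed

lemma fundamental_class:
  "fundamental_class \<in> carrier square_group" "generate square_group {fundamental_class} = carrier square_group"
proof -
  have "square_group \<cong> integer_group"
    using iso_square_to_disk[of 2] disk_group_iso iso_trans is_isoI by blast
  then have "\<exists>c. c \<in> carrier square_group \<and> generate square_group {c} = carrier square_group"
    by (intro iso_integer_group_generator(1)) auto
  from someI_ex[OF this] show "fundamental_class \<in> carrier square_group"
    "generate square_group {fundamental_class} = carrier square_group"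
    unfolding fundamental_class_def Let_def by blast+
qed

text \<open>Transported from \<open>fundamental_class\<close> rather than chosen afresh, so that an
  arbitrary sign enters faces and spheroids in the same way.\<close>

definition disk_class :: "complex chain set" where
  "disk_class = hom_induced 2 (top_of_set square) square_boundary (top_of_set (cball 0 1)) (sphere 0 1)
     square_to_disk fundamental_class"

lemma disk_class_carrier: "disk_class \<in> carrier disk_group"
  by (simp add: disk_class_def hom_induced_carrier)

lemma disk_class_powers: "bij_betw (\<lambda>n::int. disk_class [^]\<^bsub>disk_group\<^esub> n) UNIV (carrier disk_group)"
proof -
  let ?h = "hom_induced 2 (top_of_set square) square_boundary (top_of_set (cball 0 1)) (sphere 0 1) square_to_disk"
  have h: "?h \<in> hom square_group disk_group" "bij_betw ?h (carrier square_group) (carrier disk_group)"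
    using iso_square_to_disk[of 2] by (simp_all add: iso_def)
  have "square_group \<cong> integer_group"
    using iso_square_to_disk[of 2] disk_group_iso iso_trans is_isoI by blast
  then have "bij_betw (\<lambda>n::int. fundamental_class [^]\<^bsub>square_group\<^esub> n) UNIV (carrier square_group)"
    by (intro iso_integer_group_generator(2) fundamental_class) auto
  then have "bij_betw (?h \<circ> (\<lambda>n::int. fundamental_class [^]\<^bsub>square_group\<^esub> n)) UNIV (carrier disk_group)"
    using h(2) by (rule bij_betw_trans)
  moreover have "?h \<circ> (\<lambda>n::int. fundamental_class [^]\<^bsub>square_group\<^esub> n) = (\<lambda>n. disk_class [^]\<^bsub>disk_group\<^esub> n)"
    unfolding o_def disk_class_def
    by (intro ext hom_int_pow[OF h(1)] fundamental_class) auto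
  ultimately show ?thesis by simp
qed

section \<open>Local homology of the plane and winding numbers\<close>

abbreviation local_group :: "complex \<Rightarrow> complex chain set monoid" where
  "local_group x \<equiv> relative_homology_group 2 euclidean (- {x})"

abbreviation disk_map :: "(complex \<Rightarrow> complex) \<Rightarrow> complex \<Rightarrow> complex chain set \<Rightarrow> complex chain set" where
  "disk_map f x \<equiv> hom_induced 2 (top_of_set (cball 0 1)) (sphere 0 1) euclidean (- {x}) f"

lemma subtopology_disk_sphere: "subtopology (top_of_set (cball (0::complex) 1)) (sphere 0 1) = top_of_set (sphere 0 1)"
  by (simp add: subtopology_subtopology Int_absorb1)

text \<open>The plane is contractible, so a local class is determined by its boundary in the
  punctured plane.\<close>

lemma inj_boundary_local: "inj_on (hom_boundary 2 euclidean (- {x :: complex})) (carrier (local_group x))"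
proof -
  have "x + 1 \<in> topspace euclidean \<inter> - {x}" by simp
  then have "topspace euclidean \<inter> - {x} \<noteq> {}" by blast
  moreover have "contractible_space (euclidean :: complex topology)"
    using convex_imp_contractible[OF convex_UNIV] contractible_space_top_of_set[of "UNIV :: complex set"] by simp
  ultimately show ?thesis
    using iso_relative_homology_of_contractible[of euclidean "- {x}" 2] by (simp add: iso_def bij_betw_def)
qed

lemma inj_boundary_disk: "inj_on (hom_boundary 2 (top_of_set (cball 0 1)) (sphere (0::complex) 1)) (carrier disk_group)"
proof -
  have "(1::complex) \<in> topspace (top_of_set (cball 0 1)) \<inter> sphere 0 1" by simp
  then have "topspace (top_of_set (cball (0::complex) 1)) \<inter> sphere 0 1 \<noteq> {}" by blast
  moreover have "contractible_space (top_of_set (cball (0::complex) 1))"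
    by (simp add: contractible_space_top_of_set convex_imp_contractible)
  ultimately show ?thesis
    using iso_relative_homology_of_contractible[of "top_of_set (cball (0::complex) 1)" "sphere 0 1" 2]
    by (simp add: iso_def bij_betw_def)
qed

lemma boundary_disk_map:
  assumes "continuous_on (cball 0 1) f" "f \<in> sphere 0 1 \<rightarrow> - {x}"
  shows "hom_boundary 2 euclidean (- {x}) (disk_map f x c)
    = hom_induced 1 (top_of_set (sphere 0 1)) {} (top_of_set (- {x})) {} f
        (hom_boundary 2 (top_of_set (cball 0 1)) (sphere 0 1) c)"
  using fun_cong[OF naturality_hom_induced[of "top_of_set (cball 0 1)" euclidean f "sphere 0 1" "- {x}" 2], of c] assms
  by (simp add: subtopology_disk_sphere)

text \<open>Only the restriction to the circle matters: the connecting map is natural, and injective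
  on the local group.\<close>

lemma disk_map_homotopic:
  assumes f: "continuous_on (cball 0 1) f" "f \<in> sphere 0 1 \<rightarrow> - {x}"
    and g: "continuous_on (cball 0 1) g" "g \<in> sphere 0 1 \<rightarrow> - {x}"
    and hom: "homotopic_with_canon (\<lambda>_. True) (sphere 0 1) (- {x}) f g"
  shows "disk_map f x c = disk_map g x c"
proof (rule inj_onD[OF inj_boundary_local])
  show "hom_boundary 2 euclidean (- {x}) (disk_map f x c) = hom_boundary 2 euclidean (- {x}) (disk_map g x c)"
    unfolding boundary_disk_map[OF f] boundary_disk_map[OF g] homology_homotopy_empty[OF hom] ..
qed (simp_all add: hom_induced_carrier)

text \<open>Winding numbers classify loops in the punctured plane; the comparison loop is the unit
  circle around \<open>x\<close>.\<close>

lemma winding_number_1_homotopic: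
  assumes f: "continuous_on (sphere 0 1) f" "f \<in> sphere 0 1 \<rightarrow> - {x}"
    and wind: "winding_number (f \<circ> circlepath 0 1) x = 1"
  shows "homotopic_with_canon (\<lambda>_. True) (sphere 0 1) (- {x}) f (\<lambda>z. x + z)"
proof -
  have p: "path (f \<circ> circlepath 0 1)"
    using f(1) by (intro path_continuous_image) (auto intro: continuous_on_subset)
  have "x \<notin> path_image (f \<circ> circlepath 0 1)"
    using f(2) by (auto simp: path_image_compose)
  then have "homotopic_loops (- {x}) (f \<circ> circlepath 0 1) (circlepath x 1)"
    using p wind by (subst winding_number_homotopic_loops_eq[symmetric])
      (auto simp: winding_number_circlepath_centre pathstart_compose pathfinish_compose dist_norm)
  from homotopic_loops_imp_homotopic_circlemaps[OF this]
  show ?thesis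
  proof (rule homotopic_with_eq)
    fix z :: complex assume z: "z \<in> topspace (top_of_set (sphere 0 1))"
    have "exp (\<i> * of_real (Arg2pi z)) = z" using z complex_norm_eq_1_exp by auto
    then have c: "circlepath y 1 (Arg2pi z / (2 * pi)) = y + z" for y
      by (simp add: circlepath mult.commute)
    show "f z = ((f \<circ> circlepath 0 1) \<circ> (\<lambda>z. Arg2pi z / (2 * pi))) z" by (simp add: c)
    show "x + z = (circlepath x 1 \<circ> (\<lambda>z. Arg2pi z / (2 * pi))) z" by (simp add: c)
  qed auto
qed

lemma disk_map_winding_number_1:
  assumes f: "continuous_on (cball 0 1) f" "f \<in> sphere 0 1 \<rightarrow> - {x}"
    and wind: "winding_number (f \<circ> circlepath 0 1) x = 1"
  shows "disk_map f x c = disk_map (\<lambda>z. x + z) x c"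
proof (rule disk_map_homotopic[OF f])
  show "homotopic_with_canon (\<lambda>_. True) (sphere 0 1) (- {x}) f (\<lambda>z. x + z)"
    by (rule winding_number_1_homotopic) (use f wind in \<open>auto intro: continuous_on_subset\<close>)
qed (auto intro!: continuous_intros)

text \<open>The unit circle around \<open>x\<close> is a retract of the punctured plane, so its
  first homology embeds there; injectivity of the boundary on the disk carries this over to relative
  classes.\<close>

lemma inj_disk_map_translation: "inj_on (disk_map (\<lambda>z. x + z) x) (carrier disk_group)"
proof (rule inj_onI)
  fix c d assume c: "c \<in> carrier disk_group" "d \<in> carrier disk_group"
    and eq: "disk_map (\<lambda>z. x + z) x c = disk_map (\<lambda>z. x + z) x d"
  let ?s = "\<lambda>z. x + z" and ?b = "hom_boundary 2 (top_of_set (cball 0 1)) (sphere (0::complex) 1)"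
  have s: "continuous_on (cball 0 1) ?s" "?s \<in> sphere 0 1 \<rightarrow> - {x}" by (auto intro!: continuous_intros)
  have "retraction_maps (top_of_set (- {x})) (top_of_set (sphere 0 1)) (\<lambda>w. sgn (w - x)) ?s"
    by (auto simp: retraction_maps_def norm_sgn sgn_div_norm intro!: continuous_intros)
  then have "section_map (top_of_set (sphere 0 1)) (top_of_set (- {x})) ?s"
    unfolding section_map_def by blast
  then have "inj_on (hom_induced 1 (top_of_set (sphere 0 1)) {} (top_of_set (- {x})) {} ?s)
      (carrier (homology_group 1 (top_of_set (sphere 0 1))))"
    by (rule inj_on_hom_induced_section_map)
  moreover have "?b c \<in> carrier (homology_group 1 (top_of_set (sphere 0 1)))" for c
    using hom_boundary_carrier[of 2 "top_of_set (cball 0 1)" "sphere (0::complex) 1" c]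
    by (simp add: subtopology_disk_sphere)
  ultimately have "?b c = ?b d"
    using eq boundary_disk_map[OF s] by (metis inj_onD)
  then show "c = d" using inj_boundary_disk c by (metis inj_onD)
qed

section \<open>The presentation complex\<close>

lemma edge_map_skeleton1: "edge_map g s \<in> skeleton1"
  by (auto simp: edge_map_def skeleton1_def)

lemma word_loop_skeleton1: "word_loop w s \<in> skeleton1"
  by (simp add: word_loop_def Let_def edge_map_skeleton1) (simp add: skeleton1_def)

lemma face_map_sphere: "norm z = 1 \<Longrightarrow> face_map r i z \<in> skeleton1"
  by (simp add: face_map_def word_loop_skeleton1)

lemma skeleton1_points: "skeleton1 \<subseteq> complex_points I"
  by (auto simp: complex_points_def)

lemma face_map_points: "i \<in> I \<Longrightarrow> norm z \<le> 1 \<Longrightarrow> face_map r i z \<in> complex_points I"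
  using face_map_sphere[of z r i] skeleton1_points[of I]
  by (cases "norm z < 1") (auto simp: face_map_def complex_points_def)

lemma topspace_presentation_complex: "topspace (presentation_complex I r) = complex_points I"
proof -
  have "{s \<in> {0..1}. edge_map g s \<in> complex_points I} = {0..1}" for g
    using edge_map_skeleton1 skeleton1_points by blast
  moreover have "{z \<in> cball 0 1. face_map r i z \<in> complex_points I} = cball 0 1" if "i \<in> I" for i
    using face_map_points[OF that] by auto
  ultimately have "openin (presentation_complex I r) (complex_points I)"
    by (simp add: openin_presentation_complex complex_open_def)
  then show ?thesis
    by (metis complex_open_def openin_presentation_complex openin_subset openin_topspace subset_antisym)
qed

lemma continuous_map_edge_map: "continuous_map (top_of_set {0..1}) (presentation_complex I r) (edge_map g)"
  unfolding continuous_map_def topspace_presentation_complex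
  using edge_map_skeleton1 skeleton1_points[of I]
  by (auto simp: openin_presentation_complex complex_open_def)

lemma continuous_map_face_map:
  "i \<in> I \<Longrightarrow> continuous_map (top_of_set (cball 0 1)) (presentation_complex I r) (face_map r i)"
  unfolding continuous_map_def topspace_presentation_complex
  using face_map_points[of i I]
  by (auto simp: openin_presentation_complex complex_open_def)

text \<open>The universal property of the final topology.\<close>

lemma continuous_map_from_presentation_complex:
  fixes f :: "'i cpoint \<Rightarrow> 'c :: topological_space"
  assumes "\<And>g. continuous_on {0..1} (f \<circ> edge_map g)"
    and "\<And>i. i \<in> I \<Longrightarrow> continuous_on (cball 0 1) (f \<circ> face_map r i)"
  shows "continuous_map (presentation_complex I r) euclidean f"
  unfolding continuous_map_def
proof (intro conjI allI impI)
  fix U :: "'c set" assume "openin euclidean U"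
  then have U: "open U" by simp
  have "openin (top_of_set {0..1}) ({0..1} \<inter> (f \<circ> edge_map g) -` U)" for g
    by (rule continuous_openin_preimage_gen[OF assms(1) U])
  moreover have "{s \<in> {0..1}. edge_map g s \<in> {x \<in> complex_points I. f x \<in> U}} = {0..1} \<inter> (f \<circ> edge_map g) -` U" for g
    using edge_map_skeleton1 skeleton1_points by auto
  moreover have "openin (top_of_set (cball 0 1)) (cball 0 1 \<inter> (f \<circ> face_map r i) -` U)" if "i \<in> I" for i
    by (rule continuous_openin_preimage_gen[OF assms(2)[OF that] U])
  moreover have "{z \<in> cball 0 1. face_map r i z \<in> {x \<in> complex_points I. f x \<in> U}} = cball 0 1 \<inter> (f \<circ> face_map r i) -` U"
    if "i \<in> I" for i
    using face_map_points[OF that] by auto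
  ultimately show "openin (presentation_complex I r) {x \<in> topspace (presentation_complex I r). f x \<in> U}"
    by (simp add: openin_presentation_complex complex_open_def topspace_presentation_complex)
qed simp

text \<open>The complement pulls back to nothing on edges and to the open disk on faces.\<close>

lemma closedin_skeleton1: "closedin (presentation_complex I r) skeleton1"
proof -
  let ?U = "complex_points I - skeleton1"
  have 1: "{s \<in> {0..1}. edge_map g s \<in> ?U} = {}" for g
    using edge_map_skeleton1 by blast
  have 2: "{z \<in> cball 0 1. face_map r i z \<in> ?U} = ball 0 1" if "i \<in> I" for i
    using face_map_sphere[of _ r i] that
    by (force simp: face_map_def skeleton1_def complex_points_def)
  have "openin (presentation_complex I r) ?U"
    unfolding openin_presentation_complex complex_open_def
  proof (intro conjI allI ballI)
    show "openin (top_of_set {0..1}) {s \<in> {0..1}. edge_map g s \<in> ?U}" for g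
      unfolding 1 by (rule openin_empty)
    show "openin (top_of_set (cball 0 1)) {z \<in> cball 0 1. face_map r i z \<in> ?U}" if "i \<in> I" for i
      unfolding 2[OF that] by (rule open_subset) auto
  qed auto
  then show ?thesis
    by (simp add: closedin_def topspace_presentation_complex skeleton1_points)
qed

text \<open>Modulo the lattice, the unit grid is the 1-skeleton; along the circle every face map factors
  through this projection.\<close>

definition grid_point :: "complex \<Rightarrow> 'i cpoint" where
  "grid_point z =
     (if Re z \<in> \<int> \<and> Im z \<in> \<int> then Vertex
      else if Im z \<in> \<int> then Edge GX (frac (Re z)) else Edge GY (frac (Im z)))"

definition grid :: "complex set" where
  "grid = {z. Re z \<in> \<int> \<or> Im z \<in> \<int>}"

lemma lat_Ints: "Re (lat v) \<in> \<int>" "Im (lat v) \<in> \<int>"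
  by (simp_all add: lat_def)

lemma frac_add_Ints: "n \<in> \<int> \<Longrightarrow> frac (n + x) = frac x"
  by (auto elim!: Ints_cases simp: frac_def)

lemma Ints_add_iff: "n \<in> \<int> \<Longrightarrow> n + x \<in> \<int> \<longleftrightarrow> x \<in> \<int>" for x :: real
  by (metis Ints_add Ints_diff add_diff_cancel_left')

lemma grid_point_translate: "grid_point (lat v + z) = grid_point z"
  by (simp add: grid_point_def Ints_add_iff lat_Ints frac_add_Ints)

lemma step_Ints: "Re (step a) \<in> \<int>" "Im (step a) \<in> \<int>"
  by (cases a; cases "fst a"; cases "snd a"; simp)+

lemma lattice_vertex_Ints: "Re (lattice_vertex p w k) \<in> \<int>" "Im (lattice_vertex p w k) \<in> \<int>"
  unfolding lattice_vertex_def by (simp_all add: Re_sum Im_sum lat_Ints step_Ints Ints_add Ints_sum)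

lemma not_Ints_between: "0 < x \<Longrightarrow> x < 1 \<Longrightarrow> x \<notin> \<int>" for x :: real
  by (auto elim!: Ints_cases)

text \<open>Links the abstract attaching loop with the plane: whichever start \<open>p\<close> is
  taken, projecting the lattice path modulo the lattice recovers the loop.\<close>

lemma word_loop_grid_point:
  assumes "s \<ge> 0"
  shows "word_loop w s = grid_point (lattice_path p w s)" "lattice_path p w s \<in> grid"
proof -
  define u where "u = real (length w) * s"
  define k where "k = nat \<lfloor>u\<rfloor>"
  define f where "f = u - real k"
  have u0: "u \<ge> 0" using assms by (simp add: u_def)
  then have k: "real k = of_int \<lfloor>u\<rfloor>" by (simp add: k_def)
  have f: "0 \<le> f" "f < 1" unfolding f_def k by linarith+
  define V where "V = lattice_vertex p w k"
  have V: "Re V \<in> \<int>" "Im V \<in> \<int>" by (simp_all add: V_def lattice_vertex_Ints)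
  have "word_loop w s = grid_point (lattice_path p w s) \<and> lattice_path p w s \<in> grid"
  proof (cases "k < length w")
    case False
    then have "word_loop w s = Vertex" "lattice_path p w s = lattice_vertex p w (length w)"
      by (simp_all add: word_loop_def lattice_path_def Let_def u_def[symmetric] k_def[symmetric])
    then show ?thesis by (simp add: grid_point_def grid_def lattice_vertex_Ints)
  next
    case True
    obtain g b where gb: "w ! k = (g, b)" by fastforce
    have w: "word_loop w s = edge_map g (if b then f else 1 - f)"
      using True gb by (simp add: word_loop_def Let_def u_def[symmetric] k_def[symmetric] f_def[symmetric])
    have l: "lattice_path p w s = V + of_real f * step (g, b)"
      using True gb by (simp add: lattice_path_def Let_def u_def[symmetric] k_def[symmetric] f_def[symmetric] V_def)
    show ?thesis
    proof (cases "f = 0")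
      case True
      then show ?thesis by (simp add: w l edge_map_def grid_point_def grid_def V)
    next
      case False
      then have f': "0 < f" "f < 1" "0 < 1 - f" "1 - f < 1" using f by auto
      have n: "f \<notin> \<int>" "- f \<notin> \<int>" using not_Ints_between[OF f'(1,2)] by auto
      \<comment> \<open>A point on an edge traversed backwards has fractional part
        \<open>1 - f\<close>, the parameter that \<open>word_loop\<close> gives to an inverse
        letter.\<close>
      have fr: "frac f = f" "frac (- f) = 1 - f"
        using f' n frac_neg[of f] frac_eq[of f] by auto
      have "V' + - f = V' - f" for V' :: real by simp
      then have fr': "Re V - f \<notin> \<int>" "Im V - f \<notin> \<int>" "frac (Re V - f) = 1 - f" "frac (Im V - f) = 1 - f"
        using Ints_add_iff[OF V(1), of "- f"] Ints_add_iff[OF V(2), of "- f"]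
          frac_add_Ints[OF V(1), of "- f"] frac_add_Ints[OF V(2), of "- f"] n fr by auto
      show ?thesis
        using f' n fr fr' V
        by (cases g; cases b) (simp_all add: w l edge_map_def grid_point_def grid_def Ints_add_iff frac_add_Ints)
    qed
  qed
  then show "word_loop w s = grid_point (lattice_path p w s)" "lattice_path p w s \<in> grid" by auto
qed

lemma cis_frac: "cis (2 * pi * frac x) = cis (2 * pi * x)"
proof -
  have "cis (2 * pi * x) = cis (2 * pi * frac x) * cis (2 * pi * of_int \<lfloor>x\<rfloor>)"
    by (simp add: cis_mult frac_def algebra_simps)
  then show ?thesis by (simp add: cis_multiple_2pi)
qed

lemma cis_Ints: "x \<in> \<int> \<Longrightarrow> cis (2 * pi * x) = 1"
  by (simp add: cis_multiple_2pi)

lemma cis_2pi_inj: "0 \<le> s \<Longrightarrow> s < 1 \<Longrightarrow> 0 \<le> s' \<Longrightarrow> s' < 1 \<Longrightarrow> cis (2 * pi * s) = cis (2 * pi * s') \<Longrightarrow> s = s'"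
proof -
  assume *: "0 \<le> s" "s < 1" "0 \<le> s'" "s' < 1" "cis (2 * pi * s) = cis (2 * pi * s')"
  have A: "Arg2pi (cis (2 * pi * u)) = 2 * pi * u" if "0 \<le> u" "u < 1" for u
    by (rule Arg2pi_unique[of 1]) (use that in \<open>simp_all add: cis_conv_exp\<close>)
  have "2 * pi * s = Arg2pi (cis (2 * pi * s))" by (rule A[OF *(1,2), symmetric])
  also have "\<dots> = 2 * pi * s'" unfolding *(5) by (rule A[OF *(3,4)])
  finally show ?thesis by simp
qed

text \<open>Each group relative to the complement of one open cell is infinite cyclic, and the other
  cells vanish in it. So the coordinate of a class at a cell can be read off there, and by joint
  injectivity the coordinates determine the class. The last two conclusions export this reading of
  coordinates, by which the class of a tiled region will be identified.\<close>

theorem cell_basis: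
  fixes \<xi> :: "'j \<Rightarrow> complex \<Rightarrow> 'y"
  assumes cells: "cell_family norm Y A J \<xi>"
  obtains \<Psi> where "\<Psi> \<in> iso (free_Abelian_group J) (relative_homology_group 2 Y A)"
    and "\<And>j. j \<in> J \<Longrightarrow> \<Psi> (frag_of j) = hom_induced 2 (top_of_set (cball 0 1)) (sphere 0 1) Y A (\<xi> j) disk_class"
    and "\<And>j. j \<in> J \<Longrightarrow> inj (\<lambda>n::int. hom_induced 2 (top_of_set (cball 0 1)) (sphere 0 1) Y
          (topspace Y - \<xi> j ` ball 0 1) (\<xi> j) disk_class
          [^]\<^bsub>relative_homology_group 2 Y (topspace Y - \<xi> j ` ball 0 1)\<^esub> n)"
    and "\<And>j x. j \<in> J \<Longrightarrow> Poly_Mapping.keys x \<subseteq> J \<Longrightarrow>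
          hom_induced 2 Y A Y (topspace Y - \<xi> j ` ball 0 1) id (\<Psi> x)
          = hom_induced 2 (top_of_set (cball 0 1)) (sphere 0 1) Y (topspace Y - \<xi> j ` ball 0 1) (\<xi> j) disk_class
            [^]\<^bsub>relative_homology_group 2 Y (topspace Y - \<xi> j ` ball 0 1)\<^esub> (poly_mapping.lookup x j)"
proof -
  interpret cell_family norm Y A J \<xi> by (rule cells)
  let ?H = "relative_homology_group 2 Y A"
  let ?c = "\<lambda>j. hom_induced 2 (top_of_set (cball 0 1)) (sphere 0 1) Y A (\<xi> j) disk_class"
  interpret H: comm_group ?H by simp
  let ?F = "free_Abelian_group J"
  let ?K = "\<lambda>t. relative_homology_group 2 Y (off t)"
  let ?q = "\<lambda>t. hom_induced 2 Y A Y (off t) id"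
  let ?k = "\<lambda>t. hom_induced 2 (top_of_set (cball 0 1)) (sphere 0 1) Y (off t) (\<xi> t)"
  let ?e = "\<lambda>t. ?k t disk_class"
  have q: "group_hom ?H (?K t) (?q t)" for t
    by (simp add: group_hom_def group_hom_axioms_def hom_induced_hom)
  have k: "?k t \<in> hom disk_group (?K t)" "bij_betw (?k t) (carrier disk_group) (carrier (?K t))" if "t \<in> J" for t
    using iso_cell[OF that, of 2] by (simp_all add: iso_def ball_cell ball_rim)
  have powers: "bij_betw (\<lambda>n::int. ?e t [^]\<^bsub>?K t\<^esub> n) UNIV (carrier (?K t))" if t: "t \<in> J" for t
  proof -
    have "bij_betw (?k t \<circ> (\<lambda>n::int. disk_class [^]\<^bsub>disk_group\<^esub> n)) UNIV (carrier (?K t))"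
      by (rule bij_betw_trans[OF disk_class_powers k(2)[OF t]])
    moreover have "?k t \<circ> (\<lambda>n::int. disk_class [^]\<^bsub>disk_group\<^esub> n) = (\<lambda>n. ?e t [^]\<^bsub>?K t\<^esub> n)"
      unfolding o_def by (intro ext hom_int_pow[OF k(1)[OF t]] disk_class_carrier) auto
    ultimately show ?thesis by simp
  qed
  \<comment> \<open>The diagonal relation: a closed cell other than \<open>t\<close> lies in
    \<open>off t\<close>.\<close>
  have qf: "?q t (?c s) = (if s = t then ?e t else \<one>\<^bsub>?K t\<^esub>)" if s: "s \<in> J" and t: "t \<in> J" for s t
  proof -
    have c: "continuous_map (top_of_set (cball 0 1)) Y (\<xi> s)"
      using cont_chi[OF s] by (simp add: ball_cell)
    have b: "\<xi> s \<in> sphere 0 1 \<rightarrow> A" using chi_rim[OF s] by (auto simp: ball_rim)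
    have i: "id \<in> A \<rightarrow> off t" using A_off[OF t] by auto
    have e: "?q t (?c s) = hom_induced 2 (top_of_set (cball 0 1)) (sphere 0 1) Y (off t) (\<xi> s) disk_class"
      by (subst hom_induced_compose'[OF c b _ i]) auto
    show ?thesis
    proof (cases "s = t")
      case False
      have "\<xi> s \<in> cball 0 1 \<rightarrow> off t"
        unfolding off_eq[OF t] using False s by (auto simp: ball_cell)
      then have "hom_induced 2 (top_of_set (cball 0 1)) (sphere 0 1) Y (off t) (\<xi> s) disk_class = \<one>\<^bsub>?K t\<^esub>"
        using c by (intro hom_induced_into_subset) auto
      then show ?thesis using e False by simp
    qed (use e in simp)
  qed
  have "?c ` J \<subseteq> carrier ?H" by (auto simp: hom_induced_carrier)
  then obtain \<Psi> where hom: "\<Psi> \<in> hom ?F ?H" and frag: "\<And>t. t \<in> J \<Longrightarrow> \<Psi> (frag_of t) = ?c t"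
    by (rule H.free_Abelian_group_universal) blast
  interpret P: group_hom ?F ?H \<Psi> using hom by (simp add: group_hom_def group_hom_axioms_def)
  have lookup: "?q t (\<Psi> x) = ?e t [^]\<^bsub>?K t\<^esub> (poly_mapping.lookup x t)" if t: "t \<in> J" and x: "Poly_Mapping.keys x \<subseteq> J" for t x
  proof -
    interpret K: comm_group "?K t" by simp
    interpret q: group_hom ?H "?K t" "?q t" by (rule q)
    have e: "?e t \<in> carrier (?K t)" by (rule hom_induced_carrier)
    have qc: "?q t y \<in> carrier (?K t)" for y by (rule hom_induced_carrier)
    show ?thesis
    proof (rule free_Abelian_group_induct[OF x])
      have "\<Psi> 0 = \<one>\<^bsub>?H\<^esub>" using P.hom_one by simp
      then show "?q t (\<Psi> 0) = ?e t [^]\<^bsub>?K t\<^esub> (poly_mapping.lookup (0 :: 'j \<Rightarrow>\<^sub>0 int) t)"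
        using q.hom_one by (simp only: lookup_zero int_pow_0)
    next
      fix x y
      assume keys: "Poly_Mapping.keys x \<subseteq> J" "Poly_Mapping.keys y \<subseteq> J"
        and IH: "?q t (\<Psi> x) = ?e t [^]\<^bsub>?K t\<^esub> (poly_mapping.lookup x t)"
          "?q t (\<Psi> y) = ?e t [^]\<^bsub>?K t\<^esub> (poly_mapping.lookup y t)"
      then have xy: "x \<in> carrier ?F" "y \<in> carrier ?F" "- y \<in> carrier ?F" by auto
      have "\<Psi> (x - y) = \<Psi> x \<otimes>\<^bsub>?H\<^esub> inv\<^bsub>?H\<^esub> (\<Psi> y)"
        using P.hom_mult[OF xy(1,3)] P.hom_inv[OF xy(2)] keys(2) by simp
      then have "?q t (\<Psi> (x - y)) = ?q t (\<Psi> x) \<otimes>\<^bsub>?K t\<^esub> inv\<^bsub>?K t\<^esub> (?q t (\<Psi> y))"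
        using xy by (metis H.inv_closed P.hom_closed q.hom_inv q.hom_mult)
      then show "?q t (\<Psi> (x - y)) = ?e t [^]\<^bsub>?K t\<^esub> (poly_mapping.lookup (x - y) t)"
        unfolding IH lookup_minus using K.int_pow_diff[OF e] by metis
    next
      fix a assume a: "a \<in> J"
      show "?q t (\<Psi> (frag_of a)) = ?e t [^]\<^bsub>?K t\<^esub> (poly_mapping.lookup (frag_of a) t)"
        unfolding frag[OF a] qf[OF a t] using e
        by (simp add: lookup_frag_of K.int_pow_1)
    qed
  qed
  have "inj_on \<Psi> (carrier ?F)"
  proof (rule inj_onI)
    fix x y assume xy: "x \<in> carrier ?F" "y \<in> carrier ?F" "\<Psi> x = \<Psi> y"
    show "x = y"
    proof (rule poly_mapping_eqI)
      fix t
      show "poly_mapping.lookup x t = poly_mapping.lookup y t"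
      proof (cases "t \<in> J")
        case True
        then show ?thesis
          using lookup[OF True, of x] lookup[OF True, of y] xy powers[OF True]
          by (metis UNIV_I bij_betw_def carrier_free_Abelian_group_iff inj_onD)
      next
        case False
        then show ?thesis using xy(1,2) by (metis carrier_free_Abelian_group_iff in_keys_iff subsetD)
      qed
    qed
  qed
  moreover have "\<Psi> ` carrier ?F = carrier ?H"
  proof
    show "carrier ?H \<subseteq> \<Psi> ` carrier ?F"
    proof
      fix w assume w: "w \<in> carrier ?H"
      have "\<exists>n::int. ?q t w = ?e t [^]\<^bsub>?K t\<^esub> n" if "t \<in> J" for t
      proof -
        have "?q t w \<in> carrier (?K t)" by (rule hom_induced_carrier)
        also have "\<dots> = range (\<lambda>n::int. ?e t [^]\<^bsub>?K t\<^esub> n)"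
          by (rule bij_betw_imp_surj_on[OF powers[OF that], symmetric])
        finally show ?thesis by (rule rangeE) (rule exI)
      qed
      then obtain n :: "'j \<Rightarrow> int" where n: "\<And>t. t \<in> J \<Longrightarrow> ?q t w = ?e t [^]\<^bsub>?K t\<^esub> n t" by metis
      \<comment> \<open>The combination with the coordinates of \<open>w\<close>; its image differs
        from \<open>w\<close> by a class that dies relative to every \<open>off t\<close>.\<close>
      define x where "x = (\<Sum>t\<in>J. frag_cmul (n t) (frag_of t))"
      have keys: "Poly_Mapping.keys x \<subseteq> J"
      proof -
        have "x \<in> carrier ?F"
          unfolding x_def
        proof (rule sum_closed_free_Abelian_group)
          fix t assume "t \<in> J"
          then show "frag_cmul (n t) (frag_of t) \<in> carrier ?F"
            using keys_cmul[of "n t" "frag_of t"] by auto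
        qed
        then show ?thesis by simp
      qed
      have lx: "poly_mapping.lookup x t = n t" if "t \<in> J" for t
      proof -
        have "poly_mapping.lookup x t = (\<Sum>s\<in>J. if s = t then n s else 0)"
          unfolding x_def lookup_sum by (intro sum.cong) (auto simp: lookup_frag_of)
        then show ?thesis using that finite_J by simp
      qed
      have Px: "\<Psi> x \<in> carrier ?H" using keys P.hom_closed by simp
      have "w \<otimes>\<^bsub>?H\<^esub> inv\<^bsub>?H\<^esub> (\<Psi> x) = \<one>\<^bsub>?H\<^esub>"
      proof (rule ball.joint_injectivity[OF cells])
        show "w \<otimes>\<^bsub>?H\<^esub> inv\<^bsub>?H\<^esub> (\<Psi> x) \<in> carrier ?H" using w Px by simp
        fix t assume t: "t \<in> J"
        interpret K: comm_group "?K t" by simp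
        interpret q: group_hom ?H "?K t" "?q t" by (rule q)
        have "?q t (\<Psi> x) = ?q t w" using lookup[OF t keys] n[OF t] lx[OF t] by simp
        then show "?q t (w \<otimes>\<^bsub>?H\<^esub> inv\<^bsub>?H\<^esub> (\<Psi> x)) = \<one>\<^bsub>?K t\<^esub>"
          using w Px by (metis H.inv_closed K.r_inv q.hom_closed q.hom_inv q.hom_mult)
      qed
      then have "w = \<Psi> x" using w Px by (metis H.inv_closed H.inv_equality H.inv_inv)
      then show "w \<in> \<Psi> ` carrier ?F" using keys by auto
    qed
  qed (use P.hom_closed in auto)
  ultimately have "\<Psi> \<in> iso ?F ?H" using hom by (simp add: iso_def bij_betw_def)
  moreover have "off = (\<lambda>j. topspace Y - \<xi> j ` ball 0 1)" by (simp add: ball_interior)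
  ultimately show thesis
    using that[OF _ frag, unfolded ball_interior[symmetric]] lookup powers by (simp add: bij_betw_def)
qed


text \<open>The charts are parameters because the winding maps use them on the faces; the complex
  itself depends only on \<open>T\<close> and \<open>r\<close>.\<close>

locale charted_complex =
  fixes T :: "cells set" and p :: "cells \<Rightarrow> int \<times> int" and r :: "cells \<Rightarrow> word"
    and \<kappa> :: "cells \<Rightarrow> complex \<Rightarrow> complex"
  assumes finite_T: "finite T"
    and chart: "\<And>t. t \<in> T \<Longrightarrow> tile_chart t (p t) (r t) (\<kappa> t)"
begin

abbreviation X :: "cells cpoint topology" where "X \<equiv> presentation_complex T r"

lemma kappa_cont: "t \<in> T \<Longrightarrow> continuous_on (cball 0 1) (\<kappa> t)"
  and kappa_image: "t \<in> T \<Longrightarrow> \<kappa> t ` cball 0 1 = plane t"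
  and kappa_inj: "t \<in> T \<Longrightarrow> inj_on (\<kappa> t) (cball 0 1)"
  using chart[of t] by (auto simp: tile_chart_def homeomorphism_def intro: inj_on_inverseI)

lemma kappa_boundary:
  "t \<in> T \<Longrightarrow> s \<in> {0..1} \<Longrightarrow> \<kappa> t (exp (- (2 * of_real pi * of_real s * \<i>))) = lattice_path (p t) (r t) s"
  using chart[of t] by (auto simp: tile_chart_def)

text \<open>The chart turns the clockwise parameter of the attaching circle, recovered as
  \<open>Arg2pi\<close> of the conjugate, into the parameter of the lattice path, whose projection
  is the attaching loop.\<close>

lemma face_map_boundary:
  assumes t: "t \<in> T" and z: "norm z = 1"
  shows "face_map r t z = grid_point (\<kappa> t z)" "\<kappa> t z \<in> grid"
proof -
  define s where "s = Arg2pi (cnj z) / (2 * pi)"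
  have s: "0 \<le> s" "s < 1" using Arg2pi_ge_0[of "cnj z"] Arg2pi_lt_2pi[of "cnj z"] by (auto simp: s_def)
  have "exp (\<i> * of_real (Arg2pi (cnj z))) = cnj z"
    using z complex_norm_eq_1_exp[of "cnj z"] by simp
  then have "cnj (exp (\<i> * of_real (Arg2pi (cnj z)))) = z" by simp
  then have "exp (- (\<i> * of_real (Arg2pi (cnj z)))) = z" by (simp add: exp_cnj)
  then have "exp (- (2 * of_real pi * of_real s * \<i>)) = z" by (simp add: s_def mult.commute)
  then have "\<kappa> t z = lattice_path (p t) (r t) s" using kappa_boundary[OF t, of s] s by auto
  then show "face_map r t z = grid_point (\<kappa> t z)" "\<kappa> t z \<in> grid"
    using word_loop_grid_point[OF s(1), where w = "r t" and p = "p t"] z by (simp_all add: face_map_def s_def)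
qed

fun coord :: "generator \<Rightarrow> complex \<Rightarrow> real" where
  "coord GX z = Re z"
| "coord GY z = Im z"

text \<open>A circle valued map on the whole complex that winds once around the circle along one edge
  and is constant along the other one. It extends over the faces because the boundaries of the tiles
  are closed paths in the plane.\<close>

fun winding_map :: "generator \<Rightarrow> cells cpoint \<Rightarrow> complex" where
  "winding_map g Vertex = 1"
| "winding_map g (Edge g' s) = (if g' = g then cis (2 * pi * s) else 1)"
| "winding_map g (Face t z) = cis (2 * pi * coord g (\<kappa> t z))"

lemma winding_map_grid_point:
  "z \<in> grid \<Longrightarrow> winding_map g (grid_point z) = cis (2 * pi * coord g z)"
  by (cases g) (auto simp: grid_point_def grid_def cis_frac cis_Ints)

lemma winding_map_face_map:
  "t \<in> T \<Longrightarrow> norm z \<le> 1 \<Longrightarrow> winding_map g (face_map r t z) = cis (2 * pi * coord g (\<kappa> t z))"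
  using face_map_boundary[of t z] winding_map_grid_point
  by (cases "norm z < 1") (auto simp: face_map_def)

lemma winding_map_edge_map:
  "s \<in> {0..1} \<Longrightarrow> winding_map g (edge_map g' s) = (if g' = g then cis (2 * pi * s) else 1)"
  by (auto simp: edge_map_def less_le)

lemma continuous_map_winding_map: "continuous_map X euclidean (winding_map g)"
proof (rule continuous_map_from_presentation_complex)
  fix g'
  have "continuous_on {0..1} (\<lambda>s. if g' = g then cis (2 * pi * s) else 1)"
    by (cases "g' = g") (auto intro!: continuous_intros)
  then show "continuous_on {0..1} (winding_map g \<circ> edge_map g')"
    by (rule continuous_on_eq) (simp add: winding_map_edge_map)
next
  fix t assume t: "t \<in> T"
  have "continuous_on (cball 0 1) (\<lambda>z. coord g (\<kappa> t z))"
    by (cases g) (auto intro!: continuous_intros kappa_cont t)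
  then have "continuous_on (cball 0 1) (\<lambda>z. cis (2 * pi * coord g (\<kappa> t z)))"
    by (intro continuous_intros)
  then show "continuous_on (cball 0 1) (winding_map g \<circ> face_map r t)"
    by (rule continuous_on_eq) (simp add: winding_map_face_map t)
qed

text \<open>Collapses everything outside the open face \<open>t\<close> to 0 and is injective on
  that face, since \<open>1 - norm z\<close> is positive there and recorded separately.\<close>

fun face_coordinate :: "cells \<Rightarrow> cells cpoint \<Rightarrow> complex \<times> real" where
  "face_coordinate t Vertex = 0"
| "face_coordinate t (Edge g s) = 0"
| "face_coordinate t (Face t' z) = (if t' = t then (of_real (1 - norm z) * z, 1 - norm z) else 0)"

lemma face_coordinate_skeleton1: "x \<in> skeleton1 \<Longrightarrow> face_coordinate t x = 0"
  by (auto simp: skeleton1_def)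

lemma continuous_map_face_coordinate: "continuous_map X euclidean (face_coordinate t)"
proof (rule continuous_map_from_presentation_complex)
  show "continuous_on {0..1} (face_coordinate t \<circ> edge_map g)" for g
    by (simp add: o_def face_coordinate_skeleton1 edge_map_skeleton1)
  fix t' assume t': "t' \<in> T"
  have "continuous_on (cball 0 1) (\<lambda>z::complex. if t' = t then (of_real (1 - norm z) * z, 1 - norm z) else 0)"
    by (cases "t' = t") (auto intro!: continuous_intros)
  then show "continuous_on (cball 0 1) (face_coordinate t \<circ> face_map r t')"
  proof (rule continuous_on_eq)
    fix z :: complex assume z: "z \<in> cball 0 1"
    show "(if t' = t then (of_real (1 - norm z) * z, 1 - norm z) else 0) = (face_coordinate t \<circ> face_map r t') z"
    proof (cases "norm z < 1")
      case True
      then show ?thesis by (simp add: face_map_def)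
    next
      case False
      then have "norm z = 1" using z by simp
      then show ?thesis by (simp add: face_coordinate_skeleton1 face_map_sphere zero_prod_def)
    qed
  qed
qed

lemma Hausdorff_separation:
  fixes f :: "'x \<Rightarrow> 'y :: t2_space"
  assumes "continuous_map Y euclidean f" "f x \<noteq> f y"
  shows "\<exists>U V. openin Y U \<and> openin Y V \<and> (x \<in> topspace Y \<longrightarrow> x \<in> U) \<and> (y \<in> topspace Y \<longrightarrow> y \<in> V) \<and> disjnt U V"
proof -
  obtain U V where UV: "open U" "open V" "f x \<in> U" "f y \<in> V" "U \<inter> V = {}"
    using hausdorff[OF assms(2)] by auto
  have "openin Y {z \<in> topspace Y. f z \<in> U}" "openin Y {z \<in> topspace Y. f z \<in> V}"
    using assms(1) UV by (auto simp: continuous_map_def)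
  then show ?thesis using UV
    by (intro exI[of _ "{z \<in> topspace Y. f z \<in> U}"] exI[of _ "{z \<in> topspace Y. f z \<in> V}"]) (auto simp: disjnt_def)
qed

text \<open>Points are separated by continuous maps into Hausdorff spaces: the winding maps
  distinguish points of the 1-skeleton, the face coordinates distinguish a point of an open face
  from every other point.\<close>

lemma Hausdorff_X: "Hausdorff_space X"
  unfolding Hausdorff_space_def
proof (intro allI impI, elim conjE)
  fix x y assume xy: "x \<in> topspace X" "y \<in> topspace X" "x \<noteq> y"
  have "(\<exists>g. winding_map g x \<noteq> winding_map g y) \<or> (\<exists>t. face_coordinate t x \<noteq> face_coordinate t y)"
  proof (rule ccontr)
    assume "\<not> ?thesis"
    then have eq: "\<And>g. winding_map g x = winding_map g y" "\<And>t. face_coordinate t x = face_coordinate t y" by auto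
    have face: "x' = y'" if "x' \<in> topspace X" "y' \<in> topspace X" "x' = Face t z"
      "face_coordinate t x' = face_coordinate t y'" for x' y' t z
    proof -
      have z: "norm z < 1" using that(1,3) by (auto simp: topspace_presentation_complex complex_points_def skeleton1_def)
      show ?thesis
      proof (cases y')
        case (Face t' z')
        then show ?thesis using that(3,4) z by (cases "t' = t") (auto simp: zero_prod_def)
      qed (use that(3,4) z in \<open>auto simp: zero_prod_def\<close>)
    qed
    have circle: "cis (2 * pi * s) \<noteq> 1" if "0 < s" "s < 1" for s
      using cis_2pi_inj[of s 0] that by auto
    show False
    proof (cases "x \<in> skeleton1 \<and> y \<in> skeleton1")
      case True
      have edge: "x' = y'" if e: "x' = Edge g s" "0 < s" "s < 1" "y' \<in> skeleton1"
        "winding_map g x' = winding_map g y'" for x' y' g s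
      proof -
        have "winding_map g y' \<noteq> 1" using e(1,2,3,5) circle[of s] by simp
        then obtain s' where s': "y' = Edge g s'" "0 < s'" "s' < 1"
          using e(4) by (auto simp: skeleton1_def split: if_splits)
        then have "s = s'" using e(1,2,3,5) by (intro cis_2pi_inj) auto
        then show ?thesis using s' e(1) by simp
      qed
      have "x = Vertex \<or> (\<exists>g s. x = Edge g s \<and> 0 < s \<and> s < 1)"
        "y = Vertex \<or> (\<exists>g s. y = Edge g s \<and> 0 < s \<and> s < 1)"
        using True by (auto simp: skeleton1_def)
      then consider "x = Vertex" "y = Vertex" | g s where "x = Edge g s" "0 < s" "s < 1"
        | g s where "y = Edge g s" "0 < s" "s < 1" by blast
      then show False
      proof cases
        case 1
        then show False using xy(3) by simp
      next
        case 2
        then show False using edge[OF 2 _ eq(1)] True xy(3) by blast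
      next
        case 3
        then show False using edge[OF 3 _ eq(1)[symmetric]] True xy(3) by blast
      qed
    next
      case False
      then have "(\<exists>t z. x = Face t z) \<or> (\<exists>t z. y = Face t z)"
        using xy(1,2) by (auto simp: topspace_presentation_complex complex_points_def)
      then show False using face xy eq(2) by metis
    qed
  qed
  then show "\<exists>U V. openin X U \<and> openin X V \<and> x \<in> U \<and> y \<in> V \<and> disjnt U V"
    using Hausdorff_separation[OF continuous_map_winding_map] Hausdorff_separation[OF continuous_map_face_coordinate] xy
    by metis
qed

lemma cells2: "cell_family norm X skeleton1 T (face_map r)"
proof unfold_locales
  show "topspace X = skeleton1 \<union> (\<Union>t\<in>T. face_map r t ` ball.cell)"
  proof
    show "topspace X \<subseteq> skeleton1 \<union> (\<Union>t\<in>T. face_map r t ` ball.cell)"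
    proof
      fix x assume "x \<in> topspace X"
      then consider "x \<in> skeleton1" | t z where "t \<in> T" "norm z < 1" "x = Face t z"
        by (auto simp: topspace_presentation_complex complex_points_def)
      then show "x \<in> skeleton1 \<union> (\<Union>t\<in>T. face_map r t ` ball.cell)"
      proof cases
        case 2
        then have "x = face_map r t z" "z \<in> ball.cell" by (simp_all add: face_map_def ball_cell)
        then show ?thesis using 2(1) by blast
      qed simp
    qed
    show "skeleton1 \<union> (\<Union>t\<in>T. face_map r t ` ball.cell) \<subseteq> topspace X"
      using skeleton1_points face_map_points[of _ T] by (auto simp: topspace_presentation_complex ball_cell)
  qed
  show "ball.attaches X skeleton1 (face_map r t)" if "t \<in> T" for t
    unfolding ball.attaches_def ball_interior unfolding ball_cell ball_rim
  proof (intro conjI)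
    show "continuous_map (top_of_set (cball 0 1)) X (face_map r t)"
      by (rule continuous_map_face_map[OF that])
    show "face_map r t ` sphere 0 1 \<subseteq> skeleton1" using face_map_sphere by auto
    show "inj_on (face_map r t) (ball 0 1)" by (auto simp: face_map_def inj_on_def)
    show "face_map r t ` ball 0 1 \<inter> skeleton1 = {}" by (auto simp: face_map_def skeleton1_def)
  qed
  show "face_map r t ` (ball.cell - ball.rim) \<inter> face_map r t' ` (ball.cell - ball.rim) = {}" if "t \<noteq> t'" for t t'
    unfolding ball_interior using that by (auto simp: face_map_def)
qed (simp_all add: Hausdorff_X closedin_skeleton1 finite_T)

abbreviation H2 :: "cells cpoint chain set monoid" where
  "H2 \<equiv> relative_homology_group 2 X skeleton1"

definition face_class :: "cells \<Rightarrow> cells cpoint chain set" where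
  "face_class t = hom_induced 2 (top_of_set (cball 0 1)) (sphere 0 1) X skeleton1 (face_map r t) disk_class"

abbreviation X1 :: "cells cpoint topology" where "X1 \<equiv> subtopology X skeleton1"

theorem H2_basis:
  "\<exists>\<Psi> \<in> iso (free_Abelian_group T) H2. \<forall>t\<in>T. \<Psi> (frag_of t) = face_class t"
proof (rule cell_basis[OF cells2])
  fix \<Psi> assume "\<Psi> \<in> iso (free_Abelian_group T) H2"
    "\<And>t. t \<in> T \<Longrightarrow> \<Psi> (frag_of t) = hom_induced 2 (top_of_set (cball 0 1)) (sphere 0 1) X skeleton1 (face_map r t) disk_class"
  then show ?thesis by (intro bexI[of _ \<Psi>]) (simp_all add: face_class_def)
qed

end

section \<open>One-dimensional cells and the cellular boundary\<close>

interpretation line: cell_model "abs :: real \<Rightarrow> real"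
proof
  have "{x::real. \<bar>x\<bar> \<le> 1} = {-1..1}" by auto
  then show "compact {x::real. \<bar>x\<bar> \<le> 1}" by simp
  show "continuous_on UNIV (abs :: real \<Rightarrow> real)" by (intro continuous_intros)
qed (simp_all add: abs_mult)

lemma line_cell: "line.cell = {-1..1}" and line_rim: "line.rim = {-1, 1}"
  by (auto simp: line.cell_def line.rim_def)

definition wrap :: "real \<Rightarrow> complex" where
  "wrap u = cis (2 * pi * ((u + 1) / 2))"

text \<open>The circle as one 1-cell attached to the point 1: the target in which winding along an
  edge is measured.\<close>

lemma wrap_attachment: "cell_attachment abs (top_of_set (sphere 0 1)) {1} wrap"
proof unfold_locales
  have int: "wrap u \<noteq> 1" if "-1 < u" "u < 1" for u
    using cis_2pi_inj[of "(u + 1) / 2" 0] that by (auto simp: wrap_def)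
  show "topspace (top_of_set (sphere 0 1)) = {1} \<union> wrap ` line.cell"
  proof
    show "topspace (top_of_set (sphere 0 1)) \<subseteq> {1} \<union> wrap ` line.cell"
    proof
      fix e :: complex assume "e \<in> topspace (top_of_set (sphere 0 1))"
      then have "exp (\<i> * of_real (Arg2pi e)) = e" using complex_norm_eq_1_exp by auto
      then have "e = wrap (Arg2pi e / pi - 1)" by (simp add: wrap_def cis_conv_exp)
      moreover have "Arg2pi e / pi - 1 \<in> line.cell"
        using Arg2pi_ge_0[of e] Arg2pi_lt_2pi[of e] by (auto simp: line_cell field_simps)
      ultimately show "e \<in> {1} \<union> wrap ` line.cell" by blast
    qed
  qed (auto simp: wrap_def)
  show "line.attaches (top_of_set (sphere 0 1)) {1} wrap"
    unfolding line.attaches_def line_cell line_rim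
  proof (intro conjI)
    show "continuous_map (top_of_set {-1..1}) (top_of_set (sphere 0 1)) wrap"
      unfolding wrap_def by (auto intro!: continuous_intros)
    show "wrap ` {-1, 1} \<subseteq> {1}" 
    proof -
      have "wrap 1 = cis (2 * pi)" by (simp add: wrap_def)
      then have "wrap 1 = 1" by (simp only: cis_2pi)
      moreover have "wrap (-1) = 1" by (simp add: wrap_def)
      ultimately show ?thesis by simp
    qed
    show "inj_on wrap ({-1..1} - {-1, 1})"
    proof (rule inj_onI)
      fix u v :: real assume "u \<in> {-1..1} - {-1, 1}" "v \<in> {-1..1} - {-1, 1}" "wrap u = wrap v"
      then have "(u + 1) / 2 = (v + 1) / 2"
        unfolding wrap_def by (intro cis_2pi_inj) auto
      then show "u = v" by simp
    qed
    show "wrap ` ({-1..1} - {-1, 1}) \<inter> {1} = {}" using int by (force simp: less_le)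
  qed
qed (auto simp: Hausdorff_space_subtopology closed_subset)

context charted_complex
begin

abbreviation edge_cell :: "generator \<Rightarrow> real \<Rightarrow> cells cpoint" where
  "edge_cell g u \<equiv> edge_map g ((u + 1) / 2)"

lemma cells1: "cell_family abs X1 skeleton0 UNIV edge_cell"
proof unfold_locales
  have 0: "skeleton0 \<subseteq> skeleton1" by (auto simp: skeleton0_def skeleton1_def)
  have top: "topspace X1 = skeleton1"
    using skeleton1_points[of T] by (auto simp: topspace_presentation_complex)
  show H: "Hausdorff_space X1" by (simp add: Hausdorff_space_subtopology Hausdorff_X)
  show "closedin X1 skeleton0"
    using closedin_Hausdorff_sing_eq[OF H, of Vertex] top 0 by (auto simp: skeleton0_def)
  have "(UNIV :: generator set) = {GX, GY}" using generator.exhaust by auto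
  then show "finite (UNIV :: generator set)" by (metis finite.emptyI finite.insertI)
  have e: "\<exists>u\<in>{-1..1} - {-1, 1}. Edge g s = edge_cell g u" if "0 < s" "s < 1" for g s
    using that by (intro bexI[of _ "2 * s - 1"]) (auto simp: edge_map_def)
  show "topspace X1 = skeleton0 \<union> (\<Union>g\<in>UNIV. edge_cell g ` line.cell)"
    unfolding top
  proof
    show "skeleton1 \<subseteq> skeleton0 \<union> (\<Union>g\<in>UNIV. edge_cell g ` line.cell)"
      using e by (force simp: skeleton1_def skeleton0_def line_cell)
    show "skeleton0 \<union> (\<Union>g\<in>UNIV. edge_cell g ` line.cell) \<subseteq> skeleton1"
      using 0 edge_map_skeleton1 by auto
  qed
  show "line.attaches X1 skeleton0 (edge_cell g)" for g
    unfolding line.attaches_def line_cell line_rim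
  proof (intro conjI)
    have "continuous_map (top_of_set {-1..1::real}) (top_of_set {0..1}) (\<lambda>u. (u + 1) / 2)"
      by (auto intro!: continuous_intros)
    from continuous_map_compose[OF this continuous_map_edge_map]
    show "continuous_map (top_of_set {-1..1}) X1 (edge_cell g)"
      using edge_map_skeleton1 by (auto simp: continuous_map_in_subtopology o_def)
    show "edge_cell g ` {-1, 1} \<subseteq> skeleton0" by (auto simp: edge_map_def skeleton0_def)
    show "inj_on (edge_cell g) ({-1..1} - {-1, 1})"
      by (rule inj_onI) (auto simp: edge_map_def split: if_splits)
    show "edge_cell g ` ({-1..1} - {-1, 1}) \<inter> skeleton0 = {}" by (auto simp: edge_map_def skeleton0_def)
  qed
  show "edge_cell g ` (line.cell - line.rim) \<inter> edge_cell g' ` (line.cell - line.rim) = {}" if "g \<noteq> g'" for g g'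
    using that unfolding line_cell line_rim by (auto simp: edge_map_def split: if_splits)
qed

text \<open>By exactness, boundaries of relative classes die in the homology of the whole complex, to
  which the winding maps extend.\<close>

theorem cellular_boundary2_trivial:
  assumes c: "c \<in> carrier H2"
  shows "cellular_boundary2 T r c = \<one>\<^bsub>relative_homology_group 1 X1 skeleton0\<^esub>"
proof -
  interpret cell_family abs X1 skeleton0 UNIV edge_cell by (rule cells1)
  let ?b = "hom_boundary 2 X skeleton1 c"
  let ?w = "hom_induced 1 X1 {} X1 skeleton0 id ?b"
  let ?S = "top_of_set (sphere (0::complex) 1)"
  have b: "?b \<in> carrier (homology_group 1 X1)"
    using hom_boundary_carrier[of 2 X skeleton1 c] by simp
  have "?b \<in> hom_boundary 2 X skeleton1 ` carrier H2" using c by simp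
  also have "\<dots> = kernel (homology_group 1 X1) (homology_group 1 X) (hom_induced 1 X1 {} X {} id)"
    using homology_exactness_axiom_2[of 2 X skeleton1] by simp
  finally have kill: "hom_induced 1 X1 {} X {} id ?b = \<one>\<^bsub>homology_group 1 X\<^esub>" by (simp add: kernel_def)
  have "?w = \<one>\<^bsub>relative_homology_group 1 X1 skeleton0\<^esub>"
  proof (rule line.joint_injectivity[OF cells1])
    show "?w \<in> carrier (relative_homology_group 1 X1 skeleton0)" by (rule hom_induced_carrier)
    fix g :: generator
    let ?p = "winding_map g"
    have pX: "continuous_map X ?S ?p"
      using continuous_map_winding_map[of g]
      by (simp add: continuous_map_in_subtopology) (metis (no_types, lifting) Pi_I dist_0_norm mem_sphere norm_cis norm_one winding_map.elims)
    then have pX1: "continuous_map X1 ?S ?p" by (rule continuous_map_from_subtopology)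
    \<comment> \<open>Along the other edge \<open>winding_map g\<close> is constantly 1, so it is a
      map of pairs to the circle and its basepoint.\<close>
    have p_off: "?p \<in> off g \<rightarrow> {1}"
    proof
      fix x assume x: "x \<in> off g"
      then have "x \<in> skeleton1" by auto
      then consider "x = Vertex" | g' s where "x = Edge g' s" "0 < s" "s < 1" by (auto simp: skeleton1_def)
      then show "?p x \<in> {1}"
      proof cases
        case 2
        then have "x = edge_cell g' (2 * s - 1)" "2 * s - 1 \<in> line.cell - line.rim"
          by (auto simp: edge_map_def line_cell line_rim)
        then have "g' \<noteq> g" using x by blast
        then show ?thesis using 2 by simp
      qed simp
    qed
    let ?K = "relative_homology_group 1 X1 (off g)" and ?C = "relative_homology_group 1 ?S {1}"
    let ?pi = "hom_induced 1 X1 (off g) ?S {1} ?p"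
    let ?e = "hom_induced 1 (top_of_set line.cell) line.rim X1 (off g) (edge_cell g)"
    \<comment> \<open>Along the edge \<open>g\<close> the winding map is the standard
      parametrisation of the circle. Edge and circle being attachments of the same cell,
      \<open>?pi\<close> is bijective.\<close>
    have "?pi (?e x) = hom_induced 1 (top_of_set line.cell) line.rim ?S {1} wrap x" for x
    proof -
      have "edge_cell g \<in> line.rim \<rightarrow> off g" using chi_rim[of g] A_off[of g] by blast
      then have "?pi (?e x) = hom_induced 1 (top_of_set line.cell) line.rim ?S {1} (?p \<circ> edge_cell g) x"
        using cont_chi[of g] pX1 p_off by (intro hom_induced_compose') auto
      also have "\<dots> = hom_induced 1 (top_of_set line.cell) line.rim ?S {1} wrap x"
        by (rule fun_cong[OF hom_induced_eq]) (auto simp: line_cell winding_map_edge_map wrap_def)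
      finally show ?thesis .
    qed
    then have comp: "?pi \<circ> ?e = hom_induced 1 (top_of_set line.cell) line.rim ?S {1} wrap" by auto
    have "bij_betw ?pi (carrier ?K) (carrier ?C)"
    proof (subst bij_betw_comp_iff)
      show "bij_betw ?e (carrier (relative_homology_group 1 (top_of_set line.cell) line.rim)) (carrier ?K)"
        using iso_cell[of g 1] by (simp add: iso_def)
      show "bij_betw (?pi \<circ> ?e) (carrier (relative_homology_group 1 (top_of_set line.cell) line.rim)) (carrier ?C)"
        unfolding comp using cell_attachment.iso_cell[OF wrap_attachment, of 1] by (simp add: iso_def)
    qed
    then have inj: "inj_on ?pi (carrier ?K)" by (simp add: bij_betw_def)
    let ?r = "hom_induced 1 X1 skeleton0 X1 (off g) id"
    have i: "id \<in> skeleton0 \<rightarrow> off g" using A_off[of g] by auto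
    have rw: "?r ?w = hom_induced 1 X1 {} X1 (off g) id ?b"
      by (subst hom_induced_compose'[OF _ _ _ i]) auto
    have "?pi (?r ?w) = hom_induced 1 X1 {} ?S {1} ?p ?b"
      unfolding rw by (subst hom_induced_compose'[OF _ _ pX1 p_off]) auto
    \<comment> \<open>Here \<open>winding_map g\<close> must be defined on all of \<open>X\<close>,
      not merely on the 1-skeleton.\<close>
    also have "\<dots> = hom_induced 1 X {} ?S {1} ?p (hom_induced 1 X1 {} X {} id ?b)"
      by (subst hom_induced_compose'[OF _ _ pX]) (auto simp: continuous_map_from_subtopology)
    also have "\<dots> = \<one>\<^bsub>?C\<^esub>" unfolding kill by (intro hom_one[OF hom_induced_hom]) auto
    also have "\<dots> = ?pi \<one>\<^bsub>?K\<^esub>" by (intro hom_one[OF hom_induced_hom, symmetric]) auto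
    finally show "?r ?w = \<one>\<^bsub>?K\<^esub>"
      by (rule inj_onD[OF inj]) (simp_all only: hom_induced_carrier group.is_monoid monoid.one_closed group_relative_homology_group)
  qed
  then show ?thesis by (simp add: cellular_boundary2_def Let_def)
qed

corollary cellular_H2_eq: "cellular_H2 T r = H2"
proof -
  have "kernel H2 (relative_homology_group 1 X1 skeleton0) (cellular_boundary2 T r) = carrier H2"
    using cellular_boundary2_trivial by (auto simp: kernel_def)
  moreover have "G\<lparr>carrier := carrier G\<rparr> = G" for G :: "'g monoid" by (cases G) simp
  ultimately show ?thesis by (simp add: cellular_H2_def Let_def)
qed

end

section \<open>Tilings\<close>

abbreviation unit_cbox :: "int \<times> int \<Rightarrow> complex set" where
  "unit_cbox v \<equiv> cbox (lat v) (lat v + Complex 1 1)"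

abbreviation unit_box :: "int \<times> int \<Rightarrow> complex set" where
  "unit_box v \<equiv> box (lat v) (lat v + Complex 1 1)"

lemma unit_box_meets_unit_cbox:
  assumes "z \<in> unit_box v" "z \<in> unit_cbox w" shows "v = w"
proof -
  have "of_int (fst v) < (of_int (fst w) + 1 :: real)" "of_int (fst w) < (of_int (fst v) + 1 :: real)"
    "of_int (snd v) < (of_int (snd w) + 1 :: real)" "of_int (snd w) < (of_int (snd v) + 1 :: real)"
    using assms by (auto simp: in_box_complex_iff in_cbox_complex_iff lat_def)
  then have "fst v = fst w" "snd v = snd w" by linarith+
  then show ?thesis by (simp add: prod_eq_iff)
qed

lemma open_meets_unit_box:
  assumes "open U" "z \<in> U" "z \<in> unit_cbox v" shows "U \<inter> unit_box v \<noteq> {}"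
proof -
  have "unit_box v \<noteq> {}"
    by (simp add: box_ne_empty Basis_complex_def inner_complex_def lat_def)
  then have "z \<in> closure (unit_box v)" using assms(3) by (simp add: closure_box)
  then show ?thesis using assms(1,2) by (metis IntI empty_iff open_Int_closure_eq_empty)
qed

text \<open>An open set that meets a closed lattice square meets its interior, and an open square
  meets no other closed one. Hence the interior of a tile misses every tile with disjoint
  cells.\<close>

lemma open_subset_plane_disjoint:
  assumes "open U" "U \<subseteq> plane S" "S \<inter> S' = {}" shows "U \<inter> plane S' = {}"
proof (rule equals0I)
  fix z assume z: "z \<in> U \<inter> plane S'"
  then obtain v where v: "v \<in> S'" "z \<in> unit_cbox v" by (auto simp: plane_def)
  then obtain y where y: "y \<in> U" "y \<in> unit_box v" using open_meets_unit_box[OF assms(1)] z by blast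
  then obtain w where "w \<in> S" "y \<in> unit_cbox w" using assms(2) by (auto simp: plane_def)
  then show False using unit_box_meets_unit_cbox y(2) v(1) assms(3) by blast
qed

lemma plane_translate: "plane (translate v S) = (\<lambda>z. lat v + z) ` plane S"
proof -
  have "unit_cbox (fst v + fst c, snd v + snd c) = (\<lambda>z. lat v + z) ` unit_cbox c" for c
  proof -
    have "lat (fst v + fst c, snd v + snd c) = lat v + lat c" by (simp add: lat_def complex_eq_iff)
    then show ?thesis using cbox_translation[of "lat v" "lat c" "lat c + Complex 1 1"] by (simp add: add.assoc)
  qed
  then show ?thesis by (simp add: plane_def translate_def image_UN)
qed

lemma plane_Union: "plane (\<Union>i\<in>I. S i) = (\<Union>i\<in>I. plane (S i))"
  by (auto simp: plane_def)

text \<open>Invariance of domain, applied to \<open>f\<close> for one inclusion and to its inverse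
  for the other.\<close>

lemma homeomorphism_cball_interior:
  fixes f :: "complex \<Rightarrow> complex"
  assumes h: "homeomorphism (cball 0 1) P f g"
  shows "open (f ` ball 0 1)" "interior P = f ` ball 0 1"
proof -
  have f: "continuous_on (cball 0 1) f" "inj_on f (cball 0 1)" "f ` cball 0 1 = P"
    using h by (auto simp: homeomorphism_def intro: inj_on_inverseI)
  show op: "open (f ` ball 0 1)"
    by (rule invariance_of_domain) (use f in \<open>auto intro: continuous_on_subset inj_on_subset\<close>)
  show "interior P = f ` ball 0 1"
  proof
    show "f ` ball 0 1 \<subseteq> interior P" using op f(3) by (intro interior_maximal) auto
    have "continuous_on P g" "inj_on g P"
      using h by (auto simp: homeomorphism_def intro: inj_on_inverseI[where g = f])
    then have "continuous_on (interior P) g" "inj_on g (interior P)"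
      using interior_subset[of P] by (auto intro: continuous_on_subset inj_on_subset)
    then have "open (g ` interior P)" by (rule invariance_of_domain[OF _ open_interior])
    moreover have "g ` interior P \<subseteq> cball 0 1" using h interior_subset[of P] by (auto simp: homeomorphism_def)
    ultimately have "g ` interior P \<subseteq> ball 0 1" using interior_maximal interior_cball by metis
    then show "interior P \<subseteq> f ` ball 0 1"
      using h interior_subset[of P] by (force simp: homeomorphism_def image_iff)
  qed
qed

lemma homeomorphism_cball_frontier:
  fixes f :: "complex \<Rightarrow> complex"
  assumes h: "homeomorphism (cball 0 1) P f g"
  shows "frontier P = f ` sphere 0 1"
proof -
  have f: "continuous_on (cball 0 1) f" "inj_on f (cball 0 1)" "f ` cball 0 1 = P"
    using h by (auto simp: homeomorphism_def intro: inj_on_inverseI)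
  have "compact P" using f compact_continuous_image[OF f(1)] by auto
  then have "frontier P = f ` cball 0 1 - f ` ball 0 1"
    using homeomorphism_cball_interior(2)[OF h] f(3) by (simp add: frontier_def compact_imp_closed)
  also have "\<dots> = f ` (cball 0 1 - ball 0 1)"
    using f(2) by (metis inj_on_image_set_diff ball_subset_cball Diff_subset)
  also have "cball (0::complex) 1 - ball 0 1 = sphere 0 1" by auto
  finally show ?thesis .
qed

locale tiled_complex = charted_complex +
  assumes boundary: "\<And>t. t \<in> T \<Longrightarrow> boundary_word t (p t) (r t)"
begin

definition placed :: "cells \<times> (int \<times> int) \<Rightarrow> complex \<Rightarrow> complex" where
  "placed j z = lat (snd j) + \<kappa> (fst j) z"

lemma placed_cont: "fst j \<in> T \<Longrightarrow> continuous_on (cball 0 1) (placed j)"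
  unfolding placed_def by (intro continuous_intros kappa_cont)

lemma placed_inj: "fst j \<in> T \<Longrightarrow> inj_on (placed j) (cball 0 1)"
  using kappa_inj[of "fst j"] by (simp add: placed_def inj_on_def)

lemma placed_image: "fst j \<in> T \<Longrightarrow> placed j ` cball 0 1 = plane (translate (snd j) (fst j))"
  by (simp add: plane_translate kappa_image[symmetric] image_image placed_def)

lemma placed_open: "fst j \<in> T \<Longrightarrow> open (placed j ` ball 0 1)"
  by (rule invariance_of_domain) (auto intro: continuous_on_subset[OF placed_cont] inj_on_subset[OF placed_inj])

text \<open>The boundary path winds -1 times and the chart follows it clockwise, so the
  counterclockwise circle winds +1 times, the sign demanded of region charts.\<close>

lemma kappa_winding: 
  assumes t: "t \<in> T" shows "winding_number (\<kappa> t \<circ> circlepath 0 1) (\<kappa> t 0) = 1"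
proof -
  let ?L = "lattice_path (p t) (r t)"
  obtain \<kappa>' where h: "homeomorphism (cball 0 1) (plane t) (\<kappa> t) \<kappa>'"
    using chart[OF t] by (auto simp: tile_chart_def)
  have int: "\<kappa> t 0 \<in> interior (plane t)" using homeomorphism_cball_interior(2)[OF h] by simp
  have L: "simple_path ?L" "path_image ?L = frontier (plane t)" "winding_number ?L (\<kappa> t 0) = -1"
    using boundary[OF t] int by (auto simp: boundary_word_def)
  have "(\<kappa> t \<circ> circlepath 0 1) s = reversepath ?L s" if "0 \<le> s" "s \<le> 1" for s
  proof -
    \<comment> \<open>Running backwards through the clockwise parameter; the exponents differ by a
      full period.\<close>
    have "exp (2 * of_real pi * \<i> * of_real s) = exp (- (2 * of_real pi * of_real (1 - s) * \<i>))"
      using exp_integer_2pi[of "1"] by (simp add: exp_eq) (intro exI[of _ 1], simp add: algebra_simps)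
    then show ?thesis
      using kappa_boundary[OF t, of "1 - s"] that by (simp add: circlepath reversepath_def)
  qed
  then have "winding_number (\<kappa> t \<circ> circlepath 0 1) (\<kappa> t 0) = winding_number (reversepath ?L) (\<kappa> t 0)"
    by (intro winding_number_cong) auto
  also have "\<dots> = 1"
    using L int by (subst winding_number_reversepath) (auto simp: simple_path_imp_path frontier_def)
  finally show ?thesis .
qed

lemma placed_winding:
  assumes j: "fst j \<in> T" shows "winding_number (placed j \<circ> circlepath 0 1) (placed j 0) = 1"
proof -
  have "winding_number (placed j \<circ> circlepath 0 1) (placed j 0) = winding_number (\<kappa> (fst j) \<circ> circlepath 0 1) (\<kappa> (fst j) 0)"
    by (subst (1 2) winding_number_offset) (simp add: placed_def o_def)
  then show ?thesis using kappa_winding[OF j] by simp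
qed

end

locale tiling = tiled_complex +
  fixes \<Gamma> :: cells and \<alpha> :: tiling
  assumes tiling: "is_tiling T \<Gamma> \<alpha>" and finite_region: "finite \<Gamma>"
    and disks: "T \<subseteq> disk_regions"
begin

lemma in_T: "j \<in> \<alpha> \<Longrightarrow> fst j \<in> T"
  and region: "(\<Union>j\<in>\<alpha>. translate (snd j) (fst j)) = \<Gamma>"
  and disj: "i \<in> \<alpha> \<Longrightarrow> j \<in> \<alpha> \<Longrightarrow> i \<noteq> j \<Longrightarrow> translate (snd i) (fst i) \<inter> translate (snd j) (fst j) = {}"
  using tiling by (auto simp: is_tiling_def disjoint_family_on_def case_prod_unfold)

text \<open>Placed tiles have nonempty and pairwise disjoint, hence distinct, sets of cells, all of
  them subsets of the finite region.\<close>

lemma finite_tiling: "finite \<alpha>"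
proof (rule finite_imageD)
  let ?f = "\<lambda>j. translate (snd j) (fst j)"
  have "?f ` \<alpha> \<subseteq> Pow \<Gamma>" using region by auto
  then show "finite (?f ` \<alpha>)" using finite_region by (metis finite_Pow_iff finite_subset)
  have ne: "?f j \<noteq> {}" if "j \<in> \<alpha>" for j
  proof -
    have "plane (fst j) \<noteq> {}" using kappa_image[OF in_T[OF that]] by force
    then show ?thesis by (auto simp: plane_def translate_def)
  qed
  show "inj_on ?f \<alpha>"
  proof (rule inj_onI, rule ccontr)
    fix i j assume ij: "i \<in> \<alpha>" "j \<in> \<alpha>" "?f i = ?f j" "i \<noteq> j"
    then have "?f i = {}" using disj[OF ij(1,2,4)] by simp
    then show False using ne[OF ij(1)] by contradiction
  qed
qed

lemma plane_region: "plane \<Gamma> = (\<Union>j\<in>\<alpha>. placed j ` cball 0 1)"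
  unfolding region[symmetric] plane_Union using placed_image in_T by auto

lemma placed_disjoint:
  assumes "i \<in> \<alpha>" "j \<in> \<alpha>" "i \<noteq> j" shows "placed i ` ball 0 1 \<inter> placed j ` cball 0 1 = {}"
  unfolding placed_image[OF in_T[OF assms(2)]]
proof (rule open_subset_plane_disjoint)
  show "placed i ` ball 0 1 \<subseteq> plane (translate (snd i) (fst i))"
    unfolding placed_image[OF in_T[OF assms(1)], symmetric] by auto
qed (use assms placed_open in_T disj in auto)

abbreviation A :: "complex \<Rightarrow> cells cpoint" where "A \<equiv> tiling_map r \<kappa> \<alpha>"

lemma face_map_placed:
  "j \<in> \<alpha> \<Longrightarrow> norm z = 1 \<Longrightarrow> face_map r (fst j) z = grid_point (placed j z)"
  using face_map_boundary(1)[OF in_T] by (simp add: placed_def grid_point_translate)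

text \<open>The description in \<open>tiling_map\<close> is unambiguous: a point covered by two
  different tiles lies on the rim of both, and there either face map is the projection
  \<open>grid_point\<close>, which does not depend on the tile.\<close>

lemma A_placed:
  assumes j: "j \<in> \<alpha>" and z: "z \<in> cball 0 1"
  shows "A (placed j z) = face_map r (fst j) z"
  unfolding tiling_map_def
proof (rule the_equality)
  show "\<exists>t v z'. (t, v) \<in> \<alpha> \<and> z' \<in> cball 0 1 \<and> placed j z = lat v + \<kappa> t z' \<and> face_map r (fst j) z = face_map r t z'"
    using j z by (intro exI[of _ "fst j"] exI[of _ "snd j"] exI[of _ z]) (simp add: placed_def)
  fix c assume "\<exists>t v z'. (t, v) \<in> \<alpha> \<and> z' \<in> cball 0 1 \<and> placed j z = lat v + \<kappa> t z' \<and> c = face_map r t z'"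
  then obtain i z' where i: "i \<in> \<alpha>" "z' \<in> cball 0 1" "placed j z = placed i z'" "c = face_map r (fst i) z'"
    by (auto simp: placed_def)
  show "c = face_map r (fst j) z"
  proof (cases "i = j")
    case True
    then show ?thesis using i z placed_inj[OF in_T[OF j]] by (metis inj_onD)
  next
    case False
    have "z \<notin> ball 0 1" using placed_disjoint[OF j i(1)] False i by blast
    moreover have "z' \<notin> ball 0 1" using placed_disjoint[OF i(1) j] False i(3) z by (metis IntI empty_iff image_eqI)
    ultimately have "norm z = 1" "norm z' = 1" using z i(2) by auto
    then show ?thesis using face_map_placed j i by metis
  qed
qed

text \<open>The union of the tile boundaries, over which the region is a family of 2-cells, one for
  each placed tile.\<close>

definition K :: "complex set" where
  "K = (\<Union>j\<in>\<alpha>. placed j ` sphere 0 1)"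

lemma A_K:
  assumes "x \<in> K" shows "A x = grid_point x" "A x \<in> skeleton1"
proof -
  from assms obtain j z where jz: "j \<in> \<alpha>" "norm z = 1" "x = placed j z" by (auto simp: K_def)
  then have e: "A x = face_map r (fst j) z" using A_placed[of j z] by simp
  then show "A x = grid_point x" using jz face_map_placed by simp
  show "A x \<in> skeleton1" unfolding e using jz(2) by (rule face_map_sphere)
qed

lemma compact_placed: "j \<in> \<alpha> \<Longrightarrow> compact S \<Longrightarrow> S \<subseteq> cball 0 1 \<Longrightarrow> compact (placed j ` S)"
  using placed_cont in_T by (metis compact_continuous_image continuous_on_subset)

text \<open>The preimage of a closed set is a finite union of images of compact sets, one for each
  tile.\<close>

lemma continuous_map_A: "continuous_map (top_of_set (plane \<Gamma>)) X A"
  unfolding continuous_map_closedin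
proof (intro conjI allI impI)
  show "A \<in> topspace (top_of_set (plane \<Gamma>)) \<rightarrow> topspace X"
    using A_placed in_T face_map_points[of _ T] by (auto simp: plane_region topspace_presentation_complex)
  fix C assume C: "closedin X C"
  have "closed (placed j ` {z \<in> cball 0 1. face_map r (fst j) z \<in> C})" if j: "j \<in> \<alpha>" for j
  proof -
    have "closedin (top_of_set (cball 0 1)) {z \<in> cball 0 1. face_map r (fst j) z \<in> C}"
      using continuous_map_face_map[OF in_T[OF j]] C by (auto simp: continuous_map_closedin)
    then have "compact {z \<in> cball 0 1. face_map r (fst j) z \<in> C}"
      using compact_cball closedin_compact by blast
    then show ?thesis using j by (intro compact_imp_closed compact_placed) auto
  qed
  then have "closed (\<Union>j\<in>\<alpha>. placed j ` {z \<in> cball 0 1. face_map r (fst j) z \<in> C})"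
    using finite_tiling by (intro closed_UN) auto
  moreover have "{x \<in> topspace (top_of_set (plane \<Gamma>)). A x \<in> C} = (\<Union>j\<in>\<alpha>. placed j ` {z \<in> cball 0 1. face_map r (fst j) z \<in> C})"
  proof (rule Set.set_eqI)
    fix x
    show "x \<in> {x \<in> topspace (top_of_set (plane \<Gamma>)). A x \<in> C} \<longleftrightarrow>
        x \<in> (\<Union>j\<in>\<alpha>. placed j ` {z \<in> cball 0 1. face_map r (fst j) z \<in> C})"
    proof
      assume "x \<in> {x \<in> topspace (top_of_set (plane \<Gamma>)). A x \<in> C}"
      then obtain j z where "j \<in> \<alpha>" "z \<in> cball 0 1" "x = placed j z" "A x \<in> C" by (auto simp: plane_region)
      then show "x \<in> (\<Union>j\<in>\<alpha>. placed j ` {z \<in> cball 0 1. face_map r (fst j) z \<in> C})"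
        using A_placed[of j z] by (intro UN_I[of j] image_eqI[of _ _ z]) auto
    next
      assume "x \<in> (\<Union>j\<in>\<alpha>. placed j ` {z \<in> cball 0 1. face_map r (fst j) z \<in> C})"
      then obtain j z where "j \<in> \<alpha>" "z \<in> cball 0 1" "x = placed j z" "face_map r (fst j) z \<in> C" by blast
      then show "x \<in> {x \<in> topspace (top_of_set (plane \<Gamma>)). A x \<in> C}"
        using A_placed[of j z] unfolding plane_region topspace_euclidean_subtopology by (intro CollectI conjI UN_I[of j]) auto
    qed
  qed
  ultimately show "closedin (top_of_set (plane \<Gamma>)) {x \<in> topspace (top_of_set (plane \<Gamma>)). A x \<in> C}"
    by (metis (no_types, lifting) closed_subset mem_Collect_eq subsetI topspace_euclidean_subtopology)
qed

lemma tile_cells: "cell_family norm (top_of_set (plane \<Gamma>)) K \<alpha> placed"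
proof unfold_locales
  have "closed K" unfolding K_def
    using finite_tiling compact_placed[of _ "sphere 0 1"] by (intro closed_UN) (auto intro: compact_imp_closed)
  moreover have sub: "K \<subseteq> plane \<Gamma>" by (auto simp: K_def plane_region)
  ultimately show "closedin (top_of_set (plane \<Gamma>)) K" by (simp add: closed_subset)
  show "topspace (top_of_set (plane \<Gamma>)) = K \<union> (\<Union>j\<in>\<alpha>. placed j ` ball.cell)"
    using sub by (auto simp: plane_region ball_cell)
  show "ball.attaches (top_of_set (plane \<Gamma>)) K (placed j)" if j: "j \<in> \<alpha>" for j
    unfolding ball.attaches_def ball_interior unfolding ball_cell ball_rim
  proof (intro conjI)
    show "continuous_map (top_of_set (cball 0 1)) (top_of_set (plane \<Gamma>)) (placed j)"
      using placed_cont[OF in_T[OF j]] j by (auto simp: plane_region)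
    show "placed j ` sphere 0 1 \<subseteq> K" using j by (auto simp: K_def)
    show "inj_on (placed j) (ball 0 1)" using placed_inj[OF in_T[OF j]] by (rule inj_on_subset) auto
    have disj_i: "placed j ` ball 0 1 \<inter> placed i ` sphere 0 1 = {}" if i: "i \<in> \<alpha>" for i
    proof (cases "i = j")
      case True
      then show ?thesis using placed_inj[OF in_T[OF j]]
        by (metis Int_empty_right ball_subset_cball empty_subsetI image_empty inf.commute inj_on_image_Int sphere_cball disjoint_iff mem_ball mem_sphere order_less_irrefl)
    next
      case False
      then show ?thesis using placed_disjoint[OF j i] sphere_cball[of 0 1] by blast
    qed
    show "placed j ` ball 0 1 \<inter> K = {}" unfolding K_def using disj_i by blast
  qed
  show "placed i ` (ball.cell - ball.rim) \<inter> placed j ` (ball.cell - ball.rim) = {}"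
    if "i \<in> \<alpha>" "j \<in> \<alpha>" "i \<noteq> j" for i j
    unfolding ball_interior using placed_disjoint[OF that] ball_subset_cball[of "0::complex" 1] by blast
qed (simp_all add: Hausdorff_space_subtopology finite_tiling)

lemma count_vector_eq: "count_vector T \<alpha> = (\<Sum>j\<in>\<alpha>. frag_of (fst j))"
proof -
  have "(\<Sum>j\<in>\<alpha>. frag_of (fst j)) = (\<Sum>t\<in>T. \<Sum>j\<in>{j \<in> \<alpha>. fst j = t}. frag_of (fst j))"
    using finite_tiling finite_T in_T by (intro sum.group[symmetric]) auto
  also have "\<dots> = (\<Sum>t\<in>T. frag_cmul (int (tile_count \<alpha> t)) (frag_of t))"
  proof (rule sum.cong[OF refl])
    fix t
    have "{j \<in> \<alpha>. fst j = t} = Pair t ` {v. (t, v) \<in> \<alpha>}" by force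
    then have "card {j \<in> \<alpha>. fst j = t} = tile_count \<alpha> t"
      by (simp add: tile_count_def card_image inj_on_def)
    moreover have "sum f S = frag_cmul (int (card S)) (frag_of t)"
      if "finite S" "\<And>j. j \<in> S \<Longrightarrow> f j = frag_of t" for S and f :: "cells \<times> int \<times> int \<Rightarrow> cells \<Rightarrow>\<^sub>0 int"
      using that by (induction S rule: finite_induct) (simp_all add: frag_cmul_distrib algebra_simps)
    from this[of "{j \<in> \<alpha>. fst j = t}" "\<lambda>j. frag_of (fst j)"] calculation
     show "(\<Sum>j\<in>{j \<in> \<alpha>. fst j = t}. frag_of (fst j)) = frag_cmul (int (tile_count \<alpha> t)) (frag_of t)"
      using finite_tiling by simp
  qed
  finally show ?thesis by (simp add: count_vector_def)
qed

lemma keys_count_vector: "Poly_Mapping.keys (count_vector T \<alpha>) \<subseteq> T"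
proof -
  have "count_vector T \<alpha> \<in> carrier (free_Abelian_group T)"
    unfolding count_vector_eq by (rule sum_closed_free_Abelian_group) (simp add: in_T)
  then show ?thesis by simp
qed

lemma placed_center_interior:
  fixes \<phi> :: "complex \<Rightarrow> complex"
  assumes h: "homeomorphism (cball 0 1) (plane \<Gamma>) \<phi> \<phi>'" and j: "j \<in> \<alpha>"
  shows "placed j ` ball 0 1 \<subseteq> \<phi> ` ball 0 1"
proof -
  have "placed j ` ball 0 1 \<subseteq> plane \<Gamma>" using j ball_subset_cball[of 0 1] by (auto simp: plane_region)
  then have "placed j ` ball 0 1 \<subseteq> interior (plane \<Gamma>)"
    using placed_open[OF in_T[OF j]] by (rule interior_maximal)
  then show ?thesis unfolding homeomorphism_cball_interior(2)[OF h] .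
qed

text \<open>Open tiles lie in the interior of the region, so a frontier point can only sit on a
  rim.\<close>

lemma region_boundary_K:
  fixes \<phi> :: "complex \<Rightarrow> complex"
  assumes h: "homeomorphism (cball 0 1) (plane \<Gamma>) \<phi> \<phi>'"
  shows "\<phi> ` sphere 0 1 \<subseteq> K"
proof
  fix x assume x: "x \<in> \<phi> ` sphere 0 1"
  then have "x \<in> frontier (plane \<Gamma>)" unfolding homeomorphism_cball_frontier[OF h] .
  then have "x \<notin> interior (plane \<Gamma>)" by (simp add: frontier_def)
  moreover have "x \<in> plane \<Gamma>" using x sphere_cball[of 0 1] homeomorphism_image1[OF h] by blast
  ultimately obtain j z where jz: "j \<in> \<alpha>" "z \<in> cball 0 1" "x = placed j z" by (auto simp: plane_region)
  have "z \<notin> ball 0 1"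
    using placed_center_interior[OF h jz(1)] homeomorphism_cball_interior(2)[OF h] jz(3) \<open>x \<notin> interior (plane \<Gamma>)\<close> by blast
  then have "z \<in> sphere 0 1" using jz(2) by auto
  then show "x \<in> K" unfolding K_def jz(3) using jz(1) by blast
qed

text \<open>In the homology of the region relative to the tile boundaries, the region is the sum of its
  tiles: both sides have local degree 1 at the centre of every tile.\<close>

theorem tiling_class:
  assumes \<phi>: "region_chart \<Gamma> b \<phi>"
    and iso: "\<Psi> \<in> iso (free_Abelian_group T) H2" and frag: "\<And>t. t \<in> T \<Longrightarrow> \<Psi> (frag_of t) = face_class t"
  shows "hom_induced 2 (top_of_set (cball 0 1)) (sphere 0 1) X skeleton1 (A \<circ> \<phi>) disk_class = \<Psi> (count_vector T \<alpha>)"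
proof -
  let ?D = "top_of_set (cball (0::complex) 1)" and ?S = "sphere (0::complex) 1" and ?P = "top_of_set (plane \<Gamma>)"
  obtain \<phi>' where h: "homeomorphism (cball 0 1) (plane \<Gamma>) \<phi> \<phi>'" using \<phi> by (auto simp: region_chart_def)
  have wind: "winding_number (\<phi> \<circ> circlepath 0 1) (\<phi> 0) = 1" using \<phi> by (simp add: region_chart_def)
  have \<phi>_cont: "continuous_on (cball 0 1) \<phi>" and \<phi>_inj: "inj_on \<phi> (cball 0 1)" and \<phi>_img: "\<phi> ` cball 0 1 = plane \<Gamma>"
    using h by (auto simp: homeomorphism_def intro: inj_on_inverseI)
  interpret cell_family norm ?P K \<alpha> placed by (rule tile_cells)
  have \<phi>K: "\<phi> \<in> ?S \<rightarrow> K" using region_boundary_K[OF h] by auto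
  have \<phi>P: "continuous_map ?D ?P \<phi>" using \<phi>_cont \<phi>_img by auto
  let ?w = "hom_induced 2 ?D ?S ?P K \<phi> disk_class"
  obtain \<Phi> where \<Phi>: "\<Phi> \<in> iso (free_Abelian_group \<alpha>) (relative_homology_group 2 ?P K)"
    and \<Phi>_frag: "\<And>j. j \<in> \<alpha> \<Longrightarrow> \<Phi> (frag_of j) = hom_induced 2 ?D ?S ?P K (placed j) disk_class"
    and inj: "\<And>j. j \<in> \<alpha> \<Longrightarrow> inj (\<lambda>n::int. hom_induced 2 ?D ?S ?P (off j) (placed j) disk_class
          [^]\<^bsub>relative_homology_group 2 ?P (off j)\<^esub> n)"
    and lookup: "\<And>j x. j \<in> \<alpha> \<Longrightarrow> Poly_Mapping.keys x \<subseteq> \<alpha> \<Longrightarrow>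
          hom_induced 2 ?P K ?P (off j) id (\<Phi> x)
          = hom_induced 2 ?D ?S ?P (off j) (placed j) disk_class
            [^]\<^bsub>relative_homology_group 2 ?P (off j)\<^esub> (poly_mapping.lookup x j)"
  proof (rule cell_basis[OF tile_cells])
    fix \<Psi> assume 1: "\<Psi> \<in> iso (free_Abelian_group \<alpha>) (relative_homology_group 2 ?P K)"
      and 2: "\<And>j. j \<in> \<alpha> \<Longrightarrow> \<Psi> (frag_of j) = hom_induced 2 ?D ?S ?P K (placed j) disk_class"
      and 3: "\<And>j. j \<in> \<alpha> \<Longrightarrow> inj (\<lambda>n::int. hom_induced 2 ?D ?S ?P (topspace ?P - placed j ` ball 0 1) (placed j) disk_class
          [^]\<^bsub>relative_homology_group 2 ?P (topspace ?P - placed j ` ball 0 1)\<^esub> n)"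
      and 4: "\<And>j x. j \<in> \<alpha> \<Longrightarrow> Poly_Mapping.keys x \<subseteq> \<alpha> \<Longrightarrow>
          hom_induced 2 ?P K ?P (topspace ?P - placed j ` ball 0 1) id (\<Psi> x)
          = hom_induced 2 ?D ?S ?P (topspace ?P - placed j ` ball 0 1) (placed j) disk_class
            [^]\<^bsub>relative_homology_group 2 ?P (topspace ?P - placed j ` ball 0 1)\<^esub> (poly_mapping.lookup x j)"
    show thesis by (rule that[OF 1 2 3[folded ball_interior] 4[folded ball_interior]])
  qed
  have "?w \<in> carrier (relative_homology_group 2 ?P K)" by (rule hom_induced_carrier)
  then have "?w \<in> \<Phi> ` carrier (free_Abelian_group \<alpha>)" using \<Phi> by (simp add: iso_def bij_betw_def)
  then obtain x where x: "Poly_Mapping.keys x \<subseteq> \<alpha>" "\<Phi> x = ?w" by auto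
  \<comment> \<open>The coefficient is tested in the local homology of the plane at the centre of
    the tile. Region and tile both become the class of the unit disk around that point, because both
    boundary curves wind once around it.\<close>
  have one: "poly_mapping.lookup x j = 1" if j: "j \<in> \<alpha>" for j
  proof -
    let ?x = "placed j 0" let ?L = "relative_homology_group 2 ?P (off j)"
    let ?e = "hom_induced 2 ?D ?S ?P (off j) (placed j)"
    let ?i = "hom_induced 2 ?P (off j) euclidean (- {?x}) id"
    interpret L: group ?L by simp
    have "placed j z \<noteq> ?x" if "norm z = 1" for z
      using inj_onD[OF placed_inj[OF in_T[OF j]], of z 0] that by auto
    then have pj: "continuous_on (cball 0 1) (placed j)" "placed j \<in> ?S \<rightarrow> - {?x}"
      using placed_cont[OF in_T[OF j]] by auto
    have "?x \<in> placed j ` (ball.cell - ball.rim)" unfolding ball_interior by simp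
    then have i: "id \<in> off j \<rightarrow> - {?x}" by auto
    have "placed j z \<in> off j" if "z \<in> ?S" for z
      using chi_rim[OF j, unfolded ball_rim, OF that] A_off[OF j] by (rule subsetD[rotated])
    then have pj': "continuous_map ?D ?P (placed j)" "placed j \<in> ?S \<rightarrow> off j"
      using cont_chi[OF j] by (simp_all add: ball_cell)
    have ie: "?i (?e c) = disk_map (\<lambda>z. ?x + z) ?x c" for c
    proof -
      have "?i (?e c) = disk_map (id \<circ> placed j) ?x c"
        by (rule hom_induced_compose'[OF pj' _ i]) (simp add: continuous_map_from_subtopology)
      also have "\<dots> = disk_map (\<lambda>z. ?x + z) ?x c"
        using disk_map_winding_number_1[OF pj placed_winding[OF in_T[OF j]]] by simp
      finally show ?thesis .
    qed
    have "bij_betw ?e (carrier disk_group) (carrier ?L)"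
      using iso_cell[OF j, of 2] by (simp add: iso_def ball_cell ball_rim)
    moreover have "inj_on (?i \<circ> ?e) (carrier disk_group)"
      unfolding o_def ie by (rule inj_disk_map_translation)
    \<comment> \<open>The tile map is onto the group relative to \<open>off j\<close> and its
      composite to the plane is injective, so nothing is lost in passing to the plane.\<close>
    ultimately have inj_i: "inj_on ?i (carrier ?L)"
      by (metis bij_betw_def inj_on_imageI)
    have x_in: "?x \<in> \<phi> ` ball 0 1" using placed_center_interior[OF h j] by auto
    have "\<phi> ` ball 0 1 \<inter> path_image (\<phi> \<circ> circlepath 0 1) = {}"
      using \<phi>_inj by (auto simp: path_image_compose inj_on_def dist_norm)
        (metis ball_subset_cball mem_ball_0 mem_cball_0 order_less_irrefl order_refl less_imp_le)
    moreover have "path (\<phi> \<circ> circlepath 0 1)"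
      by (intro path_continuous_image) (auto intro: continuous_on_subset[OF \<phi>_cont])
    moreover have "connected (\<phi> ` ball 0 1)"
      by (intro connected_continuous_image) (auto intro: continuous_on_subset[OF \<phi>_cont])
    \<comment> \<open>A region chart is normalised at \<open>\<phi> 0\<close> only; the image of the
      open disk is connected and misses the curve, so the winding number is the same at the centre
      of the tile.\<close>
    ultimately have "winding_number (\<phi> \<circ> circlepath 0 1) constant_on \<phi> ` ball 0 1"
      by (intro winding_number_constant) (auto simp: pathfinish_compose pathstart_compose)
    then have wx: "winding_number (\<phi> \<circ> circlepath 0 1) ?x = 1"
      using x_in wind unfolding constant_on_def by (metis centre_in_ball image_eqI zero_less_one)
    have "\<phi> \<in> ?S \<rightarrow> - {?x}"
      using \<phi>_inj x_in by (force simp: inj_on_def)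
    then have "?i (hom_induced 2 ?P K ?P (off j) id ?w) = ?i (?e disk_class)"
    proof -
      have "hom_induced 2 ?P K ?P (off j) id ?w = hom_induced 2 ?D ?S ?P (off j) \<phi> disk_class"
        using A_off[OF j] by (subst hom_induced_compose'[OF \<phi>P \<phi>K]) auto
      also have "?i \<dots> = disk_map (id \<circ> \<phi>) ?x disk_class"
        using \<phi>K A_off[OF j] by (intro hom_induced_compose'[OF \<phi>P _ _ i]) (auto simp: continuous_map_from_subtopology)
      also have "\<dots> = disk_map (\<lambda>z. ?x + z) ?x disk_class"
        using disk_map_winding_number_1[OF \<phi>_cont \<open>\<phi> \<in> ?S \<rightarrow> - {?x}\<close> wx] by simp
      finally show ?thesis by (simp only: ie)
    qed
    then have "hom_induced 2 ?P K ?P (off j) id ?w = ?e disk_class"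
      by (rule inj_onD[OF inj_i]) (rule hom_induced_carrier)+
    then have "?e disk_class [^]\<^bsub>?L\<^esub> (poly_mapping.lookup x j) = ?e disk_class [^]\<^bsub>?L\<^esub> (1 :: int)"
      using lookup[OF j x(1)] unfolding x(2) by (simp only: L.int_pow_1 hom_induced_carrier)
    then show ?thesis using inj[OF j] by (rule injD[rotated])
  qed
  let ?A = "hom_induced 2 ?P K X skeleton1 A"
  have AK: "A \<in> K \<rightarrow> skeleton1" using A_K(2) by blast
  \<comment> \<open>On chains the tiling map forgets the position of a tile and keeps its
    type.\<close>
  have "?A (\<Phi> y) = \<Psi> (frag_extend (\<lambda>j. frag_of (fst j)) y)" if "Poly_Mapping.keys y \<subseteq> \<alpha>" for y
    using that
  proof (rule free_Abelian_group_induct)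
    interpret h1: group_hom "free_Abelian_group \<alpha>" H2 "?A \<circ> \<Phi>"
      using \<Phi> by (auto simp: group_hom_def group_hom_axioms_def iso_def intro!: hom_compose[OF _ hom_induced_hom])
    interpret h2: group_hom "free_Abelian_group T" H2 \<Psi>
      using iso by (auto simp: group_hom_def group_hom_axioms_def iso_def)
    show "?A (\<Phi> 0) = \<Psi> (frag_extend (\<lambda>j. frag_of (fst j)) 0)"
      using h1.hom_one h2.hom_one by simp
    fix x y assume xy: "Poly_Mapping.keys x \<subseteq> \<alpha>" "Poly_Mapping.keys y \<subseteq> \<alpha>"
      "?A (\<Phi> x) = \<Psi> (frag_extend (\<lambda>j. frag_of (fst j)) x)" "?A (\<Phi> y) = \<Psi> (frag_extend (\<lambda>j. frag_of (fst j)) y)"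
    have sub: "Poly_Mapping.keys (frag_extend (\<lambda>j. frag_of (fst j)) z) \<subseteq> T" if zk: "Poly_Mapping.keys z \<subseteq> \<alpha>" for z :: "cells \<times> int \<times> int \<Rightarrow>\<^sub>0 int"
    proof -
      have "Poly_Mapping.keys (frag_extend (\<lambda>j. frag_of (fst j)) z) \<subseteq> (\<Union>j\<in>Poly_Mapping.keys z. Poly_Mapping.keys (frag_of (fst j)))"
        by (rule keys_frag_extend)
      also have "\<dots> \<subseteq> T"
      proof
        fix t assume "t \<in> (\<Union>j\<in>Poly_Mapping.keys z. Poly_Mapping.keys (frag_of (fst j)))"
        then obtain j where "j \<in> \<alpha>" "t = fst j" using zk by auto
        then show "t \<in> T" using in_T by simp
      qed
      finally show ?thesis .
    qed
    have "?A (\<Phi> (x - y)) = ?A (\<Phi> x) \<otimes>\<^bsub>H2\<^esub> inv\<^bsub>H2\<^esub> ?A (\<Phi> y)"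
      using h1.hom_mult[of x "- y"] h1.hom_inv[of y] xy(1,2) by simp
    also have "\<dots> = \<Psi> (frag_extend (\<lambda>j. frag_of (fst j)) x - frag_extend (\<lambda>j. frag_of (fst j)) y)"
      unfolding xy(3,4)
      using h2.hom_mult[of "frag_extend (\<lambda>j. frag_of (fst j)) x" "- frag_extend (\<lambda>j. frag_of (fst j)) y"]
        h2.hom_inv[of "frag_extend (\<lambda>j. frag_of (fst j)) y"] sub[OF xy(1)] sub[OF xy(2)] by simp
    finally show "?A (\<Phi> (x - y)) = \<Psi> (frag_extend (\<lambda>j. frag_of (fst j)) (x - y))"
      by (simp only: frag_extend_diff)
  next
    fix j assume j: "j \<in> \<alpha>"
    have pj: "continuous_map ?D ?P (placed j)" "placed j \<in> ?S \<rightarrow> K"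
      using cont_chi[OF j] chi_rim[OF j] by (auto simp: ball_cell ball_rim)
    have "?A (\<Phi> (frag_of j)) = hom_induced 2 ?D ?S X skeleton1 (A \<circ> placed j) disk_class"
      unfolding \<Phi>_frag[OF j] by (rule hom_induced_compose'[OF pj continuous_map_A AK])
    also have "\<dots> = face_class (fst j)"
      unfolding face_class_def using A_placed[OF j] by (intro fun_cong[OF hom_induced_eq]) auto
    finally show "?A (\<Phi> (frag_of j)) = \<Psi> (frag_extend (\<lambda>j. frag_of (fst j)) (frag_of j))"
      using frag[OF in_T[OF j]] by simp
  qed
  moreover have "x = (\<Sum>j\<in>\<alpha>. frag_of j)"
  proof (rule poly_mapping_eqI)
    fix i
    have "poly_mapping.lookup (\<Sum>j\<in>\<alpha>. frag_of j) i = (\<Sum>j\<in>\<alpha>. if j = i then 1 else 0)"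
      unfolding lookup_sum by (intro sum.cong) (auto simp: lookup_frag_of)
    also have "\<dots> = (if i \<in> \<alpha> then 1 else 0)" using finite_tiling by simp
    also have "\<dots> = poly_mapping.lookup x i" using one x(1) by (auto simp: in_keys_iff)
    finally show "poly_mapping.lookup x i = poly_mapping.lookup (\<Sum>j\<in>\<alpha>. frag_of j) i" by simp
  qed
  moreover have "frag_extend (\<lambda>j. frag_of (fst j)) (\<Sum>j\<in>\<alpha>. frag_of j) = count_vector T \<alpha>"
    unfolding count_vector_eq frag_extend_sum[OF finite_tiling] by (simp add: o_def)
  ultimately have "?A ?w = \<Psi> (count_vector T \<alpha>)" using x by metis
  moreover have "?A ?w = hom_induced 2 ?D ?S X skeleton1 (A \<circ> \<phi>) disk_class"
    by (rule hom_induced_compose'[OF \<phi>P \<phi>K continuous_map_A AK])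
  ultimately show ?thesis by simp
qed

end

section \<open>Charts\<close>

text \<open>The Alexander trick: a homeomorphism of the circle is extended to the disk along
  radii.\<close>

lemma radial_extension:
  fixes g :: "complex \<Rightarrow> complex"
  assumes g: "continuous_on (sphere 0 1) g" "inj_on g (sphere 0 1)" "g ` sphere 0 1 = sphere 0 1"
  defines "R \<equiv> \<lambda>z. of_real (norm z) * g (sgn z)"
  shows "continuous_on S R" "inj_on R (cball 0 1)" "R ` cball 0 1 = cball 0 1"
    and "norm z = 1 \<Longrightarrow> R z = g z"
proof -
  have sgn: "sgn z \<in> sphere 0 1" if "z \<noteq> 0" for z :: complex using that by (simp add: norm_sgn)
  have gn: "norm (g u) = 1" if "u \<in> sphere 0 1" for u using g(3) that by auto
  have nR: "norm (R z) = norm z" for z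
    using gn[OF sgn[of z]] by (cases "z = 0") (simp_all add: R_def norm_mult)
  have "isCont R z" for z
  proof (cases "z = 0")
    case True
    \<comment> \<open>\<open>sgn\<close> jumps at the origin; there
      \<open>norm (R z) = norm z\<close> gives continuity instead.\<close>
    have "R \<midarrow>0\<rightarrow> 0"
      by (rule Lim_null_comparison[where g = norm]) (auto simp: nR intro: tendsto_norm_zero)
    then show ?thesis by (simp add: isCont_def True R_def)
  next
    case False
    have "continuous_on (- {0}) (\<lambda>z. g (sgn z))"
    proof (rule continuous_on_compose2[OF g(1)])
      show "continuous_on (- {0}) (sgn :: complex \<Rightarrow> complex)"
        by (intro continuous_on_sgn continuous_on_id) auto
      show "sgn ` (- {0}) \<subseteq> sphere (0::complex) 1" using sgn by blast
    qed
    then have "continuous_on (- {0}) R" unfolding R_def by (intro continuous_intros)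
    then show ?thesis using False by (simp add: continuous_on_eq_continuous_at open_delete Compl_eq_Diff_UNIV)
  qed
  then show "continuous_on S R" by (simp add: continuous_at_imp_continuous_on)
  show "inj_on R (cball 0 1)"
  proof (rule inj_onI)
    fix z w assume "R z = R w"
    then have n: "norm z = norm w" using nR by metis
    show "z = w"
    proof (cases "z = 0")
      case True
      then show ?thesis using n by simp
    next
      case False
      then have "w \<noteq> 0" using n by auto
      have "g (sgn z) = g (sgn w)" using \<open>R z = R w\<close> n False \<open>w \<noteq> 0\<close> by (simp add: R_def)
      then have "sgn z = sgn w" using g(2) sgn[OF False] sgn[OF \<open>w \<noteq> 0\<close>] by (metis inj_onD)
      then show ?thesis using n False \<open>w \<noteq> 0\<close> by (simp add: sgn_div_norm)
    qed
  qed
  show "R ` cball 0 1 = cball 0 1"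
  proof
    show "R ` cball 0 1 \<subseteq> cball 0 1" using nR by auto
    show "cball 0 1 \<subseteq> R ` cball 0 1"
    proof
      fix w :: complex assume w: "w \<in> cball 0 1"
      show "w \<in> R ` cball 0 1"
      proof (cases "w = 0")
        case True
        then show ?thesis by (auto simp: R_def intro!: image_eqI[of _ _ 0])
      next
        case False
        then obtain u where u: "u \<in> sphere 0 1" "g u = sgn w" using sgn[OF False] g(3) by (metis imageE)
        then have "norm (of_real (norm w) * u) = norm w" by (simp add: norm_mult)
        moreover have "sgn (of_real (norm w) * u) = u" using False u by (simp add: sgn_div_norm norm_mult scaleR_conv_of_real)
        ultimately have "R (of_real (norm w) * u) = of_real (norm w) * sgn w" using u by (simp add: R_def)
        also have "\<dots> = w" using False by (simp add: sgn_div_norm scaleR_conv_of_real)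
        finally have "R (of_real (norm w) * u) = w" .
        moreover have "of_real (norm w) * u \<in> cball 0 1" using w u by (simp add: norm_mult)
        ultimately show ?thesis by (metis image_eqI)
      qed
    qed
  qed
  show "norm z = 1 \<Longrightarrow> R z = g z" by (simp add: R_def sgn_div_norm)
qed

lemma Arg2pi_clockwise:
  assumes "0 \<le> s" "s < 1"
  shows "Arg2pi (cnj (exp (- (2 * of_real pi * of_real s * \<i>)))) / (2 * pi) = s"
proof -
  have "Arg2pi (cnj (exp (- (2 * of_real pi * of_real s * \<i>)))) = 2 * pi * s"
    by (rule Arg2pi_unique[of 1]) (use assms in \<open>simp_all add: exp_cnj mult.commute mult.left_commute\<close>)
  then show ?thesis by simp
qed

text \<open>An arbitrary homeomorphism of the disk with the tile is corrected on the circle so as to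
  follow the prescribed boundary path, and the correction is extended radially. It is injective
  because the boundary path is simple.\<close>

lemma tile_chart_exists:
  assumes t: "t \<in> disk_regions" and w: "boundary_word t p w"
  shows "\<exists>\<kappa>. tile_chart t p w \<kappa>"
proof -
  let ?L = "lattice_path p w"
  obtain f g where "homeomorphism (plane t) (cball (0::complex) 1) g f"
    using t unfolding disk_regions_def homeomorphic_def by blast
  then have h: "homeomorphism (cball 0 1) (plane t) f g" by (rule homeomorphism_symD)
  have L: "simple_path ?L" "pathfinish ?L = pathstart ?L" "path_image ?L = f ` sphere 0 1"
    using w homeomorphism_cball_frontier[OF h] by (auto simp: boundary_word_def)
  have fg: "f (g y) = y" if "y \<in> plane t" for y using h that by (auto simp: homeomorphism_def)
  have gf: "g (f z) = z" if "z \<in> cball 0 1" for z using h that by (auto simp: homeomorphism_def)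
  have sphere_plane: "f ` sphere 0 1 \<subseteq> plane t"
    using homeomorphism_image1[OF h] sphere_cball[of 0 1] by blast
  define a where "a z = Arg2pi (cnj z) / (2 * pi)" for z
  have a: "0 \<le> a z" "a z < 1" for z
    using Arg2pi_ge_0[of "cnj z"] Arg2pi_lt_2pi[of "cnj z"] by (auto simp: a_def)
  have a_exp: "exp (- (2 * of_real pi * of_real (a z) * \<i>)) = z" if "norm z = 1" for z
  proof -
    have "exp (\<i> * of_real (Arg2pi (cnj z))) = cnj z"
      using that complex_norm_eq_1_exp[of "cnj z"] by simp
    then have "cnj (exp (\<i> * of_real (Arg2pi (cnj z)))) = z" by simp
    then show ?thesis by (simp add: exp_cnj a_def mult.commute)
  qed
  define \<gamma> where "\<gamma> z = g (?L (a z))" for z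
  have La: "?L (a z) \<in> f ` sphere 0 1" for z
    using a[of z] L(3) by (auto simp: path_image_def)
  have "continuous_on (sphere 0 1) (?L \<circ> (\<lambda>z. Arg2pi z / (2 * pi)))"
  proof -
    \<comment> \<open>The trivial homotopy of the closed path, turned into one of circle maps,
      yields continuity across the jump of \<open>Arg2pi\<close>.\<close>
    have "homotopic_loops UNIV ?L ?L" using L by (simp add: homotopic_loops_refl simple_path_imp_path)
    from homotopic_loops_imp_homotopic_circlemaps[OF this] show ?thesis by simp
  qed
  then have "continuous_on (sphere 0 1) (\<lambda>z. (?L \<circ> (\<lambda>z. Arg2pi z / (2 * pi))) (cnj z))"
    by (rule continuous_on_compose2) (auto intro: continuous_on_cnj continuous_on_id)
  then have cL: "continuous_on (sphere 0 1) (\<lambda>z. ?L (a z))" by (simp add: o_def a_def)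
  have "continuous_on (plane t) g" using h by (simp add: homeomorphism_def)
  then have \<gamma>1: "continuous_on (sphere 0 1) \<gamma>"
    unfolding \<gamma>_def using La sphere_plane by (intro continuous_on_compose2[OF _ cL]) auto
  have \<gamma>2: "inj_on \<gamma> (sphere 0 1)"
  proof (rule inj_onI)
    fix z z' :: complex assume z: "z \<in> sphere 0 1" "z' \<in> sphere 0 1" "\<gamma> z = \<gamma> z'"
    then have "?L (a z) = ?L (a z')" unfolding \<gamma>_def using fg La sphere_plane by (metis subsetD)
    moreover have "a z \<in> {0..1}" "a z' \<in> {0..1}" using a[of z] a[of z'] by auto
    moreover have "loop_free ?L" using L(1) by (simp add: simple_path_def)
    ultimately have "a z = a z' \<or> a z = 0 \<and> a z' = 1 \<or> a z = 1 \<and> a z' = 0"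
      unfolding loop_free_def by metis
    moreover have "a z \<noteq> 1" "a z' \<noteq> 1" using a(2)[of z] a(2)[of z'] by auto
    ultimately have "a z = a z'" by metis
    moreover have "norm z = 1" "norm z' = 1" using z(1,2) by auto
    ultimately show "z = z'" using a_exp by metis
  qed
  have \<gamma>3: "\<gamma> ` sphere 0 1 = sphere 0 1"
  proof
    show "\<gamma> ` sphere 0 1 \<subseteq> sphere 0 1"
    proof
      fix y assume "y \<in> \<gamma> ` sphere 0 1"
      then obtain z where "y = g (?L (a z))" by (auto simp: \<gamma>_def)
      moreover obtain u where "u \<in> sphere 0 1" "?L (a z) = f u" using La by blast
      ultimately show "y \<in> sphere 0 1" using gf[of u] by auto
    qed
    show "sphere 0 1 \<subseteq> \<gamma> ` sphere 0 1"
    proof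
      fix y :: complex assume y: "y \<in> sphere 0 1"
      then have "f y \<in> path_image ?L" using L(3) by auto
      then obtain s where s: "0 \<le> s" "s \<le> 1" "f y = ?L s" by (auto simp: path_image_def)
      \<comment> \<open>\<open>a\<close> takes values below 1, so the end of the loop is replaced by
        its start.\<close>
      define s' where "s' = (if s < 1 then s else 0)"
      have s': "0 \<le> s'" "s' < 1" "f y = ?L s'"
        using s L(2) by (auto simp: s'_def pathfinish_def pathstart_def)
      let ?z = "exp (- (2 * of_real pi * of_real s' * \<i>))"
      have "a ?z = s'" unfolding a_def by (rule Arg2pi_clockwise[OF s'(1,2)])
      then have "\<gamma> ?z = y" using s'(3) gf[of y] y by (simp add: \<gamma>_def s'(3)[symmetric])
      moreover have "?z \<in> sphere 0 1" by simp
      ultimately show "y \<in> \<gamma> ` sphere 0 1" by (metis image_eqI)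
    qed
  qed
  define R where "R z = of_real (norm z) * \<gamma> (sgn z)" for z
  note R = radial_extension[OF \<gamma>1 \<gamma>2 \<gamma>3, folded R_def]
  have f: "continuous_on (cball 0 1) f" "inj_on f (cball 0 1)" "f ` cball 0 1 = plane t"
    using h by (auto simp: homeomorphism_def intro: inj_on_inverseI)
  have "\<exists>k. homeomorphism (cball 0 1) (plane t) (f \<circ> R) k"
  proof (rule homeomorphism_compact[OF compact_cball])
    show "continuous_on (cball 0 1) (f \<circ> R)" using R(1,3) f(1) by (intro continuous_on_compose) auto
    show "(f \<circ> R) ` cball 0 1 = plane t" using R(3) f(3) by (metis image_comp)
    show "inj_on (f \<circ> R) (cball 0 1)" using R(2,3) f(2) by (intro comp_inj_on) auto
  qed
  moreover have "(f \<circ> R) (exp (- (2 * of_real pi * of_real s * \<i>))) = ?L s" if s: "s \<in> {0..1}" for s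
  proof -
    let ?z = "exp (- (2 * of_real pi * of_real s * \<i>))"
    have "?L (a ?z) = ?L s"
    proof (cases "s < 1")
      case True
      then show ?thesis using Arg2pi_clockwise[of s] s by (simp add: a_def)
    next
      case False
      then have "s = 1" using s by simp
      moreover have "exp (- (2 * of_real pi * \<i>)) = (1 :: complex)"
        using exp_integer_2pi[of "-1"] by (simp add: mult.commute)
      ultimately have "a ?z = 0" by (simp add: a_def Arg2pi_eq_0)
      then show ?thesis using L(2) \<open>s = 1\<close> by (simp add: pathfinish_def pathstart_def)
    qed
    moreover have "R ?z = \<gamma> ?z" by (rule R(4)) simp
    ultimately show ?thesis using fg[of "?L s"] La[of ?z] sphere_plane by (auto simp: \<gamma>_def)
  qed
  ultimately show ?thesis unfolding tile_chart_def by blast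
qed

text \<open>A rotation moves the basepoint into place. The boundary of the chart is then a simple
  closed curve around \<open>f 0\<close>, with winding number 1 or -1; in the latter case complex
  conjugation, which fixes 1, reverses it.\<close>

lemma region_chart_exists:
  assumes \<Gamma>: "\<Gamma> \<in> disk_regions" and b: "lat b \<in> frontier (plane \<Gamma>)"
  shows "\<exists>\<phi>. region_chart \<Gamma> b \<phi>"
proof -
  obtain f g where "homeomorphism (plane \<Gamma>) (cball (0::complex) 1) g f"
    using \<Gamma> unfolding disk_regions_def homeomorphic_def by blast
  then have h: "homeomorphism (cball 0 1) (plane \<Gamma>) f g" by (rule homeomorphism_symD)
  have f: "continuous_on (cball 0 1) f" "inj_on f (cball 0 1)" "f ` cball 0 1 = plane \<Gamma>"
    using h by (auto simp: homeomorphism_def intro: inj_on_inverseI)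
  obtain a where a: "norm a = 1" "f a = lat b"
    using b unfolding homeomorphism_cball_frontier[OF h] by auto
  have a0: "a \<noteq> 0" using a by auto
  have rot: "\<exists>k. homeomorphism (cball 0 1) (plane \<Gamma>) (f \<circ> m) k"
    if m: "continuous_on (cball 0 1) m" "m ` cball 0 1 = cball 0 1" "inj_on m (cball 0 1)" for m :: "complex \<Rightarrow> complex"
  proof (rule homeomorphism_compact[OF compact_cball])
    show "continuous_on (cball 0 1) (f \<circ> m)" using m f(1) by (intro continuous_on_compose) auto
    show "(f \<circ> m) ` cball 0 1 = plane \<Gamma>" using m(2) f(3) by (metis image_comp)
    show "inj_on (f \<circ> m) (cball 0 1)" using m f(2) by (intro comp_inj_on) auto
  qed
  have surj: "(\<lambda>z. a * z) ` cball 0 1 = cball 0 1"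
  proof
    show "cball 0 1 \<subseteq> (\<lambda>z. a * z) ` cball 0 1"
    proof
      fix w :: complex assume "w \<in> cball 0 1"
      then show "w \<in> (\<lambda>z. a * z) ` cball 0 1"
        using a a0 by (intro image_eqI[of _ _ "w / a"]) (auto simp: norm_divide)
    qed
  qed (use a in \<open>auto simp: norm_mult\<close>)
  let ?m1 = "\<lambda>z. a * z" and ?m2 = "\<lambda>z. a * cnj z"
  have m1: "\<exists>k. homeomorphism (cball 0 1) (plane \<Gamma>) (f \<circ> ?m1) k"
    using surj a0 by (intro rot) (auto intro!: continuous_intros inj_onI)
  have m2: "\<exists>k. homeomorphism (cball 0 1) (plane \<Gamma>) (f \<circ> ?m2) k"
  proof (rule rot)
    have "cnj ` cball 0 1 = cball 0 1"
      by (auto intro!: image_eqI[of _ _ "cnj _"])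
    then show "?m2 ` cball 0 1 = cball 0 1" using surj by (metis image_image)
  qed (use a0 in \<open>auto intro!: continuous_intros inj_onI\<close>)
  let ?c = "(f \<circ> ?m1) \<circ> circlepath 0 1"
  obtain k where k: "homeomorphism (cball 0 1) (plane \<Gamma>) (f \<circ> ?m1) k" using m1 by blast
  have k1: "continuous_on (cball 0 1) (f \<circ> ?m1)" "inj_on (f \<circ> ?m1) (cball 0 1)"
    using homeomorphism_cont1[OF k] inj_on_inverseI[of "cball 0 1" k "f \<circ> ?m1"] homeomorphism_apply1[OF k] by metis+
  have pi: "path_image (circlepath (0::complex) 1) = sphere 0 1" by simp
  have simple: "simple_path ?c"
    using k1 by (intro simple_path_continuous_image) (auto simp: simple_path_circlepath intro: continuous_on_subset inj_on_subset)
  have img: "path_image ?c = frontier (plane \<Gamma>)"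
    unfolding path_image_compose pi homeomorphism_cball_frontier[OF k] ..
  have "bounded (plane \<Gamma>)"
    using f compact_continuous_image[OF f(1)] by (auto intro: compact_imp_bounded)
  then have "f 0 \<in> inside (path_image ?c)"
    using interior_inside_frontier[of "plane \<Gamma>"] homeomorphism_cball_interior(2)[OF h] unfolding img by auto
  then consider "winding_number ?c (f 0) = 1" | "winding_number ?c (f 0) = -1"
    using simple_closed_path_winding_number_inside[OF simple] by metis
  then show ?thesis
  proof cases
    case 1
    then have "region_chart \<Gamma> b (f \<circ> ?m1)" using m1 a by (auto simp: region_chart_def)
    then show ?thesis by blast
  next
    case 2
    have "((f \<circ> ?m2) \<circ> circlepath 0 1) s = reversepath ?c s" for s
    proof -
      have "exp (2 * of_real pi * \<i> * of_real (1 - s)) = cnj (exp (2 * of_real pi * \<i> * of_real s))"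
        by (simp add: exp_cnj exp_eq) (intro exI[of _ 1], simp add: algebra_simps)
      then show ?thesis by (simp add: circlepath reversepath_def)
    qed
    then have "winding_number ((f \<circ> ?m2) \<circ> circlepath 0 1) (f 0) = winding_number (reversepath ?c) (f 0)"
      by (intro winding_number_cong) auto
    also have "\<dots> = - winding_number ?c (f 0)"
      using \<open>f 0 \<in> inside _\<close> inside_no_overlap[of "path_image ?c"]
      by (intro winding_number_reversepath simple_path_imp_path[OF simple]) blast
    also have "\<dots> = 1" using 2 by simp
    finally have "region_chart \<Gamma> b (f \<circ> ?m2)" using m2 a by (auto simp: region_chart_def)
    then show ?thesis by blast
  qed
qed

section \<open>The Hurewicz image\<close>

text \<open>The product is the juxtaposition of the map of \<alpha> with the mirrored map of
  \<beta>, both pulled back by \<open>square_to_disk\<close>; mirroring turns the second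
  contribution into its inverse.\<close>

theorem (in tiled_complex) product_class:
  assumes T: "T \<subseteq> disk_regions" and \<Gamma>: "\<Gamma> \<in> disk_regions"
    and tilings: "is_tiling T \<Gamma> \<alpha>" "is_tiling T \<Gamma> \<beta>" and \<phi>: "region_chart \<Gamma> b \<phi>"
    and iso: "\<Psi> \<in> iso (free_Abelian_group T) H2" and frag: "\<And>t. t \<in> T \<Longrightarrow> \<Psi> (frag_of t) = face_class t"
  defines "f \<equiv> product_with_mirror \<phi> (tiling_map r \<kappa> \<alpha>) (tiling_map r \<kappa> \<beta>)"
  shows "f \<in> spheroids X Vertex"
    and "hom_induced 2 (top_of_set square) square_boundary X skeleton1 f fundamental_class
      = \<Psi> (count_vector T \<alpha> - count_vector T \<beta>)"
proof -
  have fin: "finite \<Gamma>" using \<Gamma> by (simp add: disk_regions_def)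
  interpret a: tiling T p r \<kappa> \<Gamma> \<alpha> using tilings fin T by unfold_locales
  interpret b: tiling T p r \<kappa> \<Gamma> \<beta> using tilings fin T by unfold_locales
  let ?Sq = "top_of_set square" let ?bd = square_boundary
  let ?D = "top_of_set (cball (0::complex) 1)" and ?S = "sphere (0::complex) 1"
  let ?C = square_to_disk
  interpret C: cell_attachment supnorm ?D ?S ?C by (rule square_to_disk_attachment)
  obtain \<phi>' where h: "homeomorphism (cball 0 1) (plane \<Gamma>) \<phi> \<phi>'" using \<phi> by (auto simp: region_chart_def)
  have \<phi>P: "continuous_map ?D (top_of_set (plane \<Gamma>)) \<phi>" using h by (auto simp: homeomorphism_def)
  have on_K: "a.A (\<phi> z) = grid_point (\<phi> z)" "b.A (\<phi> z) = grid_point (\<phi> z)" "a.A (\<phi> z) \<in> skeleton1" "b.A (\<phi> z) \<in> skeleton1"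
    if "z \<in> ?S" for z
  proof -
    have "\<phi> z \<in> a.K" "\<phi> z \<in> b.K" using a.region_boundary_K[OF h] b.region_boundary_K[OF h] that by auto
    then show "a.A (\<phi> z) = grid_point (\<phi> z)" "b.A (\<phi> z) = grid_point (\<phi> z)" "a.A (\<phi> z) \<in> skeleton1" "b.A (\<phi> z) \<in> skeleton1"
      using a.A_K b.A_K by simp_all
  qed
  have V: "a.A (\<phi> 1) = Vertex" "b.A (\<phi> 1) = Vertex"
    using on_K[of 1] \<phi> by (auto simp: region_chart_def grid_point_def lat_Ints)
  have C: "continuous_map ?Sq ?D ?C" "?C \<in> ?bd \<rightarrow> ?S"
    using C.cont C.rim_A by (auto simp: sq_cell sq_rim)
  have mir: "continuous_map ?Sq ?Sq mirror" "mirror \<in> ?bd \<rightarrow> ?bd"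
    using mirror_mem by (auto simp: continuous_mirror)
  let ?F = "(a.A \<circ> \<phi>) \<circ> ?C" and ?G = "(b.A \<circ> \<phi>) \<circ> ?C"
  have Ac: "continuous_map ?D X (a.A \<circ> \<phi>)" "continuous_map ?D X (b.A \<circ> \<phi>)"
    using continuous_map_compose[OF \<phi>P] a.continuous_map_A b.continuous_map_A by blast+
  have AS: "a.A \<circ> \<phi> \<in> ?S \<rightarrow> skeleton1" "b.A \<circ> \<phi> \<in> ?S \<rightarrow> skeleton1" using on_K by auto
  have F: "continuous_map ?Sq X ?F" "?F \<in> ?bd \<rightarrow> skeleton1" 
    using continuous_map_compose[OF C(1) Ac(1)] C(2) AS(1) by (auto simp: Pi_iff)
  have G: "continuous_map ?Sq X ?G" "?G \<in> ?bd \<rightarrow> skeleton1" 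
    using continuous_map_compose[OF C(1) Ac(2)] C(2) AS(2) by (auto simp: Pi_iff)
  have Gm: "continuous_map ?Sq X (?G \<circ> mirror)" "?G \<circ> mirror \<in> ?bd \<rightarrow> skeleton1"
    using continuous_map_compose[OF mir(1) G(1)] mir(2) G(2) by (auto simp: Pi_iff)
  \<comment> \<open>The seam lies over the boundary of the region, where either tiling map is
    \<open>grid_point\<close>.\<close>
  have FG: "?F (1, y) = (?G \<circ> mirror) (-1, y)" if "y \<in> {-1..1}" for y
  proof -
    have "?C (1, y) \<in> ?S" using that C(2) by (auto simp: Pi_iff square_boundary_iff square_iff)
    then show ?thesis using on_K by (simp add: mirror_def)
  qed
  have f: "f = juxtapose ?F (?G \<circ> mirror)"
    by (auto simp: f_def product_with_mirror_def juxtapose_def square_to_disk_def mirror_def fun_eq_iff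
        add_divide_distrib diff_divide_distrib)
  have "f z = Vertex" if "z \<in> ?bd" for z
  proof -
    obtain x y where z: "z = (x, y)" by fastforce
    have "cone_map (if x \<le> 0 then 1 + x else 1 - x) y = 1"
      using that by (auto simp: z square_boundary_iff cone_map_eq circle_point_ends)
    then show ?thesis using V by (auto simp: f_def product_with_mirror_def z split: if_splits)
  qed
  moreover have "continuous_map ?Sq X f"
    unfolding f by (rule continuous_juxtapose[OF F(1) Gm(1) FG])
  ultimately show "f \<in> spheroids X Vertex" by (auto simp: spheroids_iff)
  have c: "fundamental_class \<in> carrier square_group" by (rule fundamental_class)
  have "hom_induced 2 ?Sq ?bd X skeleton1 f fundamental_class
    = hom_induced 2 ?Sq ?bd X skeleton1 ?F fundamental_class \<otimes>\<^bsub>H2\<^esub>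
      hom_induced 2 ?Sq ?bd X skeleton1 (?G \<circ> mirror) fundamental_class"
    unfolding f by (rule hom_induced_juxtapose[OF F Gm FG c])
  also have "hom_induced 2 ?Sq ?bd X skeleton1 ?F fundamental_class = \<Psi> (count_vector T \<alpha>)"
    using hom_induced_compose'[OF C Ac(1) AS(1), of 2 fundamental_class] a.tiling_class[OF \<phi> iso frag]
    by (simp add: disk_class_def)
  also have "hom_induced 2 ?Sq ?bd X skeleton1 (?G \<circ> mirror) fundamental_class
      = hom_induced 2 ?Sq ?bd X skeleton1 ?G (inv\<^bsub>square_group\<^esub> fundamental_class)"
    unfolding hom_induced_mirror[OF c, symmetric] by (rule hom_induced_compose'[OF mir G, symmetric])
  also have "\<dots> = inv\<^bsub>H2\<^esub> (hom_induced 2 ?Sq ?bd X skeleton1 ?G fundamental_class)"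
  proof -
    interpret group_hom square_group H2 "hom_induced 2 ?Sq ?bd X skeleton1 ?G"
      by (simp add: group_hom_def group_hom_axioms_def hom_induced_hom)
    show ?thesis by (rule hom_inv[OF c])
  qed
  also have "hom_induced 2 ?Sq ?bd X skeleton1 ?G fundamental_class = \<Psi> (count_vector T \<beta>)"
    using hom_induced_compose'[OF C Ac(2) AS(2), of 2 fundamental_class] b.tiling_class[OF \<phi> iso frag]
    by (simp add: disk_class_def)
  also have "\<Psi> (count_vector T \<alpha>) \<otimes>\<^bsub>H2\<^esub> inv\<^bsub>H2\<^esub> \<Psi> (count_vector T \<beta>) = \<Psi> (count_vector T \<alpha> - count_vector T \<beta>)"
  proof -
    interpret P: group_hom "free_Abelian_group T" H2 \<Psi>
      using iso by (simp add: group_hom_def group_hom_axioms_def iso_def)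
    show ?thesis
      using P.hom_mult[of "count_vector T \<alpha>" "- count_vector T \<beta>"] P.hom_inv[of "count_vector T \<beta>"]
        a.keys_count_vector b.keys_count_vector by simp
  qed
  finally show "hom_induced 2 ?Sq ?bd X skeleton1 f fundamental_class = \<Psi> (count_vector T \<alpha> - count_vector T \<beta>)" .
qed

text \<open>\<open>hurewicz\<close> picks some representative of the class; homotopic spheroids
  induce the same map, so any representative will do.\<close>

lemma hurewicz_pi2_class:
  assumes f: "f \<in> spheroids (presentation_complex I r) Vertex"
  shows "hurewicz I r (pi2_class (presentation_complex I r) Vertex f)
    = hom_induced 2 (top_of_set square) square_boundary (presentation_complex I r) skeleton1 f fundamental_class"
proof -
  let ?X = "presentation_complex I r" and ?Sq = "top_of_set square" and ?bd = square_boundary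
  define g where "g = (SOME g. g \<in> pi2_class ?X Vertex f)"
  have g: "g \<in> pi2_class ?X Vertex f" unfolding g_def by (rule someI[where P = "\<lambda>g. g \<in> pi2_class ?X Vertex f", OF mem_pi2_class[OF f]])
  have "homotopic_with (\<lambda>h. h \<in> ?bd \<rightarrow> skeleton0) ?Sq ?X f g"
    by (rule homotopic_with_mono[OF pi2_class_mem(2)[OF g]]) (auto simp: skeleton0_def)
  then have "hom_induced 2 ?Sq ?bd ?X skeleton0 g = hom_induced 2 ?Sq ?bd ?X skeleton0 f"
    by (simp add: homology_homotopy_axiom)
  then have "hurewicz I r (pi2_class ?X Vertex f)
      = hom_induced 2 ?X skeleton0 ?X skeleton1 id (hom_induced 2 ?Sq ?bd ?X skeleton0 f fundamental_class)"
    by (simp add: hurewicz_def Let_def g_def)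
  also have "\<dots> = hom_induced 2 ?Sq ?bd ?X skeleton1 f fundamental_class"
    using f by (subst hom_induced_compose') (auto simp: spheroids_iff skeleton0_def skeleton1_def)
  finally show ?thesis .
qed

lemma Vertex_topspace: "Vertex \<in> topspace (presentation_complex I r)"
  by (simp add: topspace_presentation_complex complex_points_def skeleton1_def)

lemma hurewicz_hom:
  "hurewicz I r \<in> hom (pi2 (presentation_complex I r) Vertex) (relative_homology_group 2 (presentation_complex I r) skeleton1)"
proof (rule homI)
  let ?X = "presentation_complex I r" and ?Sq = "top_of_set square" and ?bd = square_boundary
  fix A assume "A \<in> carrier (pi2 ?X Vertex)"
  then obtain f where f: "f \<in> spheroids ?X Vertex" "A = pi2_class ?X Vertex f" by (auto simp: carrier_pi2)
  then show "hurewicz I r A \<in> carrier (relative_homology_group 2 ?X skeleton1)"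
    by (simp add: hurewicz_pi2_class hom_induced_carrier)
  fix B assume "B \<in> carrier (pi2 ?X Vertex)"
  then obtain g where g: "g \<in> spheroids ?X Vertex" "B = pi2_class ?X Vertex g" by (auto simp: carrier_pi2)
  have "hom_induced 2 ?Sq ?bd ?X skeleton1 (juxtapose f g) fundamental_class
      = hom_induced 2 ?Sq ?bd ?X skeleton1 f fundamental_class
        \<otimes>\<^bsub>relative_homology_group 2 ?X skeleton1\<^esub> hom_induced 2 ?Sq ?bd ?X skeleton1 g fundamental_class"
  proof (rule hom_induced_juxtapose(1))
    show "f (1, y) = g (-1, y)" if "y \<in> {-1..1}" for y
      using that f g by (simp add: spheroid_boundary square_boundary_iff square_iff)
    show "f \<in> ?bd \<rightarrow> skeleton1" "g \<in> ?bd \<rightarrow> skeleton1"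
      using f g by (auto simp: spheroid_boundary skeleton1_def)
  qed (use f g fundamental_class(1) in \<open>simp_all add: spheroids_iff\<close>)
  then show "hurewicz I r (A \<otimes>\<^bsub>pi2 ?X Vertex\<^esub> B)
      = hurewicz I r A \<otimes>\<^bsub>relative_homology_group 2 ?X skeleton1\<^esub> hurewicz I r B"
    using f g by (simp add: pi2_mult hurewicz_pi2_class juxtapose_spheroid)
qed

lemma hurewicz_pi1_action:
  assumes A: "A \<in> carrier (pi2 (presentation_complex I r) Vertex)" and \<gamma>: "\<gamma> \<in> loops (presentation_complex I r) Vertex"
  shows "pi1_action (presentation_complex I r) Vertex \<gamma> A \<in> carrier (pi2 (presentation_complex I r) Vertex)"
    and "hurewicz I r (pi1_action (presentation_complex I r) Vertex \<gamma> A) = hurewicz I r A"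
proof -
  let ?X = "presentation_complex I r" and ?Sq = "top_of_set square" and ?bd = square_boundary
  obtain f where f: "f \<in> spheroids ?X Vertex" "A = pi2_class ?X Vertex f" using A by (auto simp: carrier_pi2)
  have tr: "transport \<gamma> f \<in> spheroids ?X Vertex" by (rule transport_spheroid[OF f(1) \<gamma>])
  show "pi1_action ?X Vertex \<gamma> A \<in> carrier (pi2 ?X Vertex)"
    using tr by (simp add: f(2) pi1_action_class[OF f(1) \<gamma>] carrier_pi2)
  \<comment> \<open>Factors through the pair with the vertex, for which invariance under transport
    was proved.\<close>
  have "hom_induced 2 ?Sq ?bd ?X skeleton1 g fundamental_class
      = hom_induced 2 ?X {Vertex} ?X skeleton1 id (hom_induced 2 ?Sq ?bd ?X {Vertex} g fundamental_class)"
    if "g \<in> spheroids ?X Vertex" for g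
    using that by (subst hom_induced_compose') (auto simp: spheroids_iff skeleton1_def)
  then show "hurewicz I r (pi1_action ?X Vertex \<gamma> A) = hurewicz I r A"
    using f(1) tr by (simp add: f(2) pi1_action_class[OF f(1) \<gamma>] hurewicz_pi2_class hom_induced_transport[OF f(1) \<gamma>])
qed

text \<open>The preimage \<open>J0\<close> of the span of the images is a submodule, because
  Hurewicz classes are invariant under the action; so it contains the generated submodule.
  Conversely, the image of the latter is a subgroup containing the images of the generators.\<close>

lemma hurewicz_generated_submodule:
  fixes I :: "'i set" and r
  defines "P \<equiv> pi2 (presentation_complex I r) Vertex"
    and "H \<equiv> relative_homology_group 2 (presentation_complex I r) skeleton1"
  assumes S: "S \<subseteq> carrier P"
  shows "hurewicz I r ` generated_submodule (presentation_complex I r) Vertex S = generate H (hurewicz I r ` S)"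
proof -
  let ?X = "presentation_complex I r" let ?h = "hurewicz I r"
  interpret P: group P unfolding P_def by (rule group_pi2[OF Vertex_topspace])
  interpret H: comm_group H unfolding H_def by simp
  interpret h: group_hom P H ?h
    by (simp add: group_hom_def group_hom_axioms_def P.is_group H.is_group) (simp add: P_def H_def hurewicz_hom)
  have hS: "?h ` S \<subseteq> carrier H" using S h.hom_closed by auto
  let ?I = "generate H (?h ` S)"
  have I: "subgroup ?I H" by (rule H.generate_is_subgroup[OF hS])
  define J0 where "J0 = {A \<in> carrier P. ?h A \<in> ?I}"
  have "subgroup J0 P"
    unfolding J0_def using I h.hom_one
    by (intro P.subgroupI) (auto simp: subgroup.m_closed subgroup.m_inv_closed subgroup.one_closed intro: exI[of _ "\<one>\<^bsub>P\<^esub>"])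
  then have J0: "pi2_submodule ?X Vertex J0"
    using hurewicz_pi1_action[of _ I r] by (simp add: pi2_submodule_def J0_def P_def)
  have SJ0: "S \<subseteq> J0" using S generate.incl[of _ "?h ` S" H] by (auto simp: J0_def)
  let ?J = "generated_submodule ?X Vertex S"
  have "?J \<subseteq> J0" unfolding generated_submodule_def using J0 SJ0 by blast
  then have "?h ` ?J \<subseteq> ?I" by (auto simp: J0_def)
  \<comment> \<open>\<open>J0\<close> also shows that the family being intersected is not
    empty.\<close>
  moreover have J: "subgroup ?J P"
    unfolding generated_submodule_def
    by (rule P.subgroups_Inter) (use J0 SJ0 in \<open>auto simp: pi2_submodule_def P_def\<close>)
  have "subgroup (?h ` ?J) H" by (rule h.subgroup_img_is_subgroup[OF J])
  moreover have "S \<subseteq> ?J" by (auto simp: generated_submodule_def)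
  ultimately show ?thesis by (meson H.generate_subgroup_incl image_mono subset_antisym)
qed

text \<open>The first isomorphism theorem for \<Psi> followed by the projection, whose kernel is
  \<open>N\<close> since \<Psi> is injective.\<close>

lemma iso_imp_iso_Mod:
  assumes iso: "\<Psi> \<in> iso F H" and F: "comm_group F" and H: "comm_group H" and N: "subgroup N F"
  shows "F Mod N \<cong> H Mod (\<Psi> ` N)"
proof -
  interpret F: comm_group F by fact
  interpret H: comm_group H by fact
  interpret P: group_hom F H \<Psi> using iso by (simp add: group_hom_def group_hom_axioms_def iso_def)
  have inj: "inj_on \<Psi> (carrier F)" and surj: "\<Psi> ` carrier F = carrier H"
    using iso by (auto simp: iso_def bij_betw_def)
  let ?M = "\<Psi> ` N"
  have M: "subgroup ?M H" by (rule P.subgroup_img_is_subgroup[OF N])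
  then interpret M: normal ?M H by (rule H.normal_iff_subgroup[THEN iffD2])
  let ?q = "(\<lambda>a. ?M #>\<^bsub>H\<^esub> a) \<circ> \<Psi>"
  have "?q \<in> hom F (H Mod ?M)" by (rule hom_compose[OF P.homh M.r_coset_hom_Mod])
  then interpret q: group_hom F "H Mod ?M" ?q
    by (simp add: group_hom_def group_hom_axioms_def M.factorgroup_is_group F.is_group)
  have NF: "N \<subseteq> carrier F" using N by (rule subgroup.subset)
  have "?q x = ?M \<longleftrightarrow> x \<in> N" if x: "x \<in> carrier F" for x
  proof -
    have "?q x = ?M \<longleftrightarrow> \<Psi> x \<in> ?M"
      using H.coset_join1[of ?M "\<Psi> x"] H.coset_join2[of "\<Psi> x" ?M] P.hom_closed[OF x] M by auto
    also have "\<dots> \<longleftrightarrow> x \<in> N" using inj x NF by (rule inj_on_image_mem_iff)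
    finally show ?thesis .
  qed
  then have "kernel F (H Mod ?M) ?q = N" using NF by (auto simp: kernel_def)
  moreover have "?q ` carrier F = carrier (H Mod ?M)"
    unfolding image_comp[symmetric] surj by (auto simp: FactGroup_def RCOSETS_def)
  ultimately show ?thesis using q.FactGroup_iso by simp
qed

theorem theorem3p1:
  fixes T :: "cells set"
    and p :: "cells \<Rightarrow> int \<times> int"
    and r :: "cells \<Rightarrow> word"
    and b :: "cells \<Rightarrow> int \<times> int"
  assumes "finite T"
    and "T \<subseteq> disk_regions"
    and "\<And>t. t \<in> T \<Longrightarrow> boundary_word t (p t) (r t)"
    and "\<And>\<Gamma>. \<Gamma> \<in> disk_regions \<Longrightarrow> lat (b \<Gamma>) \<in> frontier (plane \<Gamma>)"
  shows "tile_counting_group T disk_regions \<cong>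
           (cellular_H2 T r Mod (hurewicz T r ` tiling_submodule T disk_regions p r b))"
proof -
  have "\<exists>\<kappa>. t \<in> T \<longrightarrow> tile_chart t (p t) (r t) \<kappa>" for t
    using tile_chart_exists assms(2,3) by blast
  then obtain \<kappa> where \<kappa>: "\<And>t. t \<in> T \<Longrightarrow> tile_chart t (p t) (r t) (\<kappa> t)" by metis
  interpret charted_complex T p r \<kappa> using assms(1) \<kappa> by unfold_locales
  obtain \<Psi> where iso: "\<Psi> \<in> iso (free_Abelian_group T) H2"
    and frag: "\<And>t. t \<in> T \<Longrightarrow> \<Psi> (frag_of t) = face_class t" using H2_basis by blast
  let ?F = "free_Abelian_group T" and ?R = disk_regions
  let ?D = "{count_vector T \<alpha> - count_vector T \<beta> | \<alpha> \<beta> \<Gamma>. \<Gamma> \<in> ?R \<and> is_tiling T \<Gamma> \<alpha> \<and> is_tiling T \<Gamma> \<beta>}"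
  let ?S = "tiling_pair_classes T ?R p r b"
  \<comment> \<open>The generators range over all charts \<kappa>', whereas \<Psi> was built from
    the single choice \<kappa>. One \<Psi> serves them all, as \<open>H2\<close> and
    \<open>face_class\<close> depend only on \<open>T\<close> and \<open>r\<close>.\<close>
  have tiling_pair: "pi2_class X Vertex (product_with_mirror \<phi> (tiling_map r \<kappa>' \<alpha>) (tiling_map r \<kappa>' \<beta>)) \<in> carrier (pi2 X Vertex)"
      "hurewicz T r (pi2_class X Vertex (product_with_mirror \<phi> (tiling_map r \<kappa>' \<alpha>) (tiling_map r \<kappa>' \<beta>)))
        = \<Psi> (count_vector T \<alpha> - count_vector T \<beta>)"
    if "\<Gamma> \<in> ?R" "is_tiling T \<Gamma> \<alpha>" "is_tiling T \<Gamma> \<beta>"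
      "\<forall>t\<in>T. tile_chart t (p t) (r t) (\<kappa>' t)" "region_chart \<Gamma> (b \<Gamma>) \<phi>" for \<kappa>' \<phi> \<alpha> \<beta> \<Gamma>
  proof -
    interpret K: tiled_complex T p r \<kappa>' using assms(1,3) that(4) by unfold_locales auto
    note * = K.product_class[OF assms(2) that(1,2,3,5) iso frag]
    show "pi2_class X Vertex (product_with_mirror \<phi> (tiling_map r \<kappa>' \<alpha>) (tiling_map r \<kappa>' \<beta>)) \<in> carrier (pi2 X Vertex)"
      using *(1) by (simp add: carrier_pi2)
    show "hurewicz T r (pi2_class X Vertex (product_with_mirror \<phi> (tiling_map r \<kappa>' \<alpha>) (tiling_map r \<kappa>' \<beta>)))
        = \<Psi> (count_vector T \<alpha> - count_vector T \<beta>)"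
      by (rule trans[OF hurewicz_pi2_class[OF *(1)] *(2)])
  qed
  have "hurewicz T r ` ?S = \<Psi> ` ?D"
  proof
    show "hurewicz T r ` ?S \<subseteq> \<Psi> ` ?D"
    proof
      fix y assume "y \<in> hurewicz T r ` ?S"
      then obtain \<kappa>' \<phi> \<alpha> \<beta> \<Gamma> where *: "\<Gamma> \<in> ?R" "is_tiling T \<Gamma> \<alpha>" "is_tiling T \<Gamma> \<beta>"
          "\<forall>t\<in>T. tile_chart t (p t) (r t) (\<kappa>' t)" "region_chart \<Gamma> (b \<Gamma>) \<phi>"
          "y = hurewicz T r (pi2_class X Vertex (product_with_mirror \<phi> (tiling_map r \<kappa>' \<alpha>) (tiling_map r \<kappa>' \<beta>)))"
        unfolding tiling_pair_classes_def by blast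
      then show "y \<in> \<Psi> ` ?D" using tiling_pair(2)[OF *(1-5)] by blast
    qed
    \<comment> \<open>Here charts must exist: without them a pair of tilings would give a relation
      but no spherical class.\<close>
    show "\<Psi> ` ?D \<subseteq> hurewicz T r ` ?S"
    proof
      fix y assume "y \<in> \<Psi> ` ?D"
      then obtain \<alpha> \<beta> \<Gamma> where *: "\<Gamma> \<in> ?R" "is_tiling T \<Gamma> \<alpha>" "is_tiling T \<Gamma> \<beta>"
          "y = \<Psi> (count_vector T \<alpha> - count_vector T \<beta>)" by blast
      obtain \<phi> where \<phi>: "region_chart \<Gamma> (b \<Gamma>) \<phi>" using region_chart_exists *(1) assms(4) by blast
      have charts: "\<forall>t\<in>T. tile_chart t (p t) (r t) (\<kappa> t)" using \<kappa> by blast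
      have "pi2_class X Vertex (product_with_mirror \<phi> (tiling_map r \<kappa> \<alpha>) (tiling_map r \<kappa> \<beta>)) \<in> ?S"
        unfolding tiling_pair_classes_def using * charts \<phi> by blast
      then show "y \<in> hurewicz T r ` ?S" using tiling_pair(2)[OF *(1-3) charts \<phi>] *(4) by (metis image_eqI)
    qed
  qed
  moreover have "?S \<subseteq> carrier (pi2 X Vertex)"
    unfolding tiling_pair_classes_def using tiling_pair(1) by blast
  ultimately have image: "hurewicz T r ` tiling_submodule T ?R p r b = generate H2 (\<Psi> ` ?D)"
    unfolding tiling_submodule_def by (simp add: hurewicz_generated_submodule)
  interpret P: group_hom ?F H2 \<Psi> using iso by (simp add: group_hom_def group_hom_axioms_def iso_def)
  have D: "?D \<subseteq> carrier ?F"
  proof -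
    have "Poly_Mapping.keys (count_vector T \<alpha>) \<subseteq> T" for \<alpha>
    proof -
      have "count_vector T \<alpha> \<in> carrier ?F"
        unfolding count_vector_def
      proof (rule sum_closed_free_Abelian_group)
        fix t assume "t \<in> T"
        then show "frag_cmul (int (tile_count \<alpha> t)) (frag_of t) \<in> carrier ?F"
          using keys_cmul[of "int (tile_count \<alpha> t)" "frag_of t"] by auto
      qed
      then show ?thesis by simp
    qed
    then show ?thesis using keys_diff by fastforce
  qed
  have "?F Mod generate ?F ?D \<cong> H2 Mod (\<Psi> ` generate ?F ?D)"
    using iso abelian_free_Abelian_group abelian_relative_homology_group
    by (rule iso_imp_iso_Mod) (rule group.generate_is_subgroup[OF group_free_Abelian_group D])
  also have "\<Psi> ` generate ?F ?D = generate H2 (\<Psi> ` ?D)" by (rule P.generate_img[OF D, symmetric])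
  finally show ?thesis
    unfolding tile_counting_group_def cellular_H2_eq image .
qed

end
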